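(* Let $f_1,\ldots,f_r$ be distinct irreducible monic polynomials with integer coefficients, let $e_1,\ldots,e_r$ be positive integers, and put $m=\prod_i f_i$, $c=\prod_i f_i^{e_i}$. The association $\Phi: I\mapsto [A(I,\bar w)]_{\sim_{\mathbb Z}}$, where $\bar w$ is any $\mathbb{Z}$-basis of $I$, induces a bijection $$\tilde\Phi:\ \mathcal{L}(R,K)/\simeq_R\ \longrightarrow\ \mathcal{M}_{m,c}(\mathbb{Z})/\sim_{\mathbb Z},\qquad \{I\}\longmapsto [A(I,\bar w)]_{\sim_{\mathbb Z}},$$ where $\simeq_R$ denotes isomorphism of $R$-modules.
   Context: Put $N=\deg c$. $\mathcal{M}_{m,c}(\mathbb{Z})$ is the set of $N\times N$ integer matrices with minimal polynomial $m$ and characteristic polynomial $c$. Two matrices $A,B\in \mathcal{M}_{m,c}(\mathbb{Z})$ are conjugate, $A\sim_{\mathbb Z}B$, if there is $O\in\mathrm{GL}_N(\mathbb{Z})$ with $OAO^{-1}=B$; $[A]_{\sim_{\mathbb Z}}$ is the conjugacy class of $A$. For $i=1,\ldots,r$ put $K_i=\mathbb{Q}[x]/(f_i)$, let $\Delta_i:K_i\to K_i^{e_i}$ be the diagonal embedding, let $K=\prod_i K_i^{e_i}$, and let $\Delta=\prod_i\Delta_i:\prod_i K_i\to K$. The ring $R_0=\mathbb{Z}[x]/(m)$ is an order with total quotient ring $\prod_i K_i$; let $R=\Delta(R_0)\subseteq K$ and $\alpha=\Delta(x \bmod m)$. $\mathcal{L}(R,K)$ is the set of full lattices in $K$ (finitely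 generated subgroups $I$ of $K$ with $I\otimes_{\mathbb Z}\mathbb{Q}=K$) that are $R$-modules under multiplication in $K$, and $\{I\}$ denotes the $R$-module isomorphism class of $I$. For $I\in\mathcal{L}(R,K)$ with $\mathbb{Z}$-basis $\bar w=\{w_1,\ldots,w_N\}$, $A(I,\bar w)\in\mathcal{M}_{m,c}(\mathbb{Z})$ is the integral matrix representing, with respect to $\bar w$, the endomorphism of $I$ given by multiplication by $\alpha$; that is, $A(I,\bar w)=(a_{h,k})$ with $\alpha w_k=\sum_{h=1}^N a_{h,k}w_h$. Changing the basis by $O\in\mathrm{GL}_N(\mathbb{Z})$ replaces $A$ by $O^{-1}AO$, so $[A(I,\bar w)]_{\sim_{\mathbb Z}}$ does not depend on $\bar w$. *)

theory Defs
  imports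
    "Jordan_Normal_Form.Char_Poly"
    "HOL-Algebra.Chinese_Remainder"
    "HOL-Algebra.Algebraic_Closure_Type"
begin

text \<open>Throughout, the polynomials \<open>f\<^sub>1, \<dots>, f\<^sub>r\<close> and the exponents \<open>e\<^sub>1, \<dots>, e\<^sub>r\<close> are given by
  functions \<open>f\<close>, \<open>e\<close> on the indices \<open>0, \<dots>, r - 1\<close>.\<close>

section \<open>Integer matrices with prescribed minimal and characteristic polynomial\<close>

definition mat_poly :: "'a :: comm_ring_1 poly \<Rightarrow> 'a mat \<Rightarrow> 'a mat" where
  "mat_poly p A = mat (dim_row A) (dim_row A)
     (\<lambda>(i, j). \<Sum>k\<le>Polynomial.degree p. Polynomial.coeff p k * (A ^\<^sub>m k) $$ (i, j))"

definition is_min_poly :: "'a :: field mat \<Rightarrow> 'a poly \<Rightarrow> bool" where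
  "is_min_poly A p \<longleftrightarrow>
     monic p \<and> mat_poly p A = 0\<^sub>m (dim_row A) (dim_row A) \<and>
     (\<forall>q. q \<noteq> 0 \<and> mat_poly q A = 0\<^sub>m (dim_row A) (dim_row A)
        \<longrightarrow> Polynomial.degree p \<le> Polynomial.degree q)"

text \<open>The minimal polynomial of an integer matrix is taken over the rationals.\<close>

definition int_matrices :: "int poly \<Rightarrow> int poly \<Rightarrow> int mat set" where
  "int_matrices m c =
     {A \<in> carrier_mat (Polynomial.degree c) (Polynomial.degree c).
        is_min_poly (map_mat rat_of_int A) (of_int_poly m) \<and> char_poly A = c}"

text \<open>Over \<^typ>\<open>int\<close>, \<^const>\<open>similar_mat\<close> asks for a conjugating matrix with a two-sided
  inverse having integer entries, i.e. for an element of \<open>GL\<^sub>N(\<int>)\<close>.\<close>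

definition int_conj_rel :: "int poly \<Rightarrow> int poly \<Rightarrow> int mat rel" where
  "int_conj_rel m c = {(A, B). A \<in> int_matrices m c \<and> B \<in> int_matrices m c \<and> similar_mat A B}"


section \<open>The algebra \<open>K\<close> and the order \<open>R\<close>\<close>

abbreviation QX :: "rat poly ring" where
  "QX \<equiv> ring_of_type_algebra"

abbreviation ZX :: "int poly ring" where
  "ZX \<equiv> ring_of_type_algebra"

definition Q_ideal :: "int poly \<Rightarrow> rat poly set" where
  "Q_ideal g = PIdl\<^bsub>QX\<^esub> (of_int_poly g)"

definition num_field :: "int poly \<Rightarrow> rat poly set ring" where
  "num_field g = QX Quot (Q_ideal g)"

text \<open>An element of \<open>K = \<Prod>\<^sub>i K\<^sub>i\<^bsup>e\<^sub>i\<^esup>\<close> is a list of lists: its \<open>i\<close>-th entry is the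
  \<open>K\<^sub>i\<^bsup>e\<^sub>i\<^esup>\<close>-component.\<close>

definition K_alg :: "nat \<Rightarrow> (nat \<Rightarrow> int poly) \<Rightarrow> (nat \<Rightarrow> nat) \<Rightarrow> rat poly set list list ring" where
  "K_alg r f e =
     RDirProd_list (map (\<lambda>i. RDirProd_list (replicate (e i) (num_field (f i)))) [0..<r])"

definition Delta :: "nat \<Rightarrow> (nat \<Rightarrow> nat) \<Rightarrow> 'a list \<Rightarrow> 'a list list" where
  "Delta r e xs = map (\<lambda>i. replicate (e i) (xs ! i)) [0..<r]"

text \<open>The canonical map \<open>\<rat>[x] \<rightarrow> \<Prod>\<^sub>i K\<^sub>i\<close>.\<close>

definition reduce :: "nat \<Rightarrow> (nat \<Rightarrow> int poly) \<Rightarrow> rat poly \<Rightarrow> rat poly set list" where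
  "reduce r f p = map (\<lambda>i. Q_ideal (f i) +>\<^bsub>QX\<^esub> p) [0..<r]"

definition Z_ideal :: "int poly \<Rightarrow> int poly set" where
  "Z_ideal g = PIdl\<^bsub>ZX\<^esub> g"

definition R0 :: "nat \<Rightarrow> (nat \<Rightarrow> int poly) \<Rightarrow> int poly set ring" where
  "R0 r f = ZX Quot (Z_ideal (\<Prod>i<r. f i))"

text \<open>The inclusion of \<open>R\<^sub>0 = \<int>[x]/(m)\<close> into its total quotient ring \<open>\<Prod>\<^sub>i K\<^sub>i\<close>: the map induced
  on cosets by \<^const>\<open>reduce\<close>, which is constant on each coset of \<open>(m)\<close>.\<close>

definition R0_incl :: "nat \<Rightarrow> (nat \<Rightarrow> int poly) \<Rightarrow> int poly set \<Rightarrow> rat poly set list" where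
  "R0_incl r f C = the_elem ((\<lambda>g. reduce r f (of_int_poly g)) ` C)"

definition R_order :: "nat \<Rightarrow> (nat \<Rightarrow> int poly) \<Rightarrow> (nat \<Rightarrow> nat) \<Rightarrow> rat poly set list list set" where
  "R_order r f e = (\<lambda>C. Delta r e (R0_incl r f C)) ` carrier (R0 r f)"

definition alpha :: "nat \<Rightarrow> (nat \<Rightarrow> int poly) \<Rightarrow> (nat \<Rightarrow> nat) \<Rightarrow> rat poly set list list" where
  "alpha r f e = Delta r e (R0_incl r f (Z_ideal (\<Prod>i<r. f i) +>\<^bsub>ZX\<^esub> [:0, 1:]))"


section \<open>Lattices\<close>

definition Q_embed ::
  "nat \<Rightarrow> (nat \<Rightarrow> int poly) \<Rightarrow> (nat \<Rightarrow> nat) \<Rightarrow> rat \<Rightarrow> rat poly set list list" where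
  "Q_embed r f e q = Delta r e (reduce r f [:q:])"

text \<open>As \<open>K\<close> is a \<open>\<rat>\<close>-vector space, \<open>I \<otimes> \<rat>\<close> embeds into \<open>K\<close> with image the subgroup generated
  by the products \<open>q w\<close> (\<open>q \<in> \<rat>\<close>, \<open>w \<in> I\<close>); \<open>I \<otimes> \<rat> = K\<close> says that this image is all of \<open>K\<close>.\<close>

definition full_lattice ::
  "nat \<Rightarrow> (nat \<Rightarrow> int poly) \<Rightarrow> (nat \<Rightarrow> nat) \<Rightarrow> rat poly set list list set \<Rightarrow> bool" where
  "full_lattice r f e I \<longleftrightarrow>
     subgroup I (add_monoid (K_alg r f e)) \<and>
     (\<exists>S. finite S \<and> S \<subseteq> I \<and> I = generate (add_monoid (K_alg r f e)) S) \<and>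
     generate (add_monoid (K_alg r f e)) {Q_embed r f e q \<otimes>\<^bsub>K_alg r f e\<^esub> w | q w. w \<in> I}
       = carrier (K_alg r f e)"

definition lattices ::
  "nat \<Rightarrow> (nat \<Rightarrow> int poly) \<Rightarrow> (nat \<Rightarrow> nat) \<Rightarrow> rat poly set list list set set" where
  "lattices r f e =
     {I. full_lattice r f e I \<and>
         (\<forall>\<rho>\<in>R_order r f e. \<forall>w\<in>I. \<rho> \<otimes>\<^bsub>K_alg r f e\<^esub> w \<in> I)}"

definition R_isomorphic :: "nat \<Rightarrow> (nat \<Rightarrow> int poly) \<Rightarrow> (nat \<Rightarrow> nat) \<Rightarrow>
    rat poly set list list set \<Rightarrow> rat poly set list list set \<Rightarrow> bool" where
  "R_isomorphic r f e I J \<longleftrightarrow>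
     (\<exists>\<phi> \<in> iso (add_monoid (K_alg r f e) \<lparr>carrier := I\<rparr>) (add_monoid (K_alg r f e) \<lparr>carrier := J\<rparr>).
        \<forall>\<rho>\<in>R_order r f e. \<forall>w\<in>I. \<phi> (\<rho> \<otimes>\<^bsub>K_alg r f e\<^esub> w) = \<rho> \<otimes>\<^bsub>K_alg r f e\<^esub> \<phi> w)"

definition R_iso_rel ::
  "nat \<Rightarrow> (nat \<Rightarrow> int poly) \<Rightarrow> (nat \<Rightarrow> nat) \<Rightarrow> rat poly set list list set rel" where
  "R_iso_rel r f e =
     {(I, J). I \<in> lattices r f e \<and> J \<in> lattices r f e \<and> R_isomorphic r f e I J}"


section \<open>The matrix of multiplication by \<open>\<alpha>\<close>\<close>

definition is_Z_basis :: "('a, 'b) ring_scheme \<Rightarrow> 'a set \<Rightarrow> 'a list \<Rightarrow> bool" where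
  "is_Z_basis K I ws \<longleftrightarrow>
     set ws \<subseteq> I \<and>
     (\<forall>v\<in>I. \<exists>!a :: int vec. a \<in> carrier_vec (length ws) \<and>
        v = (\<Oplus>\<^bsub>K\<^esub>k\<in>{..<length ws}. add_pow K (a $ k) (ws ! k)))"

definition mult_matrix ::
  "nat \<Rightarrow> (nat \<Rightarrow> int poly) \<Rightarrow> (nat \<Rightarrow> nat) \<Rightarrow> rat poly set list list list \<Rightarrow> int mat" where
  "mult_matrix r f e ws =
     (THE A. A \<in> carrier_mat (length ws) (length ws) \<and>
        (\<forall>k<length ws. alpha r f e \<otimes>\<^bsub>K_alg r f e\<^esub> ws ! k =
           (\<Oplus>\<^bsub>K_alg r f e\<^esub>h\<in>{..<length ws}. add_pow (K_alg r f e) (A $$ (h, k)) (ws ! h))))"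

end

theory Submission
  imports Defs "HOL-Library.Function_Algebras"
begin

text \<open>A \<open>\<int>\<close>-basis of \<open>I\<close> identifies \<open>I\<close>, with multiplication by \<open>\<alpha>\<close>, with \<open>\<int>\<^sup>N\<close>, with the action of \<open>A\<close>.
  As \<open>R = \<int>[\<alpha>]\<close>, an \<open>R\<close>-isomorphism between two lattices is a matrix in \<open>GL\<^sub>N(\<int>)\<close> intertwining their
  matrices. Tensoring with \<open>\<rat>\<close>, \<open>A\<close> occurs if and only if \<open>\<rat>\<^sup>N\<close>, on which \<open>x\<close> acts as \<open>A\<close>, is isomorphic to
  \<open>K\<close> as a \<open>\<rat>[x]\<close>-module. A module killed by the squarefree polynomial \<open>m\<close> is a direct sum of copies
  of the \<open>K\<^sub>i\<close>; in a basis adapted to this decomposition \<open>A\<close> becomes a block sum of companion matrices,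
  so the multiplicities are the exponents in the characteristic polynomial. Hence the condition says
  precisely that \<open>A\<close> has minimal polynomial \<open>m\<close> and characteristic polynomial \<open>c\<close>.\<close>

section \<open>Modules over Euclidean domains\<close>

text \<open>The size of the matrices is a number and \<open>K\<close> is a carrier set of nested
  lists of cosets, so neither the vectors nor the elements of \<open>K\<close> form a type to which
  module theory applies directly. Both are replaced by functions: vectors by functions on
  \<open>nat\<close> with membership in \<open>vecs n\<close> carried along, elements of
  \<open>K\<close> by families of rational polynomials under the surjection \<open>\<pi>\<close>, so
  that equality in \<open>K\<close> becomes divisibility by the irreducible factors. Gauss's lemma
  keeps these factors prime over the rationals. Both directions of the comparison pass through the
  predicate \<open>model\<close>. The rank of a lattice is not known beforehand to be the degree of
  \<open>c\<close>; it comes out of the characteristic polynomial. A greedy decomposition of a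
  module does not say how often each factor occurs, and unique factorization of the characteristic
  polynomial supplies the count. Freeness of a lattice is proved in the torsion-free group of
  families, where remainders give representatives on which \<open>\<pi>\<close> is
  injective.\<close>

lemma coprime_bezout:
  fixes p q :: "'a :: euclidean_ring_gcd"
  assumes "coprime p q"
  obtains a b where "a * p + b * q = 1"
proof -
  have "gcd p q = 1" using assms by simp
  then have "fst (bezout_coefficients p q) * p + snd (bezout_coefficients p q) * q = 1"
    by (simp add: bezout_coefficients_fst_snd)
  then show thesis by (rule that)
qed

locale euclidean_module = Modules.module scale
  for scale :: "'a :: euclidean_ring_gcd \<Rightarrow> 'v :: ab_group_add \<Rightarrow> 'v" (infixr \<open>*s\<close> 75)
begin

text \<open>Bezout for the coprime pair \<open>f i\<close> and \<open>prod f I\<close> splits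
  \<open>v\<close> into a part killed by \<open>f i\<close> and a part killed by
  \<open>prod f I\<close>; the latter is split further by induction. Keeping each component in
  \<open>span {v}\<close> ensures that replacing generators by their components does not enlarge the
  module they generate.\<close>

lemma torsion_decomposition:
  assumes "finite I" and "pairwise (\<lambda>i j. coprime (f i) (f j)) I"
    and "prod f I *s v = 0"
  shows "\<exists>w. v = sum w I \<and> (\<forall>i\<in>I. f i *s w i = 0 \<and> w i \<in> span {v})"
  using assms
proof (induction I arbitrary: v rule: finite_induct)
  case empty
  then show ?case by simp
next
  case (insert i I)
  have "coprime (f i) (prod f I)"
    using insert.hyps(2) insert.prems(1) by (auto simp: pairwise_insert intro: prod_coprime_right)
  then obtain a b where ab: "a * f i + b * prod f I = 1"
    by (rule coprime_bezout)
  have "prod f I *s ((a * f i) *s v) = a *s (prod f (insert i I) *s v)"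
    using insert.hyps by (simp add: mult_ac)
  then have "prod f I *s ((a * f i) *s v) = 0"
    using insert.prems by simp
  then obtain w where w: "(a * f i) *s v = sum w I"
      "\<forall>j\<in>I. f j *s w j = 0 \<and> w j \<in> span {(a * f i) *s v}"
    using insert.IH[of "(a * f i) *s v"] insert.prems(1) unfolding pairwise_insert by blast
  have "f i *s ((b * prod f I) *s v) = b *s (prod f (insert i I) *s v)"
    using insert.hyps by (simp add: mult_ac)
  then have *: "f i *s ((b * prod f I) *s v) = 0"
    using insert.prems by simp
  have "v = (b * prod f I) *s v + (a * f i) *s v"
    by (metis ab add.commute scale_left_distrib scale_one)
  also have "\<dots> = sum (w(i := (b * prod f I) *s v)) (insert i I)"
    using insert.hyps w(1) by (auto intro: sum.cong)
  finally have "v = sum (w(i := (b * prod f I) *s v)) (insert i I)" .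
  moreover have "span {(a * f i) *s v} \<subseteq> span {v}"
    by (intro span_minimal) (auto intro: span_scale span_base simp: subspace_span)
  moreover have "(b * prod f I) *s v \<in> span {v}" by (intro span_scale span_base) simp
  ultimately show ?case
    using w(2) * insert.hyps by (intro exI[of _ "w(i := (b * prod f I) *s v)"]) auto
qed

text \<open>The relations among the \<open>u j\<close> are exactly the tuples with entries in the
  ideals generated by the \<open>g j\<close>. Thus the span of the \<open>u j\<close> is the direct
  sum of the cyclic modules they generate, and \<open>g j\<close> generates the annihilator of
  \<open>u j\<close>.\<close>

definition independent_cyclic :: "nat \<Rightarrow> (nat \<Rightarrow> 'a) \<Rightarrow> (nat \<Rightarrow> 'v) \<Rightarrow> bool" where
  "independent_cyclic n g u \<longleftrightarrow> (\<forall>j<n. g j *s u j = 0) \<and>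
     (\<forall>p. (\<Sum>j<n. p j *s u j) = 0 \<longrightarrow> (\<forall>j<n. g j dvd p j))"

text \<open>Greedy extension: if \<open>u\<close> generates a simple module not contained in the sum so far, the two
  meet only in \<open>0\<close>, because a nonzero element of the simple module generates it.\<close>

lemma independent_cyclic_extend:
  assumes ind: "independent_cyclic n (\<lambda>j. f (c j)) u" and p: "prime_elem (f i)" "f i *s v = 0"
    and v: "v \<notin> span (u ` {..<n})"
  shows "independent_cyclic (Suc n) (\<lambda>j. f ((c(n := i)) j)) (u(n := v))"
proof -
  have eq: "(\<Sum>j<Suc n. p j *s (u(n := v)) j) = (\<Sum>j<n. p j *s u j) + p n *s v" for p
    by (simp add: sum.lessThan_Suc)
  have "\<forall>j<Suc n. f ((c(n := i)) j) dvd q j"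
    if "(\<Sum>j<Suc n. q j *s (u(n := v)) j) = 0" for q
  proof -
    have 0: "(\<Sum>j<n. q j *s u j) + q n *s v = 0" using that unfolding eq .
    have dvd: "f i dvd q n"
    proof (rule ccontr)
      assume "\<not> f i dvd q n"
      then obtain a b where "a * f i + b * q n = 1" by (rule coprime_bezout[OF prime_elem_imp_coprime[OF p(1)]])
      then have "v = (a * f i + b * q n) *s v" by simp
      also have "\<dots> = b *s (q n *s v)"
        using p(2) by (simp add: scale_left_distrib flip: scale_scale)
      also have "\<dots> = - (b *s (\<Sum>j<n. q j *s u j))"
        using 0 by (metis add.inverse_unique add.inverse_inverse add.commute scale_minus_right)
      also have "\<dots> \<in> span (u ` {..<n})"
        by (intro span_neg span_scale span_sum) (auto intro: span_base)
      finally show False using v by simp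
    qed
    then have "q n *s v = 0" using p(2) by (auto simp: mult.commute simp flip: scale_scale elim!: dvdE)
    then have "\<forall>j<n. f (c j) dvd q j"
      using 0 ind unfolding independent_cyclic_def by auto
    with dvd show ?thesis by (auto simp: less_Suc_eq)
  qed
  moreover have "\<forall>j<Suc n. f ((c(n := i)) j) *s (u(n := v)) j = 0"
    using ind p(2) unfolding independent_cyclic_def by (auto simp: less_Suc_eq)
  ultimately show ?thesis unfolding independent_cyclic_def by blast
qed

text \<open>Each generator is killed by a prime, so the module it generates is simple or zero.
  Generators lying in the span of the earlier ones, zero among them, are dropped, and the others
  extend the direct sum. The map \<open>c\<close> remembers the prime belonging to each generator
  that is kept.\<close>

lemma span_of_killed_cyclic:
  assumes "finite S" and "\<And>v. v \<in> S \<Longrightarrow> \<exists>i\<in>I. prime_elem (f i) \<and> f i *s v = 0"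
  shows "\<exists>n c u. c ` {..<n} \<subseteq> I \<and> u ` {..<n} \<subseteq> S \<and> span (u ` {..<n}) = span S \<and>
    independent_cyclic n (\<lambda>j. f (c j)) u"
  using assms
proof (induction S rule: finite_induct)
  case empty
  show ?case by (intro exI[of _ "0::nat"]) (simp add: independent_cyclic_def)
next
  case (insert v S)
  have "\<exists>n c u. c ` {..<n} \<subseteq> I \<and> u ` {..<n} \<subseteq> S \<and> span (u ` {..<n}) = span S \<and>
    independent_cyclic n (\<lambda>j. f (c j)) u"
    by (rule insert.IH) (simp add: insert.prems)
  then obtain n c u where IH: "c ` {..<n} \<subseteq> I" "u ` {..<n} \<subseteq> S" "span (u ` {..<n}) = span S"
    "independent_cyclic n (\<lambda>j. f (c j)) u" by blast
  show ?case
  proof (cases "v \<in> span S")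
    case True
    then have "span (insert v S) = span S" 
      unfolding span_eq by (auto simp: span_base)
    with IH show ?thesis by blast
  next
    case False
    obtain i where i: "i \<in> I" "prime_elem (f i)" "f i *s v = 0" using insert.prems by blast
    have im: "(u(n := v)) ` {..<Suc n} = insert v (u ` {..<n})"
      by (auto simp: lessThan_Suc image_iff)
    have "span (insert v (u ` {..<n})) = span (insert v S)"
      unfolding span_insert IH(3) ..
    moreover have "independent_cyclic (Suc n) (\<lambda>j. f ((c(n := i)) j)) (u(n := v))"
      using independent_cyclic_extend[where c = c, OF IH(4) i(2,3)] False IH(3) by simp
    moreover have "(c(n := i)) ` {..<Suc n} \<subseteq> I" using IH(1) i(1) by (auto simp: lessThan_Suc)
    moreover have "(u(n := v)) ` {..<Suc n} \<subseteq> insert v S" using IH(2) im by auto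
    ultimately show ?thesis unfolding im[symmetric] by blast
  qed
qed

theorem cyclic_decomposition:
  assumes I: "finite I" "\<And>i. i \<in> I \<Longrightarrow> prime_elem (f i)" "pairwise (\<lambda>i j. coprime (f i) (f j)) I"
    and S: "finite S" "\<And>v. v \<in> S \<Longrightarrow> prod f I *s v = 0"
  shows "\<exists>n c u. c ` {..<n} \<subseteq> I \<and> span (u ` {..<n}) = span S \<and> independent_cyclic n (\<lambda>j. f (c j)) u"
proof -
  have "\<forall>v\<in>S. \<exists>w. v = sum w I \<and> (\<forall>i\<in>I. f i *s w i = 0 \<and> w i \<in> span {v})"
    using torsion_decomposition[OF I(1,3)] S(2) by blast
  then obtain w where w: "\<And>v. v \<in> S \<Longrightarrow> v = sum (w v) I"
    "\<And>v i. v \<in> S \<Longrightarrow> i \<in> I \<Longrightarrow> f i *s w v i = 0 \<and> w v i \<in> span {v}" by metis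
  \<comment> \<open>The components of the generators: each is killed by a single prime, and together
    they span the same module as \<open>S\<close>.\<close>
  define T where "T = (\<Union>v\<in>S. w v ` I)"
  have "finite T" using I(1) S(1) by (simp add: T_def)
  moreover have "\<exists>i\<in>I. prime_elem (f i) \<and> f i *s x = 0" if "x \<in> T" for x
    using that I(2) w(2) unfolding T_def by blast
  ultimately have "\<exists>n c u. c ` {..<n} \<subseteq> I \<and> u ` {..<n} \<subseteq> T \<and> span (u ` {..<n}) = span T \<and>
      independent_cyclic n (\<lambda>j. f (c j)) u"
    by (rule span_of_killed_cyclic)
  moreover have "span T = span S"
    unfolding span_eq
  proof
    have "span {v} \<subseteq> span S" if "v \<in> S" for v using that by (intro span_mono) simp
    then show "T \<subseteq> span S" using w(2) unfolding T_def by blast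
    show "S \<subseteq> span T"
    proof
      fix v assume v: "v \<in> S"
      have "sum (w v) I \<in> span T" using v by (intro span_sum span_base) (auto simp: T_def)
      then show "v \<in> span T" using w(1)[OF v] by simp
    qed
  qed
  ultimately show ?thesis by auto
qed

text \<open>Coefficients are attached to positions rather than to vectors, so that the family
  \<open>u\<close> may have repetitions.\<close>

lemma mem_span_image_lessThan:
  fixes n :: nat
  shows "x \<in> span (u ` {..<n}) \<longleftrightarrow> (\<exists>p. x = (\<Sum>j<n. p j *s u j))"
proof
  assume "x \<in> span (u ` {..<n})"
  then show "\<exists>p. x = (\<Sum>j<n. p j *s u j)"
  proof (induction rule: span_induct_alt)
    case base
    show ?case by (intro exI[of _ "\<lambda>_. 0"]) simp
  next
    case (step a y z)
    then obtain p j where p: "z = (\<Sum>j<n. p j *s u j)" and j: "j < n" "y = u j" by auto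
    have "a *s y = (\<Sum>k<n. (if k = j then a else 0) *s u k)"
    proof -
      have "(\<Sum>k<n. (if k = j then a else 0) *s u k) = (\<Sum>k<n. if k = j then a *s u k else 0)"
        by (intro sum.cong) auto
      with j show ?thesis by simp
    qed
    then have "a *s y + z = (\<Sum>k<n. ((if k = j then a else 0) + p k) *s u k)"
      by (simp add: p scale_left_distrib sum.distrib)
    then show ?case by (intro exI[of _ "\<lambda>k. (if k = j then a else 0) + p k"])
  qed
next
  assume "\<exists>p. x = (\<Sum>j<n. p j *s u j)"
  then show "x \<in> span (u ` {..<n})" by (auto intro!: span_sum span_scale intro: span_base)
qed

end

section \<open>The polynomial action of a matrix\<close>

definition fscale :: "'a :: comm_ring_1 \<Rightarrow> (nat \<Rightarrow> 'a) \<Rightarrow> nat \<Rightarrow> 'a" where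
  "fscale c v = (\<lambda>i. c * v i)"

text \<open>Column vectors of length \<open>n\<close> are functions vanishing from \<open>n\<close> on, so that they live in a type
  with pointwise addition whatever \<open>n\<close> is.\<close>

definition vecs :: "nat \<Rightarrow> (nat \<Rightarrow> 'a :: zero) set" where
  "vecs n = {v. \<forall>i\<ge>n. v i = 0}"

definition unit_fun :: "nat \<Rightarrow> nat \<Rightarrow> 'a :: zero_neq_one" where
  "unit_fun k = (\<lambda>i. if i = k then 1 else 0)"

definition mat_app :: "'a :: comm_ring_1 mat \<Rightarrow> (nat \<Rightarrow> 'a) \<Rightarrow> nat \<Rightarrow> 'a" where
  "mat_app A v = (\<lambda>i. if i < dim_row A then \<Sum>j<dim_col A. A $$ (i, j) * v j else 0)"

text \<open>Horner's rule for the polynomial \<open>p\<close> in the matrix \<open>A\<close>,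
  applied to \<open>v\<close>. No matrix powers are formed, so the module laws follow by induction
  on the polynomial, whatever the dimensions of \<open>A\<close>.\<close>

definition act :: "'a :: comm_ring_1 mat \<Rightarrow> 'a poly \<Rightarrow> (nat \<Rightarrow> 'a) \<Rightarrow> nat \<Rightarrow> 'a" where
  "act A p v = fold_coeffs (\<lambda>a w. fscale a v + mat_app A w) p 0"

text \<open>As default simplification rules these break up equations between functions, hiding the sums
  and zeros that the algebraic lemmas about \<^typ>\<open>nat \<Rightarrow> 'a\<close> are stated for.\<close>

declare plus_fun_apply [simp del] zero_fun_apply [simp del] minus_apply [simp del]

lemmas fun_apply = plus_fun_apply zero_fun_apply minus_apply

lemma fscale_simps [simp]:
  "fscale 0 v = 0" "fscale c 0 = 0" "fscale 1 v = v" "fscale c (fscale d v) = fscale (c * d) v"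
  by (simp_all add: fscale_def fun_eq_iff fun_apply mult.assoc)

lemma fscale_add:
  "fscale (c + d) v = fscale c v + fscale d v" "fscale c (v + w) = fscale c v + fscale c w"
  by (simp_all add: fscale_def fun_eq_iff fun_apply algebra_simps)

lemma vecs_add [simp]: "v \<in> vecs n \<Longrightarrow> w \<in> vecs n \<Longrightarrow> v + w \<in> vecs n"
  for v :: "nat \<Rightarrow> 'a :: monoid_add"
  by (simp add: vecs_def fun_apply)

lemma vecs_0 [simp]: "0 \<in> vecs n"
  by (simp add: vecs_def fun_apply)

lemma vecs_sum [simp]: "(\<And>i. i \<in> I \<Longrightarrow> f i \<in> vecs n) \<Longrightarrow> sum f I \<in> vecs n"
  for f :: "'b \<Rightarrow> nat \<Rightarrow> 'a :: comm_monoid_add"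
  by (induction I rule: infinite_finite_induct) auto

lemma vecs_minus [simp]: "v \<in> vecs n \<Longrightarrow> w \<in> vecs n \<Longrightarrow> v - w \<in> vecs n"
  for v :: "nat \<Rightarrow> 'a :: group_add"
  by (simp add: vecs_def fun_apply)

lemma vecs_fscale [simp]: "v \<in> vecs n \<Longrightarrow> fscale c v \<in> vecs n"
  by (simp add: vecs_def fscale_def)

lemma unit_fun_vecs [simp]: "k < n \<Longrightarrow> unit_fun k \<in> vecs n"
  by (simp add: vecs_def unit_fun_def)

lemma sum_fun_apply: "(sum f I) x = (\<Sum>i\<in>I. f i x)"
  for f :: "'b \<Rightarrow> 'c \<Rightarrow> 'a :: comm_monoid_add"
  by (induction I rule: infinite_finite_induct) (auto simp: fun_apply)

lemma vecs_expand:
  fixes v :: "nat \<Rightarrow> 'a :: comm_ring_1"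
  assumes "v \<in> vecs n"
  shows "v = (\<Sum>k<n. fscale (v k) (unit_fun k))"
  using assms by (auto simp: fun_eq_iff fun_apply sum_fun_apply fscale_def unit_fun_def vecs_def
    if_distrib[of "\<lambda>x. _ * x"] sum.delta' cong: if_cong)

section \<open>Matrices as linear maps on column vectors\<close>

lemma mat_app_vecs [simp]: "dim_row A = n \<Longrightarrow> mat_app A v \<in> vecs n"
  by (simp add: vecs_def mat_app_def)

lemma mat_app_add: "mat_app A (v + w) = mat_app A v + mat_app A w"
  by (auto simp: mat_app_def fun_eq_iff fun_apply algebra_simps sum.distrib)

lemma mat_app_0 [simp]: "mat_app A 0 = 0"
  by (auto simp: mat_app_def fun_eq_iff fun_apply)

lemma mat_app_fscale: "mat_app A (fscale c v) = fscale c (mat_app A v)"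
  by (auto simp: mat_app_def fscale_def fun_eq_iff fun_apply sum_distrib_left mult_ac)

lemma mat_app_sum: "mat_app A (sum f I) = (\<Sum>i\<in>I. mat_app A (f i))"
  by (induction I rule: infinite_finite_induct) (auto simp: mat_app_add)

lemma mat_app_mult:
  assumes "dim_col A = dim_row B"
  shows "mat_app (A * B) v = mat_app A (mat_app B v)"
proof
  fix i
  have "(\<Sum>j<dim_col B. (\<Sum>k<dim_row B. A $$ (i, k) * B $$ (k, j)) * v j) =
      (\<Sum>k<dim_row B. A $$ (i, k) * (\<Sum>j<dim_col B. B $$ (k, j) * v j))" if "i < dim_row A"
    by (simp add: sum_distrib_left sum_distrib_right mult.assoc) (rule sum.swap)
  then show "mat_app (A * B) v i = mat_app A (mat_app B v) i"
    using assms by (auto simp: mat_app_def scalar_prod_def atLeast0LessThan intro!: sum.cong)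
qed

lemma mat_app_one: "v \<in> vecs n \<Longrightarrow> mat_app (1\<^sub>m n) v = v"
  by (auto simp: mat_app_def fun_eq_iff fun_apply vecs_def one_mat_def if_distrib[of "\<lambda>x. x * _"] sum.delta
    cong: if_cong)

lemma mat_app_unit: "i < dim_row A \<Longrightarrow> k < dim_col A \<Longrightarrow> mat_app A (unit_fun k) i = A $$ (i, k)"
  by (auto simp: mat_app_def unit_fun_def if_distrib[of "\<lambda>x. _ * x"] sum.delta' cong: if_cong)

lemma mat_eq_by_app:
  assumes "A \<in> carrier_mat n k" "B \<in> carrier_mat n k"
    and "\<And>v. v \<in> vecs k \<Longrightarrow> mat_app A v = mat_app B v"
  shows "A = B"
proof (rule eq_matI)
  fix i j assume "i < dim_row B" "j < dim_col B"
  then show "A $$ (i, j) = B $$ (i, j)"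
    using assms by (metis mat_app_unit unit_fun_vecs carrier_matD)
qed (use assms in auto)

text \<open>Turns maps that are linear only on \<open>vecs k\<close>, such as chosen inverses and
  maps read in coordinates, into matrices: the columns are the images of the unit vectors, and
  \<open>vecs_expand\<close> does the rest.\<close>

lemma mat_of_linear:
  fixes L :: "(nat \<Rightarrow> 'a :: comm_ring_1) \<Rightarrow> nat \<Rightarrow> 'a"
  assumes add: "\<And>v w. v \<in> vecs k \<Longrightarrow> w \<in> vecs k \<Longrightarrow> L (v + w) = L v + L w"
    and scale: "\<And>c v. v \<in> vecs k \<Longrightarrow> L (fscale c v) = fscale c (L v)"
    and L: "\<And>v. v \<in> vecs k \<Longrightarrow> L v \<in> vecs n" and v: "v \<in> vecs k"
  shows "mat_app (mat n k (\<lambda>(i, j). L (unit_fun j) i)) v = L v"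
proof -
  have 0: "L 0 = 0" using scale[of 0 0] by simp
  have sum: "L (sum f I) = (\<Sum>i\<in>I. L (f i))" if "\<And>i. i \<in> I \<Longrightarrow> f i \<in> vecs k" for f and I :: "nat set"
    using that by (induction I rule: infinite_finite_induct) (auto simp: 0 add)
  have "L v = L (\<Sum>j<k. fscale (v j) (unit_fun j))" using vecs_expand[OF v] by simp
  also have "\<dots> = (\<Sum>j<k. fscale (v j) (L (unit_fun j)))"
    by (subst sum) (auto simp: scale)
  finally have Lv: "L v = (\<Sum>j<k. fscale (v j) (L (unit_fun j)))" .
  have "mat_app (mat n k (\<lambda>(i, j). L (unit_fun j) i)) v i = L v i" for i
  proof (cases "i < n")
    case True
    then show ?thesis by (simp add: Lv mat_app_def sum_fun_apply fscale_def mult.commute)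
  next
    case False
    then show ?thesis using L[OF v] by (simp add: mat_app_def vecs_def fun_apply)
  qed
  then show ?thesis by blast
qed

section \<open>Column vectors as a module over the polynomial ring\<close>

lemma act_0 [simp]: "act A 0 v = 0"
  by (simp add: act_def)

lemma act_pCons: "act A (pCons a p) v = fscale a v + mat_app A (act A p v)"
  by (cases "p = 0 \<and> a = 0") (auto simp: act_def)

lemma act_add_left: "act A (p + q) v = act A p v + act A q v"
  by (induction p q rule: poly_induct2) (simp_all add: act_pCons mat_app_add fscale_add add_ac)

lemma act_add_right: "act A p (v + w) = act A p v + act A p w"
  by (induction p) (simp_all add: act_pCons mat_app_add fscale_add add_ac)

lemma act_sum_left: "act A (sum f I) v = (\<Sum>i\<in>I. act A (f i) v)"
  by (induction I rule: infinite_finite_induct) (simp_all add: act_add_left)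

lemma act_smult: "act A (Polynomial.smult c p) v = fscale c (act A p v)"
  by (induction p) (simp_all add: act_pCons mat_app_fscale fscale_add)

lemma act_mult: "act A (p * q) v = act A p (act A q v)"
  by (induction p) (simp_all add: act_pCons act_add_left act_smult)

lemma act_1 [simp]: "act A 1 v = v"
  by (simp add: act_pCons flip: pCons_one)

lemma act_x: "act A [:0, 1:] v = mat_app A v"
  by (simp add: act_pCons)

lemma act_const: "act A [:c:] v = fscale c v"
  by (simp add: act_pCons)

text \<open>The module consists of all functions on \<open>nat\<close>; the column vectors of the
  right length are only a submodule, so \<open>vecs n\<close> appears in hypotheses. The
  coefficients form a field, which makes the polynomial ring Euclidean.\<close>

interpretation act: euclidean_module "act A" for A :: "'a :: field_gcd mat"
  by unfold_locales (simp_all add: act_add_left act_add_right act_mult)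

lemma act_vecs [simp]: "dim_row A = n \<Longrightarrow> v \<in> vecs n \<Longrightarrow> act A p v \<in> vecs n"
  by (induction p) (simp_all add: act_pCons)

text \<open>Restricted to \<open>vecs n\<close> because a constant term acts by plain scaling under
  \<open>act\<close>, but through the identity matrix, which cuts off at \<open>n\<close>, under
  \<open>mat_poly\<close>.\<close>

lemma act_eq_mat_poly:
  assumes A: "A \<in> carrier_mat n n" and v: "v \<in> vecs n"
  shows "act A p v = mat_app (mat_poly p A) v"
proof -
  have pow: "act A (Polynomial.monom 1 k) v = mat_app (A ^\<^sub>m k) v" if "v \<in> vecs n" for k v
    using that
  proof (induction k arbitrary: v)
    case 0
    then show ?case using A by (simp add: monom_0 act_const mat_app_one)
  next
    case (Suc k)
    have "Polynomial.monom 1 (Suc k) = Polynomial.monom 1 k * [:0, 1 :: 'a:]"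
      by (simp add: monom_Suc mult_monom)
    then have "act A (Polynomial.monom 1 (Suc k)) v = act A (Polynomial.monom 1 k) (mat_app A v)"
      by (simp only: act_mult act_x)
    then show ?case using A Suc by (simp add: mat_app_mult)
  qed
  have "act A p v = act A (\<Sum>k\<le>Polynomial.degree p. Polynomial.monom (Polynomial.coeff p k) k) v"
    by (simp add: poly_as_sum_of_monoms)
  also have "\<dots> = (\<Sum>k\<le>Polynomial.degree p. act A (Polynomial.smult (Polynomial.coeff p k) (Polynomial.monom 1 k)) v)"
    by (simp add: act_sum_left smult_monom)
  also have "\<dots> = (\<Sum>k\<le>Polynomial.degree p. fscale (Polynomial.coeff p k) (mat_app (A ^\<^sub>m k) v))"
    by (simp add: act_smult pow v)
  also have "\<dots> = mat_app (mat_poly p A) v"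
  proof
    fix i
    have "dim_row (A ^\<^sub>m k) = n" "dim_col (A ^\<^sub>m k) = n" for k
      using A by (metis carrier_matD pow_carrier_mat)+
    then show "(\<Sum>k\<le>Polynomial.degree p. fscale (Polynomial.coeff p k) (mat_app (A ^\<^sub>m k) v)) i =
        mat_app (mat_poly p A) v i"
      using A sum.swap[of "\<lambda>k j. Polynomial.coeff p k * ((A ^\<^sub>m k) $$ (i, j) * v j)" "{..<n}" "{..Polynomial.degree p}"]
      by (simp add: mat_app_def mat_poly_def sum_fun_apply fscale_def sum_distrib_left
          sum_distrib_right mult.assoc del: pow_mat_dim)
  qed
  finally show ?thesis .
qed

lemma mat_poly_eq_0_iff:
  assumes A: "A \<in> carrier_mat n n"
  shows "mat_poly p A = 0\<^sub>m n n \<longleftrightarrow> (\<forall>v\<in>vecs n. act A p v = 0)"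
proof -
  have 0: "mat_app (0\<^sub>m n n) v = 0" for v :: "nat \<Rightarrow> 'a"
    by (auto simp: mat_app_def fun_eq_iff fun_apply)
  have c: "mat_poly p A \<in> carrier_mat n n" using A by (simp add: mat_poly_def)
  show ?thesis
    using mat_eq_by_app[OF c zero_carrier_mat] act_eq_mat_poly[OF A] by (metis 0)
qed

section \<open>Companion matrices\<close>

text \<open>For monic \<open>g\<close>, the matrix of multiplication by x on polynomials modulo
  \<open>g\<close> in the basis of powers of x: each power goes to the next, and the last one to
  minus the lower part of \<open>g\<close>.\<close>

definition companion :: "'a :: comm_ring_1 poly \<Rightarrow> 'a mat" where
  "companion g = (let d = Polynomial.degree g in mat d d (\<lambda>(i, k).
     if Suc k = d then - Polynomial.coeff g i else if i = Suc k then 1 else 0))"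

lemma companion_carrier [simp]:
  "companion g \<in> carrier_mat (Polynomial.degree g) (Polynomial.degree g)"
  "dim_row (companion g) = Polynomial.degree g" "dim_col (companion g) = Polynomial.degree g"
  by (simp_all add: companion_def Let_def)

text \<open>Laplace expansion along the first row, where only the first and the last entry survive.
  Deleting the first row and column leaves the companion matrix of \<open>g\<close>, the polynomial
  without its constant term divided by x; deleting the first row and the last column leaves a
  triangular matrix with -1 on the diagonal, whose sign cancels that of the cofactor. The result is
  x times \<open>g\<close> plus \<open>a\<close>.\<close>

lemma char_poly_companion:
  fixes g :: "'a :: idom poly"
  assumes "monic g" "Polynomial.degree g > 0"
  shows "char_poly (companion g) = g"
  using assms
proof (induction g)
  case 0
  then show ?case by simp
next
  case (pCons a g)
  define d where "d = Polynomial.degree g"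
  have g0: "g \<noteq> 0" using pCons.prems(2) by auto
  then have g: "monic g" using pCons.prems(1) by simp
  have deg: "Polynomial.degree (pCons a g) = Suc d" using g0 by (simp add: d_def)
  let ?M = "char_poly_matrix (companion (pCons a g))"
  have M: "?M \<in> carrier_mat (Suc d) (Suc d)"
    using deg by (metis char_poly_matrix_closed companion_carrier(1))
  have entry: "?M $$ (i, k) = (if i = k then [:0, 1:] else 0) -
      (if k = d then [:- Polynomial.coeff (pCons a g) i:] else if i = Suc k then 1 else 0)"
    if "i < Suc d" "k < Suc d" for i k
    using that deg by (auto simp: char_poly_matrix_def companion_def Let_def one_pCons)
  show ?case
  \<comment> \<open>For \<open>d = 0\<close> the first and the last column coincide, whereas the
    two-term expansion below needs them distinct.\<close>
  proof (cases "d = 0")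
    case True
    then have "g = 1" using g by (simp add: d_def monic_degree_0)
    have "det ?M = ?M $$ (0, 0)" using M True by (simp add: det_single)
    then show ?thesis unfolding char_poly_def using entry[of 0 0] True \<open>g = 1\<close>
      by (simp add: one_pCons)
  next
    case False
    have "char_poly (companion g) = g" using pCons.IH g False by (simp add: d_def)
    have 1: "mat_delete ?M 0 0 = char_poly_matrix (companion g)"
    proof (rule eq_matI)
      fix i j assume "i < dim_row (char_poly_matrix (companion g))" "j < dim_col (char_poly_matrix (companion g))"
      then have ij: "i < d" "j < d" by (simp_all add: char_poly_matrix_def d_def)
      then show "mat_delete ?M 0 0 $$ (i, j) = char_poly_matrix (companion g) $$ (i, j)"
        using M entry[of "Suc i" "Suc j"]
        by (auto simp: mat_delete_def char_poly_matrix_def companion_def Let_def d_def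
            coeff_pCons split: nat.splits)
    qed (use M in \<open>simp_all add: mat_delete_def char_poly_matrix_def d_def\<close>)
    have 2: "det (mat_delete ?M 0 d) = (- 1) ^ d"
    proof -
      have c: "mat_delete ?M 0 d \<in> carrier_mat d d" using M by (simp add: mat_delete_def)
      have e: "mat_delete ?M 0 d $$ (i, j) = (if i = j then - 1 else if j = Suc i then [:0, 1:] else 0)"
        if "i < d" "j < d" for i j
        using that M entry[of "Suc i" j] by (auto simp: mat_delete_def)
      have "upper_triangular (mat_delete ?M 0 d)" using c e by (auto simp: upper_triangular_def)
      then have "det (mat_delete ?M 0 d) = prod_list (diag_mat (mat_delete ?M 0 d))"
        by (rule det_upper_triangular[OF _ c])
      also have "diag_mat (mat_delete ?M 0 d) = replicate d (- 1)"
        using c e by (intro nth_equalityI) (auto simp: diag_mat_def)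
      finally show ?thesis by (simp add: prod_list_replicate)
    qed
    have "char_poly (companion (pCons a g)) = (\<Sum>j<Suc d. ?M $$ (0, j) * cofactor ?M 0 j)"
      unfolding char_poly_def using laplace_expansion_row[OF M, of 0] by simp
    also have "\<dots> = (\<Sum>j\<in>{0, d}. ?M $$ (0, j) * cofactor ?M 0 j)"
      using False entry[of 0] by (intro sum.mono_neutral_right) auto
    also have "\<dots> = [:0, 1:] * char_poly (companion g) + [:a:] * ((- 1) ^ d * (- 1) ^ d)"
      using False entry[of 0 0] entry[of 0 d] 1 2 by (simp add: cofactor_def char_poly_def)
    also have "\<dots> = pCons a g"
      using \<open>char_poly (companion g) = g\<close> by (simp flip: power_add)
    finally show ?thesis .
  qed
qed

section \<open>Block sums of companion matrices\<close>

fun companions :: "(nat \<Rightarrow> 'a :: comm_ring_1 poly) \<Rightarrow> nat \<Rightarrow> 'a mat" where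
  "companions g 0 = 0\<^sub>m 0 0"
| "companions g (Suc s) = (let B = companions g s; C = companion (g s) in
     four_block_mat B (0\<^sub>m (dim_row B) (dim_col C)) (0\<^sub>m (dim_row C) (dim_col B)) C)"

text \<open>The row at which block \<open>s\<close> begins, and at the same time the total size of
  the first \<open>s\<close> blocks.\<close>

definition offset :: "(nat \<Rightarrow> 'a :: zero poly) \<Rightarrow> nat \<Rightarrow> nat" where
  "offset g s = (\<Sum>j<s. Polynomial.degree (g j))"

lemma offset_simps [simp]: "offset g 0 = 0" "offset g (Suc s) = offset g s + Polynomial.degree (g s)"
  by (simp_all add: offset_def)

lemma offset_add_less:
  assumes "j < s" "k < Polynomial.degree (g j)"
  shows "offset g j + k < offset g s"
  using assms
proof (induction s)
  case (Suc s)
  then show ?case by (cases "j = s") auto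
qed simp

lemma offset_cases:
  assumes "i < offset g s"
  obtains j k where "j < s" "k < Polynomial.degree (g j)" "i = offset g j + k"
  using assms
proof (induction s arbitrary: thesis)
  case (Suc s)
  show ?case
  proof (cases "i < offset g s")
    case True
    show ?thesis by (rule Suc.IH[OF _ True]) (use Suc.prems(1) in \<open>auto intro: less_SucI\<close>)
  next
    case False
    then show ?thesis using Suc.prems(1)[of s "i - offset g s"] Suc.prems(2) by auto
  qed
qed simp

lemma companions_carrier [simp]:
  "companions g s \<in> carrier_mat (offset g s) (offset g s)"
  "dim_row (companions g s) = offset g s" "dim_col (companions g s) = offset g s"
proof -
  show *: "companions g s \<in> carrier_mat (offset g s) (offset g s)"
    by (induction s) (auto simp: Let_def)
  then show "dim_row (companions g s) = offset g s" "dim_col (companions g s) = offset g s" by auto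
qed

lemma char_poly_companions:
  fixes g :: "nat \<Rightarrow> 'a :: idom poly"
  assumes "\<And>j. j < s \<Longrightarrow> monic (g j) \<and> Polynomial.degree (g j) > 0"
  shows "char_poly (companions g s) = (\<Prod>j<s. g j)"
  using assms
proof (induction s)
  case 0
  show ?case by (simp add: char_poly_def char_poly_matrix_def)
next
  case (Suc s)
  let ?B = "companions g s" and ?C = "companion (g s)"
  have "char_poly_matrix (companions g (Suc s)) = four_block_mat (char_poly_matrix ?B)
     (0\<^sub>m (offset g s) (Polynomial.degree (g s))) (0\<^sub>m (Polynomial.degree (g s)) (offset g s)) (char_poly_matrix ?C)"
    by (rule eq_matI) (auto simp: char_poly_matrix_def Let_def)
  then have "char_poly (companions g (Suc s)) = char_poly ?B * char_poly ?C"
    unfolding char_poly_def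
    by (simp add: det_four_block_mat_lower_left_zero[where n = "offset g s" and m = "Polynomial.degree (g s)"])
  then show ?case using Suc by (simp add: char_poly_companion)
qed

lemma mat_app_companions:
  assumes "j < s" "k < Polynomial.degree (g j)"
  shows "mat_app (companions g s) x (offset g j + k) = mat_app (companion (g j)) (\<lambda>k. x (offset g j + k)) k"
  using assms
proof (induction s)
  case (Suc s)
  let ?N = "offset g s" and ?d = "Polynomial.degree (g s)"
  have split: "(\<Sum>h<n + d. F h) = (\<Sum>h<n. F h) + (\<Sum>h<d. F (n + h))" for F :: "nat \<Rightarrow> 'a" and n d
    by (induction d) (auto simp: add.assoc)
  show ?case
  proof (cases "j = s")
    case True
    then show ?thesis using Suc.prems(2) by (simp add: mat_app_def Let_def split)
  next
    case False
    then have j: "j < s" using Suc.prems(1) by simp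
    have "offset g j + k < ?N" using offset_add_less[of j s k g] j Suc.prems(2) by simp
    then have "mat_app (companions g (Suc s)) x (offset g j + k) = mat_app (companions g s) x (offset g j + k)"
      by (simp add: mat_app_def Let_def split)
    then show ?thesis using Suc.IH[OF j Suc.prems(2)] by simp
  qed
qed simp

text \<open>The coordinates in block \<open>j\<close>, read as the coefficients of a polynomial of
  degree below that of \<open>g j\<close>. This identifies a vector with a tuple of remainders
  modulo the \<open>g j\<close>.\<close>

definition segment :: "(nat \<Rightarrow> 'a :: comm_ring_1 poly) \<Rightarrow> (nat \<Rightarrow> 'a) \<Rightarrow> nat \<Rightarrow> 'a poly" where
  "segment g x j = (\<Sum>k<Polynomial.degree (g j). Polynomial.monom (x (offset g j + k)) k)"

lemma coeff_segment:
  "Polynomial.coeff (segment g x j) k = (if k < Polynomial.degree (g j) then x (offset g j + k) else 0)"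
  by (auto simp: segment_def coeff_sum sum.delta' cong: if_cong)

text \<open>In each block the matrix multiplies by x and reduces modulo \<open>g j\<close>. The
  product has degree at most that of \<open>g j\<close>, so subtracting one constant multiple of
  \<open>g j\<close> is enough; the constant is the top coordinate of the block.\<close>

lemma segment_companions:
  fixes g :: "nat \<Rightarrow> 'a :: comm_ring_1 poly"
  assumes "j < s" "monic (g j)" "Polynomial.degree (g j) > 0"
  shows "segment g (mat_app (companions g s) x) j = [:0, 1:] * segment g x j -
    Polynomial.smult (x (offset g j + (Polynomial.degree (g j) - 1))) (g j)"
proof (rule poly_eqI)
  fix k
  define d where "d = Polynomial.degree (g j)"
  \<comment> \<open>Row \<open>k\<close> has a 1 in column \<open>k - 1\<close> and a coefficient of
    \<open>g j\<close> in the last column; row 0 has no entry of the first kind, hence the case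
    distinction.\<close>
  have 0: "mat_app (companion (g j)) y k = (if k = 0 then 0 else y (k - 1)) - y (d - 1) * Polynomial.coeff (g j) k"
    if "k < d" for y :: "nat \<Rightarrow> 'a"
  proof -
    obtain d' where d': "d = Suc d'" using assms(3) d_def gr0_conv_Suc by metis
    have "mat_app (companion (g j)) y k = (\<Sum>h<d. (if Suc h = d then - Polynomial.coeff (g j) k else if k = Suc h then 1 else 0) * y h)"
      using that by (simp add: mat_app_def companion_def Let_def flip: d_def)
    also have "\<dots> = (\<Sum>h<d'. (if k = Suc h then 1 else 0) * y h) - Polynomial.coeff (g j) k * y d'"
      by (simp add: d')
    also have "(\<Sum>h<d'. (if k = Suc h then 1 else 0) * y h) = (\<Sum>h<d'. if h = k - 1 then if k = 0 then 0 else y h else 0)"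
      by (intro sum.cong) auto
    also have "\<dots> = (if k = 0 then 0 else y (k - 1))" using that by (auto simp: d' sum.delta)
    finally show ?thesis by (simp add: d' mult.commute)
  qed
  have 1: "mat_app (companions g s) x (offset g j + k) = (if k = 0 then 0 else x (offset g j + (k - 1))) -
      x (offset g j + (d - 1)) * Polynomial.coeff (g j) k" if "k < d"
    using mat_app_companions[OF assms(1), of k g x] 0[OF that, of "\<lambda>k. x (offset g j + k)"] that
    by (simp only: d_def)
  have 2: "Polynomial.coeff (g j) k = 0" if "k > d" using that by (simp add: d_def coeff_eq_0)
  have 3: "Polynomial.coeff (g j) d = 1" using assms(2) by (simp add: d_def)
  have 4: "Polynomial.coeff ([:0, 1:] * q) k = (if k = 0 then 0 else Polynomial.coeff q (k - 1))" for q :: "'a poly"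
    by (cases k) auto
  show "Polynomial.coeff (segment g (mat_app (companions g s) x) j) k = Polynomial.coeff ([:0, 1:] * segment g x j -
      Polynomial.smult (x (offset g j + (Polynomial.degree (g j) - 1))) (g j)) k"
    using assms(3) 1 2 3
    unfolding coeff_diff 4 coeff_smult coeff_segment d_def[symmetric]
    by (cases "k < d"; cases "k = d"; cases "k = 0") (simp_all, linarith?)
qed

section \<open>The characteristic polynomial of a cyclic decomposition\<close>

lemma segment_surj:
  assumes "\<And>j. j < s \<Longrightarrow> p j \<noteq> 0 \<Longrightarrow> Polynomial.degree (p j) < Polynomial.degree (g j)"
  shows "\<exists>x\<in>vecs (offset g s). \<forall>j<s. segment g x j = p j"
  using assms
proof (induction s)
  case 0
  show ?case by (intro bexI[of _ 0]) auto
next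
  case (Suc s)
  then obtain x where x: "x \<in> vecs (offset g s)" "\<And>j. j < s \<Longrightarrow> segment g x j = p j"
    by (metis less_SucI)
  define y where "y i = (if i < offset g s then x i else Polynomial.coeff (p s) (i - offset g s))" for i
  have deg: "Polynomial.coeff (p s) k = 0" if "k \<ge> Polynomial.degree (g s)" for k
    using Suc.prems[of s] that by (cases "p s = 0") (auto intro: coeff_eq_0)
  then have "y \<in> vecs (offset g (Suc s))" by (simp add: vecs_def y_def)
  moreover have "segment g y j = p j" if "j < Suc s" for j
  proof (cases "j = s")
    case True
    then show ?thesis using deg by (intro poly_eqI) (auto simp: coeff_segment y_def)
  next
    case False
    then have "segment g y j = segment g x j"
      using that offset_add_less[of j s _ g] by (intro poly_eqI) (auto simp: coeff_segment y_def)
    then show ?thesis using x(2) False that by simp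
  qed
  ultimately show ?case by blast
qed

lemma segment_eq_0D:
  assumes "x \<in> vecs (offset g s)" "\<And>j. j < s \<Longrightarrow> segment g x j = 0"
  shows "x = 0"
proof
  fix i
  show "x i = 0 i"
  proof (cases "i < offset g s")
    case True
    then obtain j k where "j < s" "k < Polynomial.degree (g j)" "i = offset g j + k" by (rule offset_cases)
    then show ?thesis using assms(2)[of j] coeff_segment[of g x j k] by (simp add: fun_apply)
  next
    case False
    then show ?thesis using assms(1) by (simp add: vecs_def fun_apply)
  qed
qed

lemma degree_segment:
  "segment g x j \<noteq> 0 \<Longrightarrow> Polynomial.degree (segment g x j) < Polynomial.degree (g j)"
  by (metis coeff_segment leading_coeff_0_iff)

lemma segment_add: "segment g (x + y) j = segment g x j + segment g y j"
  by (rule poly_eqI) (simp add: coeff_segment fun_apply)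

lemma segment_fscale: "segment g (fscale c x) j = Polynomial.smult c (segment g x j)"
  by (rule poly_eqI) (simp add: coeff_segment fscale_def)

text \<open>Both products have the same trace, which in characteristic zero determines the size of
  an identity matrix.\<close>

lemma two_sided_inverse_square:
  fixes P Q :: "'a :: field_char_0 mat"
  assumes "P \<in> carrier_mat n k" "Q \<in> carrier_mat k n" "P * Q = 1\<^sub>m n" "Q * P = 1\<^sub>m k"
  shows "n = k"
proof -
  have "of_nat n = (\<Sum>i<n. (P * Q) $$ (i, i))" using assms by simp
  also have "\<dots> = (\<Sum>i<n. \<Sum>j<k. P $$ (i, j) * Q $$ (j, i))"
    using assms(1,2) by (simp add: scalar_prod_def atLeast0LessThan)
  also have "\<dots> = (\<Sum>j<k. \<Sum>i<n. Q $$ (j, i) * P $$ (i, j))"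
    by (subst sum.swap) (simp add: mult.commute)
  also have "\<dots> = (\<Sum>j<k. (Q * P) $$ (j, j))"
    using assms(1,2) by (simp add: scalar_prod_def atLeast0LessThan)
  also have "\<dots> = (of_nat k :: 'a)" using assms by simp
  finally show ?thesis by (simp only: of_nat_eq_iff)
qed

text \<open>The map \<open>L\<close> uses the segments of a coordinate vector as coefficients of the
  \<open>u j\<close>. Generation makes it surjective onto \<open>vecs n\<close>, independence makes
  it injective, and it carries the action of the companion blocks to that of \<open>A\<close>. So
  \<open>A\<close> is similar to a block sum whose characteristic polynomial is known.\<close>

theorem char_poly_cyclic:
  fixes A :: "'a :: {field_char_0, field_gcd} mat"
  assumes A: "A \<in> carrier_mat n n"
    and g: "\<And>j. j < s \<Longrightarrow> monic (g j) \<and> Polynomial.degree (g j) > 0"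
    and u: "\<And>j. j < s \<Longrightarrow> u j \<in> vecs n"
    and gen: "vecs n \<subseteq> act.span A (u ` {..<s})"
    and ind: "act.independent_cyclic A s g u"
  shows "char_poly A = (\<Prod>j<s. g j)"
proof -
  define N where "N = offset g s"
  define B where "B = companions g s"
  define L where "L x = (\<Sum>j<s. act A (segment g x j) (u j))" for x
  have ann: "act A (g j) (u j) = 0" if "j < s" for j
    using ind that by (simp add: act.independent_cyclic_def)
  have B: "B \<in> carrier_mat N N" by (simp add: B_def N_def)
  have L_vecs: "L x \<in> vecs n" for x using A u by (auto simp: L_def intro!: vecs_sum act_vecs)
  have L_add: "L (x + y) = L x + L y" for x y
    by (simp add: L_def segment_add act_add_left sum.distrib)
  have L_fscale: "L (fscale c x) = fscale c (L x)" for c x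
    by (simp add: L_def segment_fscale act_smult)
      (simp add: fun_eq_iff sum_fun_apply fscale_def sum_distrib_left)
  have L_diff: "L (x - y) = L x - L y" for x y
    using L_add[of "x - y" y] by simp
  have L_B: "L (mat_app B x) = mat_app A (L x)" for x
  proof -
    have "act A (segment g (mat_app B x) j) (u j) = mat_app A (act A (segment g x j) (u j))" if "j < s" for j
    proof -
      let ?c = "x (offset g j + (Polynomial.degree (g j) - 1))"
      have "segment g (mat_app B x) j + Polynomial.smult ?c (g j) = [:0, 1:] * segment g x j"
        using segment_companions[OF that, of g x] g[OF that] by (simp only: B_def diff_add_cancel)
      then have "act A (segment g (mat_app B x) j) (u j) + fscale ?c (act A (g j) (u j)) =
          act A [:0, 1:] (act A (segment g x j) (u j))"
        by (metis act_add_left act_smult act_mult)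
      then show ?thesis using ann[OF that] by (simp add: act_pCons)
    qed
    then show ?thesis by (simp add: L_def mat_app_sum)
  qed
  have L_inj: "x = 0" if "x \<in> vecs N" "L x = 0" for x
  proof (rule segment_eq_0D)
    show "x \<in> vecs (offset g s)" using that(1) by (simp add: N_def)
    fix j assume j: "j < s"
    then have "g j dvd segment g x j"
      using ind that(2) unfolding act.independent_cyclic_def L_def by blast
    then show "segment g x j = 0"
      using degree_segment[of g x j] by (meson dvd_imp_degree_le not_le)
  qed
  have L_surj: "\<exists>x\<in>vecs N. L x = v" if "v \<in> vecs n" for v
  proof -
    have "v \<in> act.span A (u ` {..<s})" using gen that by blast
    then obtain p where p: "v = (\<Sum>j<s. act A (p j) (u j))"
      unfolding act.mem_span_image_lessThan by blast
    \<comment> \<open>As \<open>g j\<close> kills \<open>u j\<close>, coefficients may be reduced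
      modulo \<open>g j\<close>; the remainders are small enough to be the segments of a
      vector.\<close>
    have *: "act A (p j mod g j) (u j) = act A (p j) (u j)" if "j < s" for j
    proof -
      have "act A (p j) (u j) = act A (p j div g j * g j + p j mod g j) (u j)" by simp
      also have "\<dots> = act A (p j mod g j) (u j)"
        unfolding act_add_left act_mult by (simp add: ann[OF that])
      finally show ?thesis ..
    qed
    have "\<exists>x\<in>vecs (offset g s). \<forall>j<s. segment g x j = p j mod g j"
    proof (rule segment_surj)
      fix j assume "j < s" "p j mod g j \<noteq> 0"
      then show "Polynomial.degree (p j mod g j) < Polynomial.degree (g j)"
        using degree_mod_less[of "g j" "p j"] g by fastforce
    qed
    then obtain x where x: "x \<in> vecs N" "\<And>j. j < s \<Longrightarrow> segment g x j = p j mod g j"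
      unfolding N_def by blast
    then have "L x = v" using * by (simp add: L_def p)
    then show ?thesis using x(1) by blast
  qed
  \<comment> \<open>\<open>W\<close> and \<open>V\<close> are the matrices of \<open>L\<close> and
    of its inverse. They are set up as rectangular matrices, since \<open>n = N\<close> is only a
    consequence of their being inverse to each other.\<close>
  define W where "W = mat n N (\<lambda>(i, j). L (unit_fun j) i)"
  have W: "W \<in> carrier_mat n N" by (simp add: W_def)
  have app_W: "mat_app W x = L x" if "x \<in> vecs N" for x
    unfolding W_def by (rule mat_of_linear) (use that L_add L_fscale L_vecs in auto)
  obtain y where y: "\<And>v. v \<in> vecs n \<Longrightarrow> y v \<in> vecs N \<and> L (y v) = v" using L_surj by metis
  have y_unique: "x = y v" if "x \<in> vecs N" "L x = v" "v \<in> vecs n" for x v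
    using L_inj[of "x - y v"] y[OF that(3)] that by (simp add: L_diff)
  define V where "V = mat N n (\<lambda>(i, j). y (unit_fun j) i)"
  have V: "V \<in> carrier_mat N n" by (simp add: V_def)
  have app_V: "mat_app V v = y v" if "v \<in> vecs n" for v
    unfolding V_def
  proof (rule mat_of_linear)
    fix v w :: "nat \<Rightarrow> 'a" and c assume v: "v \<in> vecs n"
    show "y (fscale c v) = fscale c (y v)"
      using y[OF v] v by (intro y_unique[symmetric]) (auto simp: L_fscale)
    assume w: "w \<in> vecs n"
    show "y (v + w) = y v + y w"
      using y[OF v] y[OF w] v w by (intro y_unique[symmetric]) (auto simp: L_add)
  qed (use y that in auto)
  have WV: "W * V = 1\<^sub>m n"
    by (rule mat_eq_by_app[of _ n n]) (use W V in \<open>auto simp: mat_app_mult mat_app_one app_V app_W y\<close>)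
  have VW: "V * W = 1\<^sub>m N"
    by (rule mat_eq_by_app[of _ N N])
      (use W V in \<open>auto simp: mat_app_mult mat_app_one app_V app_W L_vecs y_unique[symmetric]\<close>)
  have AW: "A * W = W * B"
    by (rule mat_eq_by_app[of _ n N]) (use A B W in \<open>auto simp: mat_app_mult app_W L_B\<close>)
  have "n = N" using two_sided_inverse_square[OF W V WV VW] .
  have "A = W * B * V"
    using A V W WV unfolding AW[symmetric] by (simp add: assoc_mult_mat[of A n n W N V n])
  then have "similar_mat A B"
    using A B W V WV VW unfolding \<open>n = N\<close> by (intro similar_matI[of A B W V N]) auto
  then have "char_poly A = char_poly B" by (rule char_poly_similar)
  also have "\<dots> = (\<Prod>j<s. g j)" unfolding B_def by (rule char_poly_companions) (rule g)
  finally show ?thesis .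
qed

section \<open>Gauss's lemma\<close>

lemma common_denominator:
  fixes S :: "rat set"
  assumes "finite S"
  shows "\<exists>d :: int. d > 0 \<and> (\<forall>q\<in>S. of_int d * q \<in> \<int>)"
  using assms
proof (induction S rule: finite_induct)
  case empty
  show ?case by (intro exI[of _ 1]) simp
next
  case (insert x S)
  then obtain d :: int where d: "d > 0" "\<forall>q\<in>S. of_int d * q \<in> \<int>" by auto
  obtain a b where ab: "x = Rat.Fract a b" "b > 0" by (cases x) auto
  have "of_int (b * d) * q \<in> \<int>" if "q \<in> insert x S" for q
  proof (cases "q = x")
    case True
    then have "of_int (b * d) * q = of_int (d * a)" using ab by (simp add: Fract_of_int_quotient)
    then show ?thesis by (metis Ints_of_int)
  next
    case False
    then have "of_int d * q \<in> \<int>" using d(2) that by blast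
    then have "of_int b * (of_int d * q) \<in> \<int>" by (rule Ints_mult[OF Ints_of_int])
    then show ?thesis by (simp add: mult.assoc)
  qed
  then show ?case using d(1) ab(2) by (intro exI[of _ "b * d"]) simp
qed

lemma poly_common_denominator:
  fixes p :: "rat poly"
  shows "\<exists>(d :: int) q. d > 0 \<and> of_int_poly q = Polynomial.smult (of_int d) p"
proof -
  obtain d :: int where d: "d > 0" "\<forall>k\<in>Polynomial.coeff p ` {..Polynomial.degree p}. of_int d * k \<in> \<int>"
    using common_denominator[of "Polynomial.coeff p ` {..Polynomial.degree p}"] by auto
  have "of_int d * Polynomial.coeff p k \<in> \<int>" for k
    using d(2) by (cases "k \<le> Polynomial.degree p") (auto simp: coeff_eq_0)
  then have *: "of_int \<lfloor>of_int d * Polynomial.coeff p k\<rfloor> = of_int d * Polynomial.coeff p k" for k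
    by (simp add: of_int_floor)
  have "of_int_poly (map_poly (\<lambda>c. \<lfloor>of_int d * c\<rfloor>) p) = Polynomial.smult (of_int d) p"
    by (rule poly_eqI) (simp add: coeff_map_poly *)
  then show ?thesis using d(1) by blast
qed

text \<open>A factorization over the rationals is scaled to integer polynomials, whose
  contents then cancel against the scaling factor.\<close>

lemma irreducible_of_int_poly:
  fixes f :: "int poly"
  assumes irr: "Factorial_Ring.irreducible f" and f: "monic f"
  shows "Factorial_Ring.irreducible (of_int_poly f :: rat poly)"
proof -
  have "is_unit (content f)"
    using content_dvd_coeff[of f "Polynomial.degree f"] unfolding f .
  then have content_f: "content f = 1" by (simp only: is_unit_content_iff)
  have deg: "Polynomial.degree f > 0"
    using irr f by (metis monic_degree_0 not_gr0 not_irreducible_one)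
  have deg_0: "Polynomial.degree a = 0 \<or> Polynomial.degree b = 0" if ab: "of_int_poly f = a * b" for a b :: "rat poly"
  proof -
    obtain d a' where a': "d > 0" "of_int_poly a' = Polynomial.smult (of_int d) a"
      using poly_common_denominator by blast
    obtain k b' where b': "k > 0" "of_int_poly b' = Polynomial.smult (of_int k) b"
      using poly_common_denominator by blast
    have "of_int_poly (Polynomial.smult (d * k) f) = (of_int_poly (a' * b') :: rat poly)"
      using ab a'(2) b'(2) by (simp add: of_int_hom.map_poly_hom_smult of_int_poly_hom.hom_mult mult.commute)
    then have eq: "Polynomial.smult (d * k) f = a' * b'" by simp
    have "content a' * content b' = content (Polynomial.smult (d * k) f)"
      unfolding eq by (simp add: content_mult)
    also have "\<dots> = d * k" using a'(1) b'(1) by (simp add: content_f)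
    finally have c: "content a' * content b' = d * k" .
    have "Polynomial.smult (d * k) f =
        Polynomial.smult (content a') (primitive_part a') * Polynomial.smult (content b') (primitive_part b')"
      unfolding eq by (simp only: content_times_primitive_part)
    also have "\<dots> = Polynomial.smult (d * k) (primitive_part a' * primitive_part b')"
      unfolding c[symmetric] by (simp only: mult_smult_left mult_smult_right smult_smult mult.commute)
    finally have "Polynomial.smult (d * k) (f - primitive_part a' * primitive_part b') = 0"
      by (simp add: smult_diff_right)
    \<comment> \<open>Scaling and taking primitive parts preserve degrees, so a unit factor here
      forces \<open>a\<close> or \<open>b\<close> to be constant.\<close>
    then have "f = primitive_part a' * primitive_part b'" using a'(1) b'(1) by simp
    then have "is_unit (primitive_part a') \<or> is_unit (primitive_part b')"
      by (rule Factorial_Ring.irreducibleD[OF irr])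
    then have "Polynomial.degree a' = 0 \<or> Polynomial.degree b' = 0"
      using poly_dvd_1 by (metis degree_primitive_part)
    moreover have "Polynomial.degree a' = Polynomial.degree a"
      using arg_cong[OF a'(2), of Polynomial.degree] a'(1) by simp
    moreover have "Polynomial.degree b' = Polynomial.degree b"
      using arg_cong[OF b'(2), of Polynomial.degree] b'(1) by simp
    ultimately show ?thesis by simp
  qed
  have deg': "Polynomial.degree (of_int_poly f :: rat poly) > 0" using deg by simp
  show ?thesis
  proof (rule Factorial_Ring.irreducibleI)
    show "of_int_poly f \<noteq> (0 :: rat poly)" using deg by auto
    show "\<not> is_unit (of_int_poly f :: rat poly)" using deg' by (auto simp: is_unit_iff_degree)
    fix a b :: "rat poly" assume ab: "of_int_poly f = a * b"
    then have "a \<noteq> 0" "b \<noteq> 0" using deg by auto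
    then show "is_unit a \<or> is_unit b" using deg_0[OF ab] by (simp add: is_unit_iff_degree)
  qed
qed

lemma prime_of_int_poly:
  fixes f :: "int poly"
  assumes "Factorial_Ring.irreducible f" "monic f"
  shows "normalization_semidom_class.prime (of_int_poly f :: rat poly)"
proof -
  have "normalize (of_int_poly f :: rat poly) = of_int_poly f" using assms(2) by (intro normalize_monic) simp
  then show ?thesis using irreducible_of_int_poly[OF assms]
    by (simp add: normalization_semidom_class.prime_def prime_elem_iff_irreducible)
qed

section \<open>Models of the algebra \<open>K\<close>\<close>

locale irreducible_factors =
  fixes r :: nat and f :: "nat \<Rightarrow> int poly" and e :: "nat \<Rightarrow> nat"
  assumes inj_f: "inj_on f {..<r}"
    and irr_f: "\<And>i. i < r \<Longrightarrow> Factorial_Ring.irreducible (f i)"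
    and monic_f: "\<And>i. i < r \<Longrightarrow> monic (f i)"
    and e_pos: "\<And>i. i < r \<Longrightarrow> e i > 0"
begin

definition F :: "nat \<Rightarrow> rat poly" where
  "F i = of_int_poly (f i)"

text \<open>One index for each field among the factors of \<open>K\<close>: \<open>(i, l)\<close>
  stands for copy number \<open>l\<close> of the field defined by \<open>f i\<close>.\<close>

definition Ix :: "(nat \<times> nat) set" where
  "Ix = Sigma {..<r} (\<lambda>i. {..<e i})"

lemma finite_Ix [simp]: "finite Ix"
  by (simp add: Ix_def)

lemma monic_F: "i < r \<Longrightarrow> monic (F i)"
  using monic_f by (simp add: F_def)

lemma prime_F: "i < r \<Longrightarrow> normalization_semidom_class.prime (F i)"
  unfolding F_def using prime_of_int_poly irr_f monic_f by blast

lemma inj_F: "inj_on F {..<r}"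
  using inj_f by (auto simp: inj_on_def F_def)

lemma degree_F: "i < r \<Longrightarrow> Polynomial.degree (F i) > 0"
  using prime_F[of i] monic_degree_0[OF monic_F, of i] by (cases "Polynomial.degree (F i) = 0") auto

lemma coprime_F: "i < r \<Longrightarrow> j < r \<Longrightarrow> i \<noteq> j \<Longrightarrow> coprime (F i) (F j)"
  using primes_coprime[OF prime_F prime_F] inj_F by (auto simp: inj_on_def)

lemma prod_F_dvd_iff: "(\<Prod>i<r. F i) dvd p \<longleftrightarrow> (\<forall>i<r. F i dvd p)"
proof
  assume p: "(\<Prod>i<r. F i) dvd p"
  have "F i dvd (\<Prod>i<r. F i)" if "i < r" for i using that by (intro dvd_prodI) auto
  then show "\<forall>i<r. F i dvd p" using p dvd_trans by blast
next
  assume p: "\<forall>i<r. F i dvd p"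
  have "(\<Prod>i<k. F i) dvd p" if "k \<le> r" for k
    using that
  proof (induction k)
    case (Suc k)
    have "coprime (\<Prod>i<k. F i) (F k)"
      using Suc.prems by (intro prod_coprime_left) (auto intro: coprime_F)
    then show ?case using Suc p by (simp add: divides_mult)
  qed simp
  then show "(\<Prod>i<r. F i) dvd p" by simp
qed

lemma prod_Ix: "(\<Prod>j\<in>Ix. F (fst j)) = (\<Prod>i<r. F i ^ e i)"
proof -
  have "(\<Prod>j\<in>Ix. F (fst j)) = (\<Prod>i<r. \<Prod>l<e i. F i)"
    unfolding Ix_def by (subst prod.Sigma) (auto intro!: prod.cong)
  then show ?thesis by simp
qed

text \<open>Elements of \<open>K\<close> are represented by families of polynomials indexed by \<open>Ix\<close>. A model is an
  isomorphism of \<open>\<rat>[x]\<close>-modules from \<open>K\<close> to the column vectors, on which \<open>x\<close> acts as the matrix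
  \<open>A\<close>.\<close>

definition model :: "nat \<Rightarrow> rat mat \<Rightarrow> ((nat \<times> nat \<Rightarrow> rat poly) \<Rightarrow> nat \<Rightarrow> rat) \<Rightarrow> bool" where
  "model n A \<Theta> \<longleftrightarrow> A \<in> carrier_mat n n \<and> range \<Theta> = vecs n \<and>
     (\<forall>P Q. \<Theta> (P + Q) = \<Theta> P + \<Theta> Q) \<and>
     (\<forall>p P. \<Theta> (\<lambda>j. p * P j) = act A p (\<Theta> P)) \<and>
     (\<forall>P. \<Theta> P = 0 \<longleftrightarrow> (\<forall>j\<in>Ix. F (fst j) dvd P j))"

text \<open>A polynomial kills all of \<open>K\<close> if and only if it kills the constant family
  1, that is, if every \<open>F i\<close> divides it; positivity of the exponents makes every
  \<open>i\<close> occur in \<open>Ix\<close>.\<close>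

lemma model_mat_poly_eq_0_iff:
  assumes "model n A \<Theta>"
  shows "mat_poly p A = 0\<^sub>m n n \<longleftrightarrow> (\<Prod>i<r. F i) dvd p"
proof -
  have A: "A \<in> carrier_mat n n" and range: "range \<Theta> = vecs n"
    and act: "\<And>P. act A p (\<Theta> P) = \<Theta> (\<lambda>j. p * P j)"
    and ker: "\<And>P. \<Theta> P = 0 \<longleftrightarrow> (\<forall>j\<in>Ix. F (fst j) dvd P j)"
    using assms by (auto simp: model_def)
  have "mat_poly p A = 0\<^sub>m n n \<longleftrightarrow> (\<forall>P. \<forall>j\<in>Ix. F (fst j) dvd p * P j)"
    unfolding mat_poly_eq_0_iff[OF A] range[symmetric] by (simp add: act ker)
  also have "\<dots> \<longleftrightarrow> (\<forall>j\<in>Ix. F (fst j) dvd p)"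
  proof
    assume "\<forall>P. \<forall>j\<in>Ix. F (fst j) dvd p * P j"
    from this[rule_format, of _ "\<lambda>_. 1"] show "\<forall>j\<in>Ix. F (fst j) dvd p" by simp
  qed (simp add: dvd_mult2)
  also have "\<dots> \<longleftrightarrow> (\<forall>i<r. F i dvd p)"
    using e_pos by (force simp: Ix_def)
  finally show ?thesis by (simp add: prod_F_dvd_iff)
qed

lemma monic_prod_F: "monic (\<Prod>i<r. F i)"
  using monic_F by (intro monic_prod) auto

lemma is_min_poly_prodI:
  assumes "A \<in> carrier_mat n n"
    and "\<And>p. mat_poly p A = 0\<^sub>m n n \<longleftrightarrow> (\<Prod>i<r. F i) dvd p"
  shows "is_min_poly A (\<Prod>i<r. F i)"
  using assms monic_prod_F by (auto simp: is_min_poly_def dvd_imp_degree_le)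

lemma model_sum:
  assumes "model n A \<Theta>"
  shows "\<Theta> (sum P I) = (\<Sum>i\<in>I. \<Theta> (P i))"
proof -
  have "\<Theta> (0 + 0) = \<Theta> 0 + \<Theta> 0" using assms unfolding model_def by blast
  then have "\<Theta> 0 = 0" by simp
  then show ?thesis using assms
    by (induction I rule: infinite_finite_induct) (simp_all add: model_def)
qed

text \<open>The kernel of a model does not see values outside \<open>Ix\<close>, so families that
  agree on \<open>Ix\<close> are identified.\<close>

lemma model_cong:
  assumes "model n A \<Theta>" "\<And>j. j \<in> Ix \<Longrightarrow> P j = Q j"
  shows "\<Theta> P = \<Theta> Q"
proof -
  have "\<Theta> (P - Q) = 0" using assms by (auto simp: model_def fun_apply)
  moreover have "\<Theta> ((P - Q) + Q) = \<Theta> (P - Q) + \<Theta> Q" using assms(1) unfolding model_def by blast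
  ultimately show ?thesis by simp
qed

text \<open>The images of the primitive idempotents of \<open>K\<close> form an independent cyclic
  family: the idempotent at \<open>(i, l)\<close> has annihilator \<open>F i\<close>, and the kernel
  condition of a model is exactly independence. The enumeration \<open>h\<close> turns
  \<open>Ix\<close> into an initial segment of the natural numbers.\<close>

lemma model_char_poly:
  assumes m: "model n A \<Theta>"
  shows "char_poly A = (\<Prod>i<r. F i ^ e i)"
proof -
  have A: "A \<in> carrier_mat n n" and range: "range \<Theta> = vecs n"
    and act: "\<And>p P. \<Theta> (\<lambda>j. p * P j) = act A p (\<Theta> P)"
    and ker: "\<And>P. \<Theta> P = 0 \<longleftrightarrow> (\<forall>j\<in>Ix. F (fst j) dvd P j)"
    using m by (auto simp: model_def)
  define s where "s = card Ix"
  obtain h where h: "bij_betw h {..<s} Ix"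
    using ex_bij_betw_nat_finite[OF finite_Ix] by (auto simp: s_def atLeast0LessThan)
  have h_Ix: "h k \<in> Ix" if "k < s" for k using h that by (auto simp: bij_betw_def)
  define E where "E j = (\<lambda>i. if i = j then 1 else 0 :: rat poly)" for j :: "nat \<times> nat"
  define u where "u k = \<Theta> (E (h k))" for k
  have expand: "\<Theta> P = (\<Sum>k<s. act A (P (h k)) (u k))" for P
  proof -
    have "(\<Sum>k<s. act A (P (h k)) (u k)) = \<Theta> (\<Sum>k<s. (\<lambda>j. P (h k) * E (h k) j))"
      by (simp add: model_sum[OF m] act u_def)
    also have "\<dots> = \<Theta> P"
    proof (rule model_cong[OF m])
      fix j assume "j \<in> Ix"
      then obtain k where k: "k < s" "j = h k" using h by (auto simp: bij_betw_def)
      have "(\<Sum>i<s. (\<lambda>j. P (h i) * E (h i) j)) j = (\<Sum>i<s. if i = k then P j else 0)"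
        unfolding sum_fun_apply using h k
        by (intro sum.cong) (auto simp: E_def bij_betw_def inj_on_def)
      then show "(\<Sum>i<s. (\<lambda>j. P (h i) * E (h i) j)) j = P j" using k by (simp add: sum.delta)
    qed
    finally show ?thesis ..
  qed
  have "char_poly A = (\<Prod>k<s. F (fst (h k)))"
  proof (rule char_poly_cyclic[OF A])
    fix k assume "k < s"
    then have "fst (h k) < r" using h_Ix by (fastforce simp: Ix_def)
    then show "monic (F (fst (h k))) \<and> Polynomial.degree (F (fst (h k))) > 0"
      using monic_F degree_F by blast
    show "u k \<in> vecs n" using range by (auto simp: u_def)
  next
    show "vecs n \<subseteq> act.span A (u ` {..<s})"
      unfolding range[symmetric]
    proof
      fix v assume "v \<in> range \<Theta>"
      then obtain P where "v = \<Theta> P" by blast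
      then show "v \<in> act.span A (u ` {..<s})"
        unfolding act.mem_span_image_lessThan using expand[of P] by (intro exI[of _ "\<lambda>k. P (h k)"]) simp
    qed
    show "act.independent_cyclic A s (\<lambda>k. F (fst (h k))) u"
      unfolding act.independent_cyclic_def
    proof (intro conjI allI impI)
      fix k assume "k < s"
      show "act A (F (fst (h k))) (u k) = 0"
        unfolding u_def act[symmetric] ker by (simp add: E_def)
    next
      fix p k assume p: "(\<Sum>k<s. act A (p k) (u k)) = 0" and k: "k < s"
      define P where "P j = p (inv_into {..<s} h j)" for j
      have P: "P (h k) = p k" if "k < s" for k
        using h that by (simp add: P_def bij_betw_def)
      have "\<Theta> P = 0" unfolding expand using p P by simp
      then show "F (fst (h k)) dvd p k" using ker h_Ix[OF k] P[OF k] by metis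
    qed
  qed
  also have "\<dots> = (\<Prod>j\<in>Ix. F (fst j))"
    by (rule prod.reindex_bij_betw[OF h])
  finally show ?thesis by (simp add: prod_Ix)
qed

text \<open>Unique factorization: the multiplicity of the prime \<open>F i\<close> is read off on
  both sides. This recovers the number of summands of each kind, which the greedy decomposition
  leaves open.\<close>

lemma card_index_fibre:
  fixes s :: nat
  assumes c: "c ` {..<s} \<subseteq> {..<r}" and eq: "(\<Prod>j<s. F (c j)) = (\<Prod>i<r. F i ^ e i)" and i: "i < r"
  shows "card {j. j < s \<and> c j = i} = e i"
proof -
  have mult: "multiplicity (F i) (\<Prod>i<r. F i ^ k i) = k i" for k
  proof -
    \<comment> \<open>Written as a product over the set of primes instead of over indices, which
      injectivity of \<open>F\<close> permits, so that multiplicities of prime powers can be read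
      off.\<close>
    have "(\<Prod>i<r. F i ^ k i) = (\<Prod>p\<in>F ` {..<r}. p ^ k (inv_into {..<r} F p))"
      using inj_F by (simp add: prod.reindex)
    also have "multiplicity (F i) \<dots> = k (inv_into {..<r} F (F i))"
      using i prime_F by (subst multiplicity_prod_prime_powers) auto
    finally show ?thesis using i inj_F by simp
  qed
  have "(\<Prod>j<s. F (c j)) = (\<Prod>i<r. \<Prod>j | j \<in> {..<s} \<and> c j = i. F (c j))"
    using c by (intro prod.group[symmetric]) auto
  also have "\<dots> = (\<Prod>i<r. F i ^ card {j. j < s \<and> c j = i})"
    by (intro prod.cong) auto
  finally have "(\<Prod>i<r. F i ^ e i) = (\<Prod>i<r. F i ^ card {j. j < s \<and> c j = i})"
    unfolding eq .
  then show ?thesis using mult[of e] mult[of "\<lambda>i. card {j. j < s \<and> c j = i}"] by simp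
qed

lemma model_exists:
  assumes A: "A \<in> carrier_mat n n" and min: "is_min_poly A (\<Prod>i<r. F i)"
    and char: "char_poly A = (\<Prod>i<r. F i ^ e i)"
  shows "\<exists>\<Theta>. model n A \<Theta>"
proof -
  \<comment> \<open>The unit vectors generate the column vectors already over the constants, hence
    over the polynomials.\<close>
  let ?S = "unit_fun ` {..<n} :: (nat \<Rightarrow> rat) set"
  have sub: "act.subspace A (vecs n)" using A by (auto simp: act.subspace_def)
  have span_S: "act.span A ?S = vecs n"
  proof
    show "act.span A ?S \<subseteq> vecs n" by (rule act.span_minimal[OF _ sub]) auto
    show "vecs n \<subseteq> act.span A ?S"
    proof
      fix v :: "nat \<Rightarrow> rat" assume "v \<in> vecs n"
      have "(\<Sum>k<n. act A [:v k:] (unit_fun k)) \<in> act.span A ?S"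
        by (intro act.span_sum act.span_scale act.span_base) auto
      then show "v \<in> act.span A ?S" using vecs_expand[OF \<open>v \<in> vecs n\<close>] by (simp add: act_const)
    qed
  qed
  have "act A (\<Prod>i<r. F i) v = 0" if "v \<in> vecs n" for v
    using min that A mat_poly_eq_0_iff[OF A] by (auto simp: is_min_poly_def)
  then have "\<exists>s c u. c ` {..<s} \<subseteq> {..<r} \<and> act.span A (u ` {..<s}) = act.span A ?S \<and>
      act.independent_cyclic A s (\<lambda>j. F (c j)) u"
    using prime_F coprime_F by (intro act.cyclic_decomposition) (auto simp: pairwise_def)
  then obtain s :: nat and c u where c: "c ` {..<s} \<subseteq> {..<r}" and span_u: "act.span A (u ` {..<s}) = vecs n"
    and ind: "act.independent_cyclic A s (\<lambda>j. F (c j)) u" unfolding span_S by blast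
  have u: "u k \<in> vecs n" if "k < s" for k
    using that unfolding span_u[symmetric] by (intro act.span_base) auto
  have "char_poly A = (\<Prod>j<s. F (c j))"
  proof (rule char_poly_cyclic[OF A _ u _ ind])
    fix k assume "k < s"
    then have "c k < r" using c by auto
    then show "monic (F (c k)) \<and> Polynomial.degree (F (c k)) > 0" using monic_F degree_F by blast
  qed (simp_all add: span_u)
  then have card: "card {k. k < s \<and> c k = i} = e i" if "i < r" for i
    using card_index_fibre[OF c] char that by simp
  \<comment> \<open>The decomposition lists its summands in arbitrary order. For each
    \<open>i\<close>, \<open>b i\<close> numbers those with annihilator \<open>F i\<close>; there
    are \<open>e i\<close> of them, so together they relabel all summands by
    \<open>Ix\<close>.\<close>
  have "\<exists>b. bij_betw b {..<e i} {k. k < s \<and> c k = i}" if "i < r" for i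
    using card[OF that] by (intro finite_same_card_bij) auto
  then obtain b where b: "\<And>i. i < r \<Longrightarrow> bij_betw (b i) {..<e i} {k. k < s \<and> c k = i}" by metis
  define h where "h = (\<lambda>(i, l). b i l)"
  have c_h: "c (h j) = fst j" "h j < s" if "j \<in> Ix" for j
  proof -
    have "b (fst j) (snd j) \<in> {k. k < s \<and> c k = fst j}"
      by (rule bij_betw_apply[OF b]) (use that in \<open>auto simp: Ix_def\<close>)
    then show "c (h j) = fst j" "h j < s" by (auto simp: h_def split_beta)
  qed
  have h: "bij_betw h Ix {..<s}"
    unfolding bij_betw_def
  proof
    show "inj_on h Ix"
    proof (rule inj_onI)
      fix j j' assume j: "j \<in> Ix" "j' \<in> Ix" "h j = h j'"
      then have "fst j = fst j'" using c_h by metis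
      then show "j = j'" using j b[of "fst j"] by (auto simp: h_def Ix_def bij_betw_def inj_on_def)
    qed
    show "h ` Ix = {..<s}"
    proof
      show "h ` Ix \<subseteq> {..<s}" using c_h by auto
      show "{..<s} \<subseteq> h ` Ix"
      proof
        fix k assume k: "k \<in> {..<s}"
        have "c k < r" using c k by auto
        have "k \<in> b (c k) ` {..<e (c k)}"
          unfolding bij_betw_imp_surj_on[OF b[OF \<open>c k < r\<close>]] using k by simp
        then obtain l where "l < e (c k)" "b (c k) l = k" by auto
        then show "k \<in> h ` Ix" using \<open>c k < r\<close> by (intro image_eqI[of _ _ "(c k, l)"]) (auto simp: h_def Ix_def)
      qed
    qed
  qed
  \<comment> \<open>Entry \<open>(i, l)\<close> of a family acts on generator number
    \<open>l\<close> among those killed by \<open>F i\<close>. The kernel condition of a model then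
    is independence of the generators.\<close>
  define \<Theta> where "\<Theta> P = (\<Sum>j\<in>Ix. act A (P j) (u (h j)))" for P
  have \<Theta>_alt: "\<Theta> P = (\<Sum>k<s. act A (P (inv_into Ix h k)) (u k))" for P
    unfolding \<Theta>_def sum.reindex_bij_betw[OF h, symmetric]
    by (intro sum.cong) (simp_all add: bij_betw_inv_into_left[OF h])
  have "range \<Theta> = vecs n"
  proof
    show "range \<Theta> \<subseteq> vecs n" using A u c_h(2) by (auto simp: \<Theta>_def intro!: vecs_sum act_vecs)
    show "vecs n \<subseteq> range \<Theta>"
    proof
      fix v :: "nat \<Rightarrow> rat" assume "v \<in> vecs n"
      then obtain p where p: "v = (\<Sum>k<s. act A (p k) (u k))"
        unfolding span_u[symmetric] act.mem_span_image_lessThan by blast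
      have "v = \<Theta> (p \<circ> h)" unfolding \<Theta>_alt p
        by (intro sum.cong) (simp_all add: bij_betw_inv_into_right[OF h])
      then show "v \<in> range \<Theta>" by blast
    qed
  qed
  moreover have "\<Theta> P = 0 \<longleftrightarrow> (\<forall>j\<in>Ix. F (fst j) dvd P j)" for P
  proof
    assume "\<Theta> P = 0"
    then have 0: "(\<Sum>k<s. act A (P (inv_into Ix h k)) (u k)) = 0" by (simp only: \<Theta>_alt)
    have "F (c k) dvd P (inv_into Ix h k)" if "k < s" for k
      using ind[unfolded act.independent_cyclic_def, THEN conjunct2, rule_format, OF 0 that] .
    then have "F (c (h j)) dvd P (inv_into Ix h (h j))" if "j \<in> Ix" for j
      using c_h(2)[OF that] by blast
    then show "\<forall>j\<in>Ix. F (fst j) dvd P j" by (simp add: c_h(1) bij_betw_inv_into_left[OF h])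
  next
    assume P: "\<forall>j\<in>Ix. F (fst j) dvd P j"
    have "act A (P j) (u (h j)) = 0" if "j \<in> Ix" for j
    proof -
      have "F (c (h j)) dvd P j" using P that c_h(1)[OF that] by simp
      then obtain q where "P j = q * F (c (h j))" by (auto simp: dvd_def mult.commute)
      moreover have "act A (F (c (h j))) (u (h j)) = 0"
        using ind c_h(2)[OF that] by (simp add: act.independent_cyclic_def)
      ultimately show ?thesis by (simp add: act_mult)
    qed
    then show "\<Theta> P = 0" by (simp add: \<Theta>_def)
  qed
  moreover have "\<Theta> (P + Q) = \<Theta> P + \<Theta> Q" for P Q
    by (simp add: \<Theta>_def fun_apply act_add_left sum.distrib)
  moreover have "\<Theta> (\<lambda>j. p * P j) = act A p (\<Theta> P)" for p P
    unfolding \<Theta>_def act.scale_sum_right act_mult ..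
  ultimately have "model n A \<Theta>"
    using A unfolding model_def by blast
  then show ?thesis by (rule exI[of _ \<Theta>])
qed

end

section \<open>Bases of torsion-free abelian groups\<close>

locale torsion_free_int_module = euclidean_module scale
  for scale :: "int \<Rightarrow> 'v :: ab_group_add \<Rightarrow> 'v" (infixr \<open>*s\<close> 75) +
  assumes torsion_free: "c *s v = 0 \<Longrightarrow> c = 0 \<or> v = 0"
begin

lemma span_drop_zero:
  assumes "i < Suc n" "b i = 0"
  shows "\<exists>b'. span (b' ` {..<n}) = span (b ` {..<Suc n})"
proof -
  \<comment> \<open>The last generator moves into the place vacated by the zero at \<open>i\<close>,
    so that the remaining ones occupy the first \<open>n\<close> positions.\<close>
  define b' where "b' = b(i := b n)"
  have "b ` {..<Suc n} \<subseteq> insert 0 (b' ` {..<n})"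
  proof
    fix x assume "x \<in> b ` {..<Suc n}"
    then obtain k where k: "k < Suc n" "x = b k" by auto
    consider "k = i" | "k \<noteq> i" "k = n" | "k \<noteq> i" "k < n" using k(1) by linarith
    then show "x \<in> insert 0 (b' ` {..<n})"
    proof cases
      case 2
      then have "x = b' i" "i < n" using k assms(1) by (auto simp: b'_def)
      then show ?thesis by blast
    qed (use k assms(2) in \<open>auto simp: b'_def\<close>)
  qed
  moreover have "b' ` {..<n} \<subseteq> b ` {..<Suc n}"
    by (auto simp: b'_def)
  ultimately have "span (b' ` {..<n}) \<subseteq> span (b ` {..<Suc n})"
    "span (b ` {..<Suc n}) \<subseteq> span (insert 0 (b' ` {..<n}))"
    by (auto intro!: span_mono)
  moreover have "span (insert 0 (b' ` {..<n})) = span (b' ` {..<n})"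
    unfolding span_eq by (auto simp: span_zero intro: span_base)
  ultimately show ?thesis by (intro exI[of _ b']) simp
qed

lemma span_add_multiple:
  assumes "i < n" "j < n" "i \<noteq> j"
  shows "span (b(j := b j + c *s b i) ` {..<n}) = span (b ` {..<n})"
proof -
  let ?b = "b(j := b j + c *s b i)"
  have "?b k \<in> span (b ` {..<n})" if "k < n" for k
    using that assms by (auto intro!: span_add span_scale intro: span_base)
  moreover have "b k \<in> span (?b ` {..<n})" if "k < n" for k
  proof (cases "k = j")
    case True
    have "?b j - c *s ?b i \<in> span (?b ` {..<n})"
      using assms by (intro span_diff span_scale span_base) blast+
    then show ?thesis using True assms by simp
  next
    case False
    then have "?b k \<in> span (?b ` {..<n})" using that by (intro span_base) blast
    then show ?thesis using False by simp
  qed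
  ultimately show ?thesis unfolding span_eq by blast
qed

text \<open>A relation between a minimal number of generators is shortened by the Euclidean algorithm
  until it involves a single generator, which then vanishes.\<close>

lemma minimal_generators_independent:
  fixes n :: nat
  assumes min: "\<And>k b'. span (b' ` {..<k}) = V \<Longrightarrow> n \<le> k"
    and "span (b ` {..<n}) = V" "(\<Sum>k<n. a k *s b k) = 0"
  shows "\<forall>k<n. a k = 0"
  using assms(2,3)
proof (induction "\<Sum>k<n. nat \<bar>a k\<bar>" arbitrary: a b rule: less_induct)
  case less
  show ?case
  proof (rule ccontr)
    assume "\<not> (\<forall>k<n. a k = 0)"
    then obtain i0 where i0: "i0 < n" "a i0 \<noteq> 0" by auto
    have "\<exists>i j. i < n \<and> j < n \<and> i \<noteq> j \<and> a j \<noteq> 0 \<and> \<bar>a j\<bar> \<le> \<bar>a i\<bar>"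
    proof (cases "\<exists>j<n. j \<noteq> i0 \<and> a j \<noteq> 0")
      case True
      then obtain j where "j < n" "j \<noteq> i0" "a j \<noteq> 0" by blast
      then show ?thesis using i0
        by (cases "\<bar>a j\<bar> \<le> \<bar>a i0\<bar>") (blast, meson linear)
    next
      case False
      then have "(\<Sum>k<n. a k *s b k) = (\<Sum>k<n. if k = i0 then a i0 *s b i0 else 0)"
        by (intro sum.cong) auto
      then have "a i0 *s b i0 = 0" using less.prems(2) i0(1) by simp
      then have "b i0 = 0" using torsion_free i0(2) by blast
      moreover obtain n' where "n = Suc n'" using i0(1) by (cases n) auto
      ultimately obtain b' where "span (b' ` {..<n'}) = V"
        using span_drop_zero[of i0 n' b] i0(1) less.prems(1) by auto
      then show ?thesis using min[of b' n'] \<open>n = Suc n'\<close> by simp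
    qed
    then obtain i j where ij: "i < n" "j < n" "i \<noteq> j" "a j \<noteq> 0" "\<bar>a j\<bar> \<le> \<bar>a i\<bar>" by blast
    \<comment> \<open>The sign for which subtracting \<open>c * a j\<close> from \<open>a i\<close>
      brings it closer to 0, by \<open>\<bar>a j\<bar>\<close>. Replacing \<open>b j\<close> by
      \<open>b j + c *s b i\<close> compensates, so the relation persists with smaller
      coefficients.\<close>
    define c where "c = sgn (a i) * sgn (a j)"
    define a' where "a' = a(i := a i - c * a j)"
    define b' where "b' = b(j := b j + c *s b i)"
    have "\<bar>a i - c * a j\<bar> < \<bar>a i\<bar>"
      using ij(4,5) by (auto simp: c_def sgn_if abs_if split: if_splits)
    then have "nat \<bar>a' i\<bar> < nat \<bar>a i\<bar>" by (simp add: a'_def)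
    then have "(\<Sum>k<n. nat \<bar>a' k\<bar>) < (\<Sum>k<n. nat \<bar>a k\<bar>)"
      using ij(1) by (intro sum_strict_mono_ex1) (auto simp: a'_def)
    moreover have "span (b' ` {..<n}) = V"
      using less.prems(1) span_add_multiple[OF ij(1,2,3)] by (simp add: b'_def)
    moreover have "(\<Sum>k<n. a' k *s b' k) = 0"
    proof -
      have "(\<Sum>k<n. a' k *s b' k) = (\<Sum>k<n. a k *s b k +
          ((if k = i then - (c * a j) *s b i else 0) + (if k = j then a j *s (c *s b i) else 0)))"
        using ij(3) by (intro sum.cong) (auto simp: a'_def b'_def scale_left_diff_distrib scale_right_distrib)
      also have "\<dots> = 0"
        using ij less.prems(2) by (simp add: sum.distrib mult.commute)
      finally show ?thesis .
    qed
    ultimately have "\<forall>k<n. a' k = 0" using less.hyps by blast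
    then show False using ij by (auto simp: a'_def)
  qed
qed

text \<open>A generating family of least length admits no nontrivial relation, and a generating
  family exists because \<open>S\<close> can be enumerated.\<close>

theorem finitely_generated_basis:
  assumes "finite S"
  shows "\<exists>(n :: nat) b. span (b ` {..<n}) = span S \<and> (\<forall>a. (\<Sum>k<n. a k *s b k) = 0 \<longrightarrow> (\<forall>k<n. a k = 0))"
proof -
  define good where "good n \<longleftrightarrow> (\<exists>b. span (b ` {..<n}) = span S)" for n :: nat
  obtain h where "bij_betw h {..<card S} S"
    using ex_bij_betw_nat_finite[OF assms] by (auto simp: atLeast0LessThan)
  then have "good (card S)" unfolding good_def by (intro exI[of _ h]) (simp add: bij_betw_def)
  then have "good (LEAST n. good n)" by (rule LeastI)
  then obtain b where b: "span (b ` {..<(LEAST n. good n)}) = span S" by (auto simp: good_def)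
  have "(LEAST n. good n) \<le> k" if "span (b' ` {..<k}) = span S" for k b'
    using that by (intro Least_le) (auto simp: good_def)
  note ind = minimal_generators_independent[OF this b]
  show ?thesis
    by (intro exI[of _ "LEAST n. good n"] exI[of _ b] conjI b allI impI ind)
qed

end

section \<open>Representing elements of \<open>K\<close> by polynomials\<close>

text \<open>The product of a list of rings is defined by recursion through binary products, so its
  operations are not visibly componentwise. The homomorphism sending a pair of head and tail to a
  list peels off one factor at a time.\<close>

lemma RDirProd_list_ops_map:
  assumes "\<And>k. k < length Rs \<Longrightarrow> a k \<in> carrier (Rs ! k) \<and> b k \<in> carrier (Rs ! k)"
  shows "map a [0..<length Rs] \<oplus>\<^bsub>RDirProd_list Rs\<^esub> map b [0..<length Rs] =
      map (\<lambda>k. a k \<oplus>\<^bsub>Rs ! k\<^esub> b k) [0..<length Rs]"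
    and "map a [0..<length Rs] \<otimes>\<^bsub>RDirProd_list Rs\<^esub> map b [0..<length Rs] =
      map (\<lambda>k. a k \<otimes>\<^bsub>Rs ! k\<^esub> b k) [0..<length Rs]"
  using assms
proof (induction Rs arbitrary: a b)
  case Nil
  {
    case 1
    show ?case by (simp add: monoid.defs)
  next
    case 2
    show ?case by (simp add: monoid.defs)
  }
next
  case (Cons R Rs)
  have c: "(x 0, map (\<lambda>k. x (Suc k)) [0..<length Rs]) \<in> carrier (RDirProd R (RDirProd_list Rs))"
    if "\<And>k. k < length (R # Rs) \<Longrightarrow> x k \<in> carrier ((R # Rs) ! k)" for x
    unfolding RDirProd_carrier
    using that[of 0] that[of "Suc _"] by (auto intro!: RDirProd_list_carrier_memI)
  have u: "map x [0..<length (R # Rs)] = x 0 # map (\<lambda>k. x (Suc k)) [0..<length Rs]" for x :: "nat \<Rightarrow> 'a"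
    by (simp only: length_Cons map_upt_Suc)
  note hom = RDirProd_list_hom1[of R Rs]
  {
    case 1
    then show ?case
      using ring_hom_add[OF hom c[of a] c[of b]] Cons.IH(1)[of "\<lambda>k. a (Suc k)" "\<lambda>k. b (Suc k)"]
      unfolding u by (fastforce simp: RDirProd_def DirProd_def monoid.defs)
  next
    case 2
    then show ?case
      using ring_hom_mult[OF hom c[of a] c[of b]] Cons.IH(2)[of "\<lambda>k. a (Suc k)" "\<lambda>k. b (Suc k)"]
      unfolding u by (fastforce simp: RDirProd_def DirProd_def monoid.defs)
  }
qed

lemma RDirProd_list_zero_map:
  "\<zero>\<^bsub>RDirProd_list Rs\<^esub> = map (\<lambda>k. \<zero>\<^bsub>Rs ! k\<^esub>) [0..<length Rs]"
proof (induction Rs)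
  case Nil
  show ?case by (simp add: monoid.defs)
next
  case (Cons R Rs)
  then show ?case by (simp only: RDirProd_list_zero' length_Cons map_upt_Suc nth_Cons_0 nth_Cons_Suc)
qed

section \<open>Quotients of polynomial rings by principal ideals\<close>

lemma type_algebra_simps [simp]:
  "carrier ring_of_type_algebra = UNIV"
  "x \<otimes>\<^bsub>ring_of_type_algebra\<^esub> y = x * y" "x \<oplus>\<^bsub>ring_of_type_algebra\<^esub> y = x + y"
  "\<zero>\<^bsub>ring_of_type_algebra\<^esub> = 0" "\<one>\<^bsub>ring_of_type_algebra\<^esub> = 1"
  for x :: "'a :: comm_ring_1"
  by (simp_all add: ring_of_type_algebra_def)

lemma type_algebra_cgenideal:
  "PIdl\<^bsub>ring_of_type_algebra\<^esub> a = {x. a dvd x}" for a :: "'a :: comm_ring_1"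
  by (auto simp: cgenideal_def dvd_def mult.commute)

lemma type_algebra_coset:
  "(PIdl\<^bsub>ring_of_type_algebra\<^esub> a) +>\<^bsub>ring_of_type_algebra\<^esub> p = {q. a dvd q - p}"
  for a :: "'a :: comm_ring_1"
proof -
  have "q \<in> (PIdl\<^bsub>ring_of_type_algebra\<^esub> a) +>\<^bsub>ring_of_type_algebra\<^esub> p \<longleftrightarrow> a dvd q - p" for q
    unfolding a_r_coset_def' type_algebra_cgenideal
    by (auto intro!: exI[of _ "q - p"])
  then show ?thesis by blast
qed

lemma type_algebra_ideal: "ideal (PIdl\<^bsub>ring_of_type_algebra\<^esub> a) ring_of_type_algebra"
  for a :: "'a :: comm_ring_1"
  by (rule cring.cgenideal_ideal[OF cring_from_type_algebra]) simp

definition residue :: "int poly \<Rightarrow> rat poly \<Rightarrow> rat poly set" where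
  "residue g p = Q_ideal g +>\<^bsub>QX\<^esub> p"

lemma residue_eq_iff: "residue g p = residue g q \<longleftrightarrow> of_int_poly g dvd p - q"
proof
  assume "residue g p = residue g q"
  moreover have "p \<in> residue g p" by (simp add: residue_def Q_ideal_def type_algebra_coset)
  ultimately have "p \<in> residue g q" by simp
  then show "of_int_poly g dvd p - q" by (simp add: residue_def Q_ideal_def type_algebra_coset)
next
  assume d: "of_int_poly g dvd p - q"
  have "of_int_poly g dvd x - p \<longleftrightarrow> of_int_poly g dvd x - q" for x
    using dvd_add_left_iff[OF d, of "x - p"] by simp
  then show "residue g p = residue g q" by (simp add: residue_def Q_ideal_def type_algebra_coset)
qed

lemma num_field_simps:
  "carrier (num_field g) = range (residue g)"
  "residue g p \<oplus>\<^bsub>num_field g\<^esub> residue g q = residue g (p + q)"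
  "residue g p \<otimes>\<^bsub>num_field g\<^esub> residue g q = residue g (p * q)"
  "\<zero>\<^bsub>num_field g\<^esub> = residue g 0"
proof -
  interpret ideal "Q_ideal g" QX unfolding Q_ideal_def by (rule type_algebra_ideal)
  note hom = rcos_ring_hom
  show "carrier (num_field g) = range (residue g)"
    by (auto simp: num_field_def FactRing_def A_RCOSETS_def' residue_def)
  show "residue g p \<oplus>\<^bsub>num_field g\<^esub> residue g q = residue g (p + q)"
    using ring_hom_add[OF hom, of p q] by (simp add: num_field_def residue_def)
  show "residue g p \<otimes>\<^bsub>num_field g\<^esub> residue g q = residue g (p * q)"
    using ring_hom_mult[OF hom, of p q] by (simp add: num_field_def residue_def)
  have "\<zero>\<^bsub>num_field g\<^esub> = Q_ideal g" by (simp add: num_field_def FactRing_def)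
  also have "\<dots> = residue g 0"
    unfolding residue_def Q_ideal_def type_algebra_coset by (simp add: type_algebra_cgenideal)
  finally show "\<zero>\<^bsub>num_field g\<^esub> = residue g 0" .
qed

lemma num_field_ring: "ring (num_field g)"
  unfolding num_field_def Q_ideal_def by (rule ideal.quotient_is_ring[OF type_algebra_ideal])

section \<open>The algebra \<open>K\<close> as a quotient of families of polynomials\<close>

context irreducible_factors begin

abbreviation K :: "rat poly set list list ring" where
  "K \<equiv> K_alg r f e"

text \<open>Every element of \<open>K\<close> is the image of a family, so identities in
  \<open>K\<close> can be checked as congruences between polynomials. Families form a type with
  pointwise addition, on which sums and spans are available.\<close>

definition \<pi> :: "(nat \<times> nat \<Rightarrow> rat poly) \<Rightarrow> rat poly set list list" where
  "\<pi> P = map (\<lambda>i. map (\<lambda>l. residue (f i) (P (i, l))) [0..<e i]) [0..<r]"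

abbreviation component :: "nat \<Rightarrow> rat poly set list ring" where
  "component i \<equiv> RDirProd_list (replicate (e i) (num_field (f i)))"

lemma K_eq: "K = RDirProd_list (map component [0..<r])"
  by (simp add: K_alg_def)

lemma K_ring: "ring K"
  unfolding K_eq by (auto intro!: RDirProd_list_is_ring num_field_ring)

sublocale K: ring K
  by (rule K_ring)

lemma component_carrier: "map (\<lambda>l. residue (f i) (P l)) [0..<e i] \<in> carrier (component i)"
  by (auto intro!: RDirProd_list_carrier_memI simp: num_field_simps)

lemma component_ops:
  "map (\<lambda>l. residue (f i) (P l)) [0..<e i] \<oplus>\<^bsub>component i\<^esub> map (\<lambda>l. residue (f i) (Q l)) [0..<e i] =
    map (\<lambda>l. residue (f i) (P l + Q l)) [0..<e i]"
  "map (\<lambda>l. residue (f i) (P l)) [0..<e i] \<otimes>\<^bsub>component i\<^esub> map (\<lambda>l. residue (f i) (Q l)) [0..<e i] =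
    map (\<lambda>l. residue (f i) (P l * Q l)) [0..<e i]"
  using RDirProd_list_ops_map[of "replicate (e i) (num_field (f i))" "\<lambda>l. residue (f i) (P l)" "\<lambda>l. residue (f i) (Q l)"]
  by (simp_all add: num_field_simps cong: map_cong)

lemma \<pi>_carrier [simp]: "\<pi> P \<in> carrier K"
  unfolding K_eq \<pi>_def by (auto intro!: RDirProd_list_carrier_memI simp: component_carrier)

lemma \<pi>_add: "\<pi> P \<oplus>\<^bsub>K\<^esub> \<pi> Q = \<pi> (P + Q)"
  and \<pi>_mult: "\<pi> P \<otimes>\<^bsub>K\<^esub> \<pi> Q = \<pi> (\<lambda>j. P j * Q j)"
  using RDirProd_list_ops_map[of "map component [0..<r]"
      "\<lambda>i. map (\<lambda>l. residue (f i) (P (i, l))) [0..<e i]" "\<lambda>i. map (\<lambda>l. residue (f i) (Q (i, l))) [0..<e i]"]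
  unfolding K_eq \<pi>_def
  by (simp_all add: component_carrier component_ops fun_apply cong: map_cong)

lemma \<pi>_zero: "\<zero>\<^bsub>K\<^esub> = \<pi> 0"
  unfolding K_eq \<pi>_def RDirProd_list_zero_map by (simp add: RDirProd_list_zero_map num_field_simps fun_apply)

lemma carrier_K: "carrier K = range \<pi>"
proof
  show "carrier K \<subseteq> range \<pi>"
  proof
    fix x assume x: "x \<in> carrier K"
    have len: "length x = r" and xi: "\<And>i. i < r \<Longrightarrow> x ! i \<in> carrier (component i)"
      using RDirProd_list_carrier_mem[OF x[unfolded K_eq]] by auto
    have len_i: "length (x ! i) = e i" if "i < r" for i
      using RDirProd_list_carrier_mem(1)[OF xi[OF that]] by simp
    have "x ! i ! l \<in> range (residue (f i))" if "i < r" "l < e i" for i l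
      using RDirProd_list_carrier_mem(2)[OF xi[OF that(1)], of l] that(2) by (simp add: num_field_simps)
    then have "\<forall>i l. \<exists>p. i < r \<longrightarrow> l < e i \<longrightarrow> x ! i ! l = residue (f i) p" by blast
    then obtain p where p: "\<And>i l. i < r \<Longrightarrow> l < e i \<Longrightarrow> x ! i ! l = residue (f i) (p i l)" by metis
    have "x = \<pi> (\<lambda>(i, l). p i l)"
      unfolding \<pi>_def by (auto intro!: nth_equalityI simp: len len_i p)
    then show "x \<in> range \<pi>" by blast
  qed
qed auto

lemma carrier_K_obtain:
  assumes "x \<in> carrier K"
  obtains P where "x = \<pi> P"
  using assms unfolding carrier_K by blast

lemma \<pi>_eq_iff: "\<pi> P = \<pi> Q \<longleftrightarrow> (\<forall>j\<in>Ix. F (fst j) dvd P j - Q j)"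
  by (auto simp: \<pi>_def Ix_def residue_eq_iff F_def)

lemma \<pi>_cong: "(\<And>j. j \<in> Ix \<Longrightarrow> P j = Q j) \<Longrightarrow> \<pi> P = \<pi> Q"
  by (simp add: \<pi>_eq_iff)

lemma \<pi>_finsum: "finite A \<Longrightarrow> (\<Oplus>\<^bsub>K\<^esub>k\<in>A. \<pi> (P k)) = \<pi> (\<Sum>k\<in>A. P k)"
  by (induction A rule: finite_induct) (simp_all add: \<pi>_zero \<pi>_add)

lemma \<pi>_minus: "\<ominus>\<^bsub>K\<^esub> \<pi> P = \<pi> (- P)"
  by (rule K.minus_equality) (simp_all add: \<pi>_add \<pi>_zero)

definition xscale :: "rat \<Rightarrow> (nat \<times> nat \<Rightarrow> rat poly) \<Rightarrow> nat \<times> nat \<Rightarrow> rat poly" where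
  "xscale q P = (\<lambda>j. Polynomial.smult q (P j))"

lemma xscale_simps [simp]:
  "xscale 0 P = 0" "xscale q 0 = 0" "xscale 1 P = P" "xscale q (xscale q' P) = xscale (q * q') P"
  by (simp_all add: xscale_def fun_eq_iff fun_apply)

lemma xscale_add:
  "xscale (q + q') P = xscale q P + xscale q' P" "xscale q (P + Q) = xscale q P + xscale q Q"
  by (simp_all add: xscale_def fun_eq_iff fun_apply smult_add_left smult_add_right)

lemma \<pi>_add_pow_nat: "add_pow K (n :: nat) (\<pi> P) = \<pi> (xscale (of_nat n) P)"
proof (induction n)
  case 0
  show ?case by (simp add: \<pi>_zero)
next
  case (Suc n)
  then show ?case by (simp add: K.add.nat_pow_Suc \<pi>_add xscale_add add.commute)
qed

lemma \<pi>_add_pow: "add_pow K (c :: int) (\<pi> P) = \<pi> (xscale (of_int c) P)"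
proof (cases "c < 0")
  case True
  then have "add_pow K c (\<pi> P) = \<ominus>\<^bsub>K\<^esub> add_pow K (nat (- c)) (\<pi> P)"
    by (simp only: add_pow_def int_pow_def2 a_inv_def if_True)
  also have "\<dots> = \<pi> (xscale (of_int c) P)"
    unfolding \<pi>_add_pow_nat \<pi>_minus using True by (intro \<pi>_cong) (simp add: xscale_def)
  finally show ?thesis .
next
  case False
  then have "add_pow K c (\<pi> P) = add_pow K (nat c) (\<pi> P)"
    by (simp only: add_pow_def int_pow_def2 if_False)
  then show ?thesis unfolding \<pi>_add_pow_nat using False by simp
qed

text \<open>The diagonal corresponds to constant families; this is how \<alpha>, \<open>R\<close>
  and the rational scalars become visible in terms of \<open>\<pi>\<close>.\<close>

lemma Delta_reduce: "Delta r e (reduce r f p) = \<pi> (\<lambda>_. p)"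
  by (simp add: Delta_def reduce_def \<pi>_def residue_def map_replicate_const cong: map_cong)

text \<open>Polynomials congruent modulo the product are congruent modulo every \<open>f i\<close>,
  so the image of a coset is a singleton and \<open>the_elem\<close> picks its only member.\<close>

lemma R0_incl_coset:
  "R0_incl r f (Z_ideal (\<Prod>i<r. f i) +>\<^bsub>ZX\<^esub> g) = reduce r f (of_int_poly g)"
proof -
  let ?C = "Z_ideal (\<Prod>i<r. f i) +>\<^bsub>ZX\<^esub> g"
  have C: "?C = {h. (\<Prod>i<r. f i) dvd h - g}" unfolding Z_ideal_def by (rule type_algebra_coset)
  have "reduce r f (of_int_poly h) = reduce r f (of_int_poly g)" if "h \<in> ?C" for h
  proof -
    have "f i dvd h - g" if "i < r" for i
      using that \<open>h \<in> ?C\<close> dvd_prodI[of "{..<r}" i f] unfolding C by (auto intro: dvd_trans)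
    then have "(of_int_poly (f i) :: rat poly) dvd of_int_poly h - of_int_poly g" if "i < r" for i
      using that of_int_poly_hom.hom_dvd by (metis of_int_poly_hom.hom_minus)
    then show ?thesis by (auto simp: reduce_def residue_eq_iff simp flip: residue_def)
  qed
  moreover have "g \<in> ?C" unfolding C by simp
  ultimately have "(\<lambda>g. reduce r f (of_int_poly g)) ` ?C = {reduce r f (of_int_poly g)}" by blast
  then show ?thesis by (simp add: R0_incl_def)
qed

lemma alpha_eq: "alpha r f e = \<pi> (\<lambda>_. [:0, 1:])"
  by (simp add: alpha_def R0_incl_coset Delta_reduce)

lemma R_order_eq: "R_order r f e = range (\<lambda>g. \<pi> (\<lambda>_. of_int_poly g))"
proof -
  have "carrier (R0 r f) = range (\<lambda>g. Z_ideal (\<Prod>i<r. f i) +>\<^bsub>ZX\<^esub> g)"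
    by (auto simp: R0_def FactRing_def A_RCOSETS_def')
  then show ?thesis by (simp add: R_order_def image_image R0_incl_coset Delta_reduce)
qed

lemma Q_embed_mult: "Q_embed r f e q \<otimes>\<^bsub>K\<^esub> \<pi> P = \<pi> (xscale q P)"
  by (simp add: Q_embed_def Delta_reduce \<pi>_mult xscale_def)

section \<open>Lattices and their bases\<close>

text \<open>\<open>P\<close> lists representatives of the vectors to be combined. Rational
  coefficients will describe \<open>K\<close>, and integral ones, through \<open>zcomb\<close>, a
  lattice inside it.\<close>

definition qcomb :: "nat \<Rightarrow> (nat \<Rightarrow> nat \<times> nat \<Rightarrow> rat poly) \<Rightarrow> (nat \<Rightarrow> rat) \<Rightarrow> rat poly set list list" where
  "qcomb n P q = \<pi> (\<Sum>k<n. xscale (q k) (P k))"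

abbreviation zcomb :: "nat \<Rightarrow> (nat \<Rightarrow> nat \<times> nat \<Rightarrow> rat poly) \<Rightarrow> (nat \<Rightarrow> int) \<Rightarrow> rat poly set list list" where
  "zcomb n P a \<equiv> qcomb n P (\<lambda>k. of_int (a k))"

lemma qcomb_carrier [simp]: "qcomb n P q \<in> carrier K"
  by (simp add: qcomb_def)

lemma qcomb_cong: "(\<And>k. k < n \<Longrightarrow> q k = q' k) \<Longrightarrow> qcomb n P q = qcomb n P q'"
  unfolding qcomb_def by (intro arg_cong[of _ _ \<pi>] sum.cong) auto

lemma qcomb_add: "qcomb n P (q + q') = qcomb n P q \<oplus>\<^bsub>K\<^esub> qcomb n P q'"
  by (simp add: qcomb_def \<pi>_add fun_apply xscale_add sum.distrib)

lemma zcomb_add: "zcomb n P (a + b) = zcomb n P a \<oplus>\<^bsub>K\<^esub> zcomb n P b"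
  unfolding qcomb_add[symmetric] by (rule qcomb_cong) (simp add: fun_apply)

lemma xscale_sum: "xscale c (sum P A) = (\<Sum>k\<in>A. xscale c (P k))"
  by (induction A rule: infinite_finite_induct) (simp_all add: xscale_add)

lemma qcomb_fscale: "qcomb n P (fscale c q) = \<pi> (xscale c (\<Sum>k<n. xscale (q k) (P k)))"
  by (simp add: qcomb_def xscale_sum fscale_def)

lemma qcomb_zero [simp]: "qcomb n P 0 = \<pi> 0"
  by (simp add: qcomb_def fun_apply)

lemma zcomb_zero [simp]: "zcomb n P 0 = \<pi> 0"
  by (simp add: qcomb_def fun_apply)

lemma qcomb_unit: "k < n \<Longrightarrow> qcomb n P (unit_fun k) = \<pi> (P k)"
  unfolding qcomb_def
proof (rule arg_cong[of _ _ \<pi>])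
  assume k: "k < n"
  have "(\<Sum>i<n. xscale (unit_fun k i) (P i)) = (\<Sum>i<n. if i = k then P i else 0)"
    by (intro sum.cong) (auto simp: unit_fun_def)
  then show "(\<Sum>i<n. xscale (unit_fun k i) (P i)) = P k" using k by simp
qed

lemma zcomb_unit: "k < n \<Longrightarrow> zcomb n P (unit_fun k) = \<pi> (P k)"
  using qcomb_unit[of k n P] by (simp add: unit_fun_def if_distrib[of of_int] cong: if_cong)

text \<open>Rational scaling is defined on families; this says that it descends to \<open>K\<close>,
  which is what clearing denominators needs.\<close>

lemma \<pi>_xscale_cong: "\<pi> P = \<pi> Q \<Longrightarrow> \<pi> (xscale c P) = \<pi> (xscale c Q)"
  by (auto simp: \<pi>_eq_iff xscale_def intro: dvd_smult simp flip: smult_diff_right)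

lemma \<pi>_xscale_cancel:
  assumes "c \<noteq> 0" "\<pi> (xscale c P) = \<pi> (xscale c Q)"
  shows "\<pi> P = \<pi> Q"
  using \<pi>_xscale_cong[OF assms(2), of "inverse c"] assms(1) by simp

lemma alpha_mult: "alpha r f e \<otimes>\<^bsub>K\<^esub> \<pi> P = \<pi> (\<lambda>j. [:0, 1:] * P j)"
  by (simp only: alpha_eq \<pi>_mult)

lemma alpha_xscale:
  assumes "alpha r f e \<otimes>\<^bsub>K\<^esub> \<pi> P = \<pi> Q"
  shows "alpha r f e \<otimes>\<^bsub>K\<^esub> \<pi> (xscale c P) = \<pi> (xscale c Q)"
proof -
  have "alpha r f e \<otimes>\<^bsub>K\<^esub> \<pi> (xscale c P) = \<pi> (xscale c (\<lambda>j. [:0, 1:] * P j))"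
    unfolding alpha_mult by (rule \<pi>_cong) (simp add: xscale_def)
  then show ?thesis using \<pi>_xscale_cong[of "\<lambda>j. [:0, 1:] * P j" Q c] assms unfolding alpha_mult by simp
qed

lemma alpha_carrier [simp]: "alpha r f e \<in> carrier K"
  by (simp add: alpha_eq)

lemma latticesD:
  assumes "I \<in> lattices r f e"
  shows "subgroup I (add_monoid K)"
    and "\<exists>S. finite S \<and> S \<subseteq> I \<and> I = generate (add_monoid K) S"
    and "generate (add_monoid K) {Q_embed r f e q \<otimes>\<^bsub>K\<^esub> w | q w. w \<in> I} = carrier K"
    and "\<And>\<rho> w. \<rho> \<in> R_order r f e \<Longrightarrow> w \<in> I \<Longrightarrow> \<rho> \<otimes>\<^bsub>K\<^esub> w \<in> I"
  using assms by (auto simp: lattices_def full_lattice_def)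

lemma lattice_subset: "I \<in> lattices r f e \<Longrightarrow> I \<subseteq> carrier K"
  using subgroup.subset[OF latticesD(1)] by simp

lemma alpha_R_order: "alpha r f e \<in> R_order r f e"
  unfolding R_order_eq alpha_eq by (intro range_eqI[of _ _ "[:0, 1:]"]) simp

lemma subgroup_zscale:
  assumes "subgroup I (add_monoid K)" "\<pi> P \<in> I"
  shows "\<pi> (xscale (of_int c) P) \<in> I"
  using K.add.subgroup_int_pow_closed[OF assms, of c] by (simp add: \<pi>_add_pow add_pow_def[symmetric])

lemma subgroup_zcomb:
  assumes "subgroup I (add_monoid K)" "\<And>k. k < n \<Longrightarrow> \<pi> (P k) \<in> I"
  shows "zcomb n P a \<in> I"
  unfolding qcomb_def using assms(2)
proof (induction n)
  case 0
  show ?case using subgroup.one_closed[OF assms(1)] by (simp add: \<pi>_zero)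
next
  case (Suc n)
  then have "\<pi> (\<Sum>k<n. xscale (of_int (a k)) (P k)) \<in> I" "\<pi> (xscale (of_int (a n)) (P n)) \<in> I"
    using subgroup_zscale[OF assms(1)] by auto
  from subgroup.m_closed[OF assms(1) this] show ?case by (simp add: \<pi>_add)
qed

lemma finsum_add_pow:
  assumes "length ws = n" "\<And>k. k < n \<Longrightarrow> ws ! k = \<pi> (P k)"
  shows "(\<Oplus>\<^bsub>K\<^esub>k\<in>{..<n}. add_pow K (a k :: int) (ws ! k)) = zcomb n P a"
proof -
  have "(\<Oplus>\<^bsub>K\<^esub>k\<in>{..<n}. add_pow K (a k) (ws ! k)) = (\<Oplus>\<^bsub>K\<^esub>k\<in>{..<n}. \<pi> (xscale (of_int (a k)) (P k)))"
    by (rule K.finsum_cong') (auto simp: assms(2) \<pi>_add_pow)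
  then show ?thesis by (simp add: \<pi>_finsum qcomb_def)
qed

text \<open>Trades unique existence of a coefficient vector for a coordinate bijection, the form in
  which bases are used from here on. Integer vectors of length \<open>n\<close> correspond to
  functions vanishing from \<open>n\<close> on.\<close>

lemma Z_basis_iff:
  assumes I: "subgroup I (add_monoid K)" and ws: "length ws = n" "\<And>k. k < n \<Longrightarrow> ws ! k = \<pi> (P k)"
  shows "is_Z_basis K I ws \<longleftrightarrow> bij_betw (zcomb n P) (vecs n) I"
proof -
  have fin: "(\<Oplus>\<^bsub>K\<^esub>k\<in>{..<n}. add_pow K (a $ k) (ws ! k)) = zcomb n P (\<lambda>k. a $ k)" for a :: "int vec"
    by (rule finsum_add_pow[OF ws])
  show ?thesis
  proof
    assume b: "is_Z_basis K I ws"
    have w_I: "\<pi> (P k) \<in> I" if "k < n" for k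
      using b that ws by (metis is_Z_basis_def nth_mem subsetD)
    have ex1: "\<exists>!a :: int vec. a \<in> carrier_vec n \<and> v = zcomb n P (\<lambda>k. a $ k)" if "v \<in> I" for v
      using b that unfolding is_Z_basis_def ws(1) fin by simp
    show "bij_betw (zcomb n P) (vecs n) I"
      unfolding bij_betw_def
    proof
      show "inj_on (zcomb n P) (vecs n)"
      proof (rule inj_onI)
        fix a b :: "nat \<Rightarrow> int" assume ab: "a \<in> vecs n" "b \<in> vecs n" "zcomb n P a = zcomb n P b"
        have "zcomb n P (\<lambda>k. vec n a $ k) = zcomb n P a" "zcomb n P (\<lambda>k. vec n b $ k) = zcomb n P b"
          by (auto intro: qcomb_cong)
        moreover have "zcomb n P a \<in> I" using subgroup_zcomb[OF I w_I] .
        ultimately have "vec n a = vec n b"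
          using ex1[of "zcomb n P a"] ab(3) by (metis vec_carrier)
        then have eq: "a k = b k" if "k < n" for k using that by (metis index_vec)
        have "a k = b k" for k using eq ab(1,2) by (cases "k < n") (simp_all add: vecs_def)
        then show "a = b" by blast
      qed
      show "zcomb n P ` vecs n = I"
      proof
        show "zcomb n P ` vecs n \<subseteq> I" using subgroup_zcomb[where P = P, OF I w_I] by auto
        show "I \<subseteq> zcomb n P ` vecs n"
        proof
          fix v assume "v \<in> I"
          then obtain a :: "int vec" where "a \<in> carrier_vec n" "v = zcomb n P (\<lambda>k. a $ k)" using ex1 by blast
          \<comment> \<open>The entries of \<open>a\<close> beyond its length are not known to
            vanish, so they are overwritten by 0 to land in \<open>vecs n\<close>.\<close>
          then have "v = zcomb n P (\<lambda>k. if k < n then a $ k else 0)" by (auto intro: qcomb_cong)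
          then show "v \<in> zcomb n P ` vecs n"
            by (intro image_eqI[of _ _ "\<lambda>k. if k < n then a $ k else 0"]) (simp_all add: vecs_def)
        qed
      qed
    qed
  next
    assume b: "bij_betw (zcomb n P) (vecs n) I"
    have "\<pi> (P k) \<in> I" if "k < n" for k
      using bij_betw_apply[OF b unit_fun_vecs[OF that]] that by (simp add: zcomb_unit)
    then have "set ws \<subseteq> I" using ws by (auto simp: in_set_conv_nth)
    moreover have "\<exists>!a :: int vec. a \<in> carrier_vec n \<and> v = zcomb n P (\<lambda>k. a $ k)" if "v \<in> I" for v
    proof -
      have "v \<in> zcomb n P ` vecs n" using bij_betw_imp_surj_on[OF b] that by simp
      then obtain a where a: "a \<in> vecs n" "v = zcomb n P a" by (elim imageE)
      show ?thesis
      proof (rule ex1I[of _ "vec n a"])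
        show "vec n a \<in> carrier_vec n \<and> v = zcomb n P (\<lambda>k. vec n a $ k)"
          using a(2) by (auto intro: qcomb_cong)
        fix a' :: "int vec" assume a': "a' \<in> carrier_vec n \<and> v = zcomb n P (\<lambda>k. a' $ k)"
        let ?a = "\<lambda>k. if k < n then a' $ k else 0"
        have "zcomb n P ?a = zcomb n P (\<lambda>k. a' $ k)" by (auto intro: qcomb_cong)
        then have "?a = a" using a' a b by (intro inj_onD[OF bij_betw_imp_inj_on[OF b]]) (auto simp: vecs_def)
        then show "a' = vec n a" using a' by (intro eq_vecI) auto
      qed
    qed
    ultimately show "is_Z_basis K I ws"
      unfolding is_Z_basis_def ws(1) fin by simp
  qed
qed

lemma representatives:
  assumes "set ws \<subseteq> carrier K"
  shows "\<exists>P. \<forall>k<length ws. ws ! k = \<pi> (P k)"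
proof -
  have "\<forall>k. \<exists>P. k < length ws \<longrightarrow> ws ! k = \<pi> P"
    using assms unfolding carrier_K by (auto dest!: nth_mem)
  then show ?thesis by (rule choice)
qed

text \<open>Remainders modulo the \<open>F i\<close>, and 0 off \<open>Ix\<close>: representatives
  compatible with addition and rational scaling, on which \<open>\<pi>\<close> is injective.
  Relations in \<open>K\<close> can therefore be lifted to relations between families.\<close>

definition canon :: "(nat \<times> nat \<Rightarrow> rat poly) \<Rightarrow> nat \<times> nat \<Rightarrow> rat poly" where
  "canon P = (\<lambda>j. if j \<in> Ix then P j mod F (fst j) else 0)"

lemma canon_add: "canon (P + Q) = canon P + canon Q"
  by (auto simp: canon_def fun_eq_iff fun_apply poly_mod_add_left)

lemma canon_xscale: "canon (xscale c P) = xscale c (canon P)"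
  by (auto simp: canon_def xscale_def fun_eq_iff mod_smult_left)

lemma canon_zero [simp]: "canon 0 = 0"
  by (auto simp: canon_def fun_eq_iff fun_apply)

lemma canon_idem [simp]: "canon (canon P) = canon P"
  by (auto simp: canon_def fun_eq_iff)

lemma \<pi>_canon [simp]: "\<pi> (canon P) = \<pi> P"
proof -
  have "F (fst j) dvd P j mod F (fst j) - P j" for j
    by (metis dvd_minus_iff minus_diff_eq minus_mod_eq_mult_div dvd_triv_left)
  then show ?thesis by (simp add: \<pi>_eq_iff canon_def)
qed

lemma canon_eq_zero: "\<pi> P = \<pi> 0 \<Longrightarrow> canon P = 0"
  by (auto simp: canon_def fun_eq_iff fun_apply \<pi>_eq_iff)

text \<open>Rational coefficients leave no integer torsion, so the families are an ambient group in
  which finitely generated subgroups have bases.\<close>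

interpretation zmod: torsion_free_int_module "\<lambda>c. xscale (of_int c)"
proof unfold_locales
  fix c :: int and v :: "nat \<times> nat \<Rightarrow> rat poly"
  assume 0: "xscale (of_int c) v = 0"
  have "v j = 0" if "c \<noteq> 0" for j
    using fun_cong[OF 0, of j] that by (simp add: xscale_def fun_apply)
  then show "c = 0 \<or> v = 0" by (auto simp: fun_eq_iff fun_apply)
qed (simp_all add: xscale_add)

text \<open>The generators are lifted to canonical representatives. On the integer span of these
  \<open>\<pi>\<close> is injective, so a basis of the span maps to a basis of the lattice.\<close>

lemma lattice_basis_exists:
  assumes I: "I \<in> lattices r f e"
  shows "\<exists>n P. bij_betw (zcomb n P) (vecs n) I"
proof -
  obtain S where S: "finite S" "S \<subseteq> I" "I = generate (add_monoid K) S" using latticesD(2)[OF I] by blast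
  have sub: "subgroup I (add_monoid K)" by (rule latticesD(1)[OF I])
  have "\<forall>v. \<exists>P. v \<in> S \<longrightarrow> v = \<pi> P" using S(2) lattice_subset[OF I] unfolding carrier_K by blast
  then obtain rep where rep: "\<And>v. v \<in> S \<Longrightarrow> v = \<pi> (rep v)" by metis
  define T where "T = (\<lambda>v. canon (rep v)) ` S"
  have "finite T" using S(1) by (simp add: T_def)
  then obtain n :: nat and b where b: "zmod.span (b ` {..<n}) = zmod.span T"
    and ind: "\<And>a. (\<Sum>k<n. xscale (of_int (a k)) (b k)) = 0 \<Longrightarrow> \<forall>k<n. a k = 0"
    using zmod.finitely_generated_basis[of T] by blast
  \<comment> \<open>The families fixed by \<open>canon\<close> form a subgroup, so injectivity of
    \<open>\<pi>\<close> is available on all of the span and not only on \<open>T\<close>.\<close>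
  have "zmod.span T \<subseteq> {Q. canon Q = Q}"
    by (rule zmod.span_minimal) (auto simp: zmod.subspace_def canon_add canon_xscale T_def)
  then have canon_span: "canon Q = Q" if "Q \<in> zmod.span T" for Q
    using that by blast
  have I_eq: "I = \<pi> ` zmod.span T"
  proof
    show "I \<subseteq> \<pi> ` zmod.span T"
    proof
      fix v assume "v \<in> I"
      then have "v \<in> generate (add_monoid K) S" using S(3) by simp
      then show "v \<in> \<pi> ` zmod.span T"
      proof (induction v rule: generate.induct)
        case one
        show ?case using zmod.span_zero by (auto simp: \<pi>_zero)
      next
        case (incl v)
        then have "v = \<pi> (canon (rep v))" using rep by simp
        then show ?case using incl by (intro image_eqI[of _ _ "canon (rep v)"]) (auto simp: T_def intro: zmod.span_base)
      next
        case (inv v)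
        then have "v = \<pi> (canon (rep v))" using rep by simp
        then have eq: "inv\<^bsub>add_monoid K\<^esub> v = \<pi> (- canon (rep v))" using \<pi>_minus by (metis a_inv_def)
        have "canon (rep v) \<in> T" using inv by (simp add: T_def)
        then have "- canon (rep v) \<in> zmod.span T" by (intro zmod.span_neg zmod.span_base)
        then show ?case unfolding eq by (rule imageI)
      next
        case (eng v w)
        then obtain P Q where "v = \<pi> P" "w = \<pi> Q" "P \<in> zmod.span T" "Q \<in> zmod.span T" by blast
        then show ?case by (intro image_eqI[of _ _ "P + Q"]) (auto simp: \<pi>_add intro: zmod.span_add)
      qed
    qed
    have "zmod.subspace {Q. \<pi> Q \<in> I}"
      using subgroup_zscale[OF sub] subgroup.one_closed[OF sub] subgroup.m_closed[OF sub]
      by (auto simp: zmod.subspace_def \<pi>_zero \<pi>_add[symmetric])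
    moreover have "T \<subseteq> {Q. \<pi> Q \<in> I}" using rep S(2) by (auto simp: T_def)
    ultimately show "\<pi> ` zmod.span T \<subseteq> I" using zmod.span_minimal by blast
  qed
  have "bij_betw (zcomb n b) (vecs n) I"
    unfolding bij_betw_def
  proof
    have mem: "(\<Sum>k<n. xscale (of_int (a k)) (b k)) \<in> zmod.span T" for a :: "nat \<Rightarrow> int"
      unfolding b[symmetric] zmod.mem_span_image_lessThan by blast
    show "inj_on (zcomb n b) (vecs n)"
    proof (rule inj_onI)
      fix x y :: "nat \<Rightarrow> int" assume xy: "x \<in> vecs n" "y \<in> vecs n" "zcomb n b x = zcomb n b y"
      let ?Q = "\<Sum>k<n. xscale (of_int ((x - y) k)) (b k)"
      have "zcomb n b ((x - y) + y) = zcomb n b (x - y) \<oplus>\<^bsub>K\<^esub> zcomb n b y" by (rule zcomb_add)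
      then have "zcomb n b y = zcomb n b (x - y) \<oplus>\<^bsub>K\<^esub> zcomb n b y" using xy(3) by simp
      then have "zcomb n b (x - y) = \<zero>\<^bsub>K\<^esub>"
        using K.add.l_cancel_one'[of "zcomb n b y" "zcomb n b (x - y)"] by simp
      then have "\<pi> ?Q = \<pi> 0" by (simp add: qcomb_def \<pi>_zero)
      then have "?Q = 0" using canon_span[OF mem] canon_eq_zero by metis
      then have "\<forall>k<n. (x - y) k = 0" by (rule ind)
      then have "x k = y k" for k using xy(1,2) by (cases "k < n") (auto simp: vecs_def fun_apply)
      then show "x = y" by blast
    qed
    show "zcomb n b ` vecs n = I"
    proof
      show "zcomb n b ` vecs n \<subseteq> I" unfolding I_eq qcomb_def using mem by blast
      show "I \<subseteq> zcomb n b ` vecs n"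
      proof
        fix v assume "v \<in> I"
        then obtain Q where Q: "v = \<pi> Q" "Q \<in> zmod.span (b ` {..<n})" unfolding I_eq b by blast
        then obtain p where "Q = (\<Sum>k<n. xscale (of_int (p k)) (b k))"
          unfolding zmod.mem_span_image_lessThan by blast
        then have "v = zcomb n b p" using Q(1) by (simp add: qcomb_def)
        also have "\<dots> = zcomb n b (\<lambda>k. if k < n then p k else 0)" by (rule qcomb_cong) simp
        finally show "v \<in> zcomb n b ` vecs n"
          by (intro image_eqI[of _ _ "\<lambda>k. if k < n then p k else 0"]) (simp_all add: vecs_def)
      qed
    qed
  qed
  then show ?thesis by blast
qed

end

section \<open>The matrix of a lattice\<close>

lemma vecs_of_int: "(\<lambda>k. rat_of_int (a k)) \<in> vecs n \<longleftrightarrow> a \<in> vecs n"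
  by (simp add: vecs_def)

lemma mat_app_of_int:
  "mat_app (map_mat of_int A) (\<lambda>k. of_int (a k)) = (\<lambda>k. of_int (mat_app A a k))"
  by (auto simp: mat_app_def fun_eq_iff)

lemma act_of_int:
  "act (map_mat of_int A) (of_int_poly g) (\<lambda>k. of_int (a k)) = (\<lambda>k. of_int (act A g a k) :: rat)"
proof (induction g)
  case 0
  show ?case by (simp add: fun_eq_iff fun_apply)
next
  case (pCons c g)
  then show ?case
    by (simp add: act_pCons mat_app_of_int of_int_hom.map_poly_pCons_hom) (simp add: fun_eq_iff fun_apply fscale_def)
qed

context irreducible_factors begin

lemma zcomb_fscale: "zcomb n P (fscale c a) = \<pi> (xscale (of_int c) (\<Sum>k<n. xscale (of_int (a k)) (P k)))"
  unfolding qcomb_fscale[symmetric] by (rule qcomb_cong) (simp add: fscale_def)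

text \<open>Stability of the lattice under \<alpha> lets the multiplication be pulled back along the
  coordinate bijection, and injectivity of the coordinates turns identities in \<open>K\<close> into
  linearity of the resulting map.\<close>

lemma multiplication_matrix:
  assumes I: "I \<in> lattices r f e" and bij: "bij_betw (zcomb n P) (vecs n) I"
  obtains A where "A \<in> carrier_mat n n"
    and "\<And>a. a \<in> vecs n \<Longrightarrow> alpha r f e \<otimes>\<^bsub>K\<^esub> zcomb n P a = zcomb n P (mat_app A a)"
proof -
  let ?\<alpha> = "alpha r f e"
  define L where "L a = inv_into (vecs n) (zcomb n P) (?\<alpha> \<otimes>\<^bsub>K\<^esub> zcomb n P a)" for a
  have L: "L a \<in> vecs n \<and> zcomb n P (L a) = ?\<alpha> \<otimes>\<^bsub>K\<^esub> zcomb n P a" if "a \<in> vecs n" for a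
  proof -
    have "?\<alpha> \<otimes>\<^bsub>K\<^esub> zcomb n P a \<in> zcomb n P ` vecs n"
      using latticesD(4)[OF I alpha_R_order bij_betw_apply[OF bij that]] bij by (simp add: bij_betw_def)
    from inv_into_into[OF this] f_inv_into_f[OF this] show ?thesis unfolding L_def ..
  qed
  have inj: "a = b" if "a \<in> vecs n" "b \<in> vecs n" "zcomb n P a = zcomb n P b" for a b
    using inj_onD[OF bij_betw_imp_inj_on[OF bij]] that by blast
  have app: "mat_app (mat n n (\<lambda>(i, j). L (unit_fun j) i)) a = L a" if "a \<in> vecs n" for a
  proof (rule mat_of_linear[OF _ _ _ that])
    fix v w :: "nat \<Rightarrow> int" and c assume v: "v \<in> vecs n"
    show "L v \<in> vecs n" using L[OF v] ..
    show "L (fscale c v) = fscale c (L v)"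
    proof (rule inj)
      have "?\<alpha> \<otimes>\<^bsub>K\<^esub> \<pi> (\<Sum>k<n. xscale (of_int (v k)) (P k)) = \<pi> (\<Sum>k<n. xscale (of_int (L v k)) (P k))"
        using L[OF v] by (simp add: qcomb_def)
      then show "zcomb n P (L (fscale c v)) = zcomb n P (fscale c (L v))"
        using L[of "fscale c v"] v unfolding zcomb_fscale by (simp add: alpha_xscale)
    qed (use L v in auto)
    assume w: "w \<in> vecs n"
    show "L (v + w) = L v + L w"
    proof (rule inj)
      show "zcomb n P (L (v + w)) = zcomb n P (L v + L w)"
        using L[of "v + w"] L[of v] L[of w] v w by (simp add: zcomb_add K.r_distr)
    qed (use L v w in auto)
  qed
  show thesis
  proof (rule that)
    fix a :: "nat \<Rightarrow> int" assume a: "a \<in> vecs n"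
    show "?\<alpha> \<otimes>\<^bsub>K\<^esub> zcomb n P a = zcomb n P (mat_app (mat n n (\<lambda>(i, j). L (unit_fun j) i)) a)"
      unfolding app[OF a] using L[OF a] by simp
  qed simp
qed

text \<open>\<open>mult_matrix\<close> is a definite description; injectivity of the coordinates
  forces any two candidates to have the same columns.\<close>

lemma mult_matrix_eqI:
  assumes ws: "length ws = n" "\<And>k. k < n \<Longrightarrow> ws ! k = \<pi> (P k)"
    and inj: "inj_on (zcomb n P) (vecs n)" and A: "A \<in> carrier_mat n n"
    and app: "\<And>a. a \<in> vecs n \<Longrightarrow> alpha r f e \<otimes>\<^bsub>K\<^esub> zcomb n P a = zcomb n P (mat_app A a)"
  shows "mult_matrix r f e ws = A"
proof -
  have col: "alpha r f e \<otimes>\<^bsub>K\<^esub> ws ! k = zcomb n P (mat_app A (unit_fun k))" if "k < n" for k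
    using app[OF unit_fun_vecs[OF that]] that by (simp add: zcomb_unit ws)
  have fin: "(\<Oplus>\<^bsub>K\<^esub>h\<in>{..<n}. add_pow K (B $$ (h, k)) (ws ! h)) = zcomb n P (mat_app B (unit_fun k))"
    if "B \<in> carrier_mat n n" "k < n" for B k
    using finsum_add_pow[OF ws, of "\<lambda>h. B $$ (h, k)"] that
    by (auto simp: mat_app_unit intro: qcomb_cong)
  show ?thesis
    unfolding mult_matrix_def ws(1)
  proof (rule the_equality)
    show "A \<in> carrier_mat n n \<and> (\<forall>k<n. alpha r f e \<otimes>\<^bsub>K\<^esub> ws ! k =
        (\<Oplus>\<^bsub>K\<^esub>h\<in>{..<n}. add_pow K (A $$ (h, k)) (ws ! h)))"
      using A col fin[OF A] by simp
    fix B :: "int mat" assume B: "B \<in> carrier_mat n n \<and> (\<forall>k<n. alpha r f e \<otimes>\<^bsub>K\<^esub> ws ! k =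
        (\<Oplus>\<^bsub>K\<^esub>h\<in>{..<n}. add_pow K (B $$ (h, k)) (ws ! h)))"
    show "B = A"
    proof (rule eq_matI)
      fix h k assume "h < dim_row A" "k < dim_col A"
      then have hk: "h < n" "k < n" using A by auto
      have "zcomb n P (mat_app B (unit_fun k)) = zcomb n P (mat_app A (unit_fun k))"
        using B col fin[of B k] hk by simp
      then have "mat_app B (unit_fun k) = mat_app A (unit_fun k)"
        using A B by (intro inj_onD[OF inj]) auto
      then have "mat_app B (unit_fun k) h = mat_app A (unit_fun k) h" by simp
      then show "B $$ (h, k) = A $$ (h, k)"
        using mat_app_unit[of h B k] mat_app_unit[of h A k] A conjunct1[OF B] hk by simp
    qed (use A B in auto)
  qed
qed

section \<open>Extending coordinates from a lattice to \<open>K\<close>\<close>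

lemma common_denominator_fun:
  fixes q :: "nat \<Rightarrow> rat"
  assumes "q \<in> vecs n"
  obtains d :: int and a where "d > 0" "a \<in> vecs n" "fscale (of_int d) q = (\<lambda>k. of_int (a k))"
proof -
  obtain d :: int where d: "d > 0" "\<forall>x\<in>q ` {..<n}. of_int d * x \<in> \<int>"
    using common_denominator[of "q ` {..<n}"] by auto
  have "of_int d * q k \<in> \<int>" for k
    using d(2) assms by (cases "k < n") (auto simp: vecs_def)
  then have "fscale (of_int d) q = (\<lambda>k. of_int \<lfloor>of_int d * q k\<rfloor>)"
    by (simp add: fscale_def of_int_floor)
  moreover have "(\<lambda>k. \<lfloor>of_int d * q k\<rfloor>) \<in> vecs n" using assms by (simp add: vecs_def)
  ultimately show thesis using that d(1) by blast
qed

text \<open>A rational relation becomes an integral one after clearing denominators, whence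
  injectivity; surjectivity is fullness of the lattice, since rational multiples of lattice elements
  are rational combinations of its basis.\<close>

lemma qcomb_bij:
  assumes I: "I \<in> lattices r f e" and bij: "bij_betw (zcomb n P) (vecs n) I"
  shows "bij_betw (qcomb n P) (vecs n) (carrier K)"
  unfolding bij_betw_def
proof
  show "inj_on (qcomb n P) (vecs n)"
  proof (rule inj_onI)
    fix x y :: "nat \<Rightarrow> rat" assume xy: "x \<in> vecs n" "y \<in> vecs n" "qcomb n P x = qcomb n P y"
    obtain d :: int and a where d: "d > 0" "a \<in> vecs n" "fscale (of_int d) (x - y) = (\<lambda>k. of_int (a k))"
      using common_denominator_fun[OF vecs_minus[OF xy(1,2)]] .
    have "qcomb n P ((x - y) + y) = qcomb n P (x - y) \<oplus>\<^bsub>K\<^esub> qcomb n P y" by (rule qcomb_add)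
    then have "qcomb n P y = qcomb n P (x - y) \<oplus>\<^bsub>K\<^esub> qcomb n P y" using xy(3) by simp
    then have 0: "\<pi> (\<Sum>k<n. xscale ((x - y) k) (P k)) = \<pi> 0"
      using K.add.l_cancel_one'[of "qcomb n P y" "qcomb n P (x - y)"] by (simp add: qcomb_def \<pi>_zero)
    have "zcomb n P a = zcomb n P 0"
      using \<pi>_xscale_cong[OF 0, of "of_int d"] unfolding d(3)[symmetric] qcomb_fscale by simp
    then have "a = 0" using d(2) by (intro inj_onD[OF bij_betw_imp_inj_on[OF bij]]) auto
    then have "of_int d * (x - y) k = 0" for k
      using fun_cong[OF d(3), of k] by (simp add: fscale_def fun_apply)
    then have "x k = y k" for k using d(1) by (simp add: fun_apply)
    then show "x = y" by blast
  qed
  show "qcomb n P ` vecs n = carrier K"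
  proof
    show "carrier K \<subseteq> qcomb n P ` vecs n"
    proof
      fix v assume "v \<in> carrier K"
      then have "v \<in> generate (add_monoid K) {Q_embed r f e q \<otimes>\<^bsub>K\<^esub> w | q w. w \<in> I}"
        using latticesD(3)[OF I] by simp
      then show "v \<in> qcomb n P ` vecs n"
      proof (induction v rule: generate.induct)
        case one
        have "\<one>\<^bsub>add_monoid K\<^esub> = qcomb n P 0" by (simp add: \<pi>_zero)
        then show ?case by (intro image_eqI[of _ _ 0]) simp_all
      next
        case (incl v)
        then obtain q w where w: "v = Q_embed r f e q \<otimes>\<^bsub>K\<^esub> w" "w \<in> I" by blast
        then obtain a where a: "a \<in> vecs n" "w = zcomb n P a" using bij by (auto simp: bij_betw_def)
        then have "v = qcomb n P (fscale q (\<lambda>k. of_int (a k)))"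
          unfolding w(1) a(2) qcomb_fscale by (simp add: qcomb_def Q_embed_mult)
        then show ?case using a(1)
          by (intro image_eqI[of _ _ "fscale q (\<lambda>k. of_int (a k))"]) (simp_all add: vecs_of_int)
      next
        case (inv v)
        then obtain q w where w: "v = Q_embed r f e q \<otimes>\<^bsub>K\<^esub> w" "w \<in> I" by blast
        then obtain a where a: "a \<in> vecs n" "w = zcomb n P a" using bij by (auto simp: bij_betw_def)
        let ?s = "\<Sum>k<n. xscale (of_int (a k)) (P k)"
        have "inv\<^bsub>add_monoid K\<^esub> v = \<ominus>\<^bsub>K\<^esub> \<pi> (xscale q ?s)"
          unfolding w(1) a(2) by (simp add: qcomb_def Q_embed_mult a_inv_def)
        also have "\<dots> = \<pi> (xscale (- q) ?s)"
          unfolding \<pi>_minus by (rule \<pi>_cong) (simp add: xscale_def)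
        also have "\<dots> = qcomb n P (fscale (- q) (\<lambda>k. of_int (a k)))" by (simp add: qcomb_fscale)
        finally show ?case using a(1)
          by (intro image_eqI[of _ _ "fscale (- q) (\<lambda>k. of_int (a k))"]) (simp_all add: vecs_of_int)
      next
        case (eng v w)
        then obtain x y where xy: "x \<in> vecs n" "y \<in> vecs n" "v = qcomb n P x" "w = qcomb n P y" by blast
        then have "v \<otimes>\<^bsub>add_monoid K\<^esub> w = qcomb n P (x + y)" by (simp add: qcomb_add)
        then show ?case using xy(1,2) by (intro image_eqI[of _ _ "x + y"]) simp_all
      qed
    qed
  qed auto
qed

text \<open>The model reads off rational coordinates. The action of x is tied to the matrix only on
  integral coordinates at first; denominators are cleared, the hypothesis is applied, and the scalar
  is cancelled again.\<close>

lemma lattice_model: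
  assumes I: "I \<in> lattices r f e" and bij: "bij_betw (zcomb n P) (vecs n) I" and A: "A \<in> carrier_mat n n"
    and app: "\<And>a. a \<in> vecs n \<Longrightarrow> alpha r f e \<otimes>\<^bsub>K\<^esub> zcomb n P a = zcomb n P (mat_app A a)"
  shows "\<exists>\<Theta>. model n (map_mat of_int A) \<Theta>"
proof -
  let ?A = "map_mat rat_of_int A" and ?V = "vecs n :: (nat \<Rightarrow> rat) set"
  have A': "?A \<in> carrier_mat n n" using A by simp
  note qbij = qcomb_bij[OF I bij]
  define \<Theta> where "\<Theta> Q = inv_into ?V (qcomb n P) (\<pi> Q)" for Q
  have \<Theta>: "\<Theta> Q \<in> ?V" "qcomb n P (\<Theta> Q) = \<pi> Q" for Q
  proof -
    have "\<pi> Q \<in> qcomb n P ` ?V" using qbij by (simp add: bij_betw_def)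
    then show "\<Theta> Q \<in> ?V" "qcomb n P (\<Theta> Q) = \<pi> Q"
      unfolding \<Theta>_def by (simp_all add: inv_into_into f_inv_into_f)
  qed
  have \<Theta>I: "\<Theta> Q = q" if "q \<in> ?V" "qcomb n P q = \<pi> Q" for q Q
    using \<Theta>[of Q] that by (intro inj_onD[OF bij_betw_imp_inj_on[OF qbij]]) auto
  have add: "\<Theta> (Q + R) = \<Theta> Q + \<Theta> R" for Q R
    by (rule \<Theta>I) (simp_all add: \<Theta> qcomb_add \<pi>_add)
  have scale: "\<Theta> (xscale c Q) = fscale c (\<Theta> Q)" for c Q
  proof (rule \<Theta>I)
    have "\<pi> (\<Sum>k<n. xscale (\<Theta> Q k) (P k)) = \<pi> Q" using \<Theta>(2)[of Q] by (simp add: qcomb_def)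
    then show "qcomb n P (fscale c (\<Theta> Q)) = \<pi> (xscale c Q)"
      unfolding qcomb_fscale by (rule \<pi>_xscale_cong)
  qed (simp add: \<Theta>)
  have x: "\<Theta> (\<lambda>j. [:0, 1:] * Q j) = mat_app ?A (\<Theta> Q)" for Q
  proof (rule \<Theta>I)
    obtain d :: int and a where d: "d > 0" "a \<in> vecs n" "fscale (of_int d) (\<Theta> Q) = (\<lambda>k. of_int (a k))"
      using common_denominator_fun[OF \<Theta>(1)[of Q]] .
    have "zcomb n P a = \<pi> (xscale (of_int d) Q)"
      unfolding d(3)[symmetric] scale[symmetric] by (rule \<Theta>(2))
    then have "\<pi> (xscale (of_int d) (\<lambda>j. [:0, 1:] * Q j)) = alpha r f e \<otimes>\<^bsub>K\<^esub> zcomb n P a"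
      using alpha_xscale[OF alpha_mult] by simp
    also have "\<dots> = qcomb n P (mat_app ?A (\<lambda>k. of_int (a k)))"
      unfolding app[OF d(2)] mat_app_of_int ..
    also have "\<dots> = \<pi> (xscale (of_int d) (\<Sum>k<n. xscale (mat_app ?A (\<Theta> Q) k) (P k)))"
      unfolding d(3)[symmetric] mat_app_fscale qcomb_fscale ..
    finally have eq: "\<pi> (xscale (of_int d) (\<lambda>j. [:0, 1:] * Q j)) =
        \<pi> (xscale (of_int d) (\<Sum>k<n. xscale (mat_app ?A (\<Theta> Q) k) (P k)))" .
    show "qcomb n P (mat_app ?A (\<Theta> Q)) = \<pi> (\<lambda>j. [:0, 1:] * Q j)"
      unfolding qcomb_def by (rule \<pi>_xscale_cancel[OF _ eq[symmetric]]) (use d(1) in simp)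
  qed (use A in simp)
  have ker: "\<Theta> Q = 0 \<longleftrightarrow> (\<forall>j\<in>Ix. F (fst j) dvd Q j)" for Q
  proof -
    have "\<Theta> Q = 0 \<longleftrightarrow> \<pi> Q = \<pi> 0" using \<Theta>I[of 0 Q] \<Theta>(2)[of Q] by auto
    then show ?thesis by (simp add: \<pi>_eq_iff fun_apply)
  qed
  have act: "\<Theta> (\<lambda>j. p * Q j) = act ?A p (\<Theta> Q)" for p Q
  proof (induction p)
    case 0
    have "\<Theta> (\<lambda>j. 0) = 0" by (simp add: ker)
    then show ?case by simp
  next
    case (pCons c p)
    have "(\<lambda>j. pCons c p * Q j) = xscale c Q + (\<lambda>j. [:0, 1:] * (p * Q j))"
      by (simp add: fun_eq_iff fun_apply xscale_def)
    then have "\<Theta> (\<lambda>j. pCons c p * Q j) = fscale c (\<Theta> Q) + mat_app ?A (\<Theta> (\<lambda>j. p * Q j))"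
      by (simp only: add scale x)
    then show ?case by (simp only: pCons.IH act_pCons)
  qed
  have "?V \<subseteq> range \<Theta>"
  proof
    fix q assume q: "q \<in> ?V"
    have "q = \<Theta> (\<Sum>k<n. xscale (q k) (P k))" by (rule \<Theta>I[OF q, symmetric]) (simp add: qcomb_def)
    then show "q \<in> range \<Theta>" by blast
  qed
  then have "range \<Theta> = ?V" using \<Theta>(1) by blast
  then have "model n ?A \<Theta>" using A' add act ker unfolding model_def by blast
  then show ?thesis by (rule exI[of _ \<Theta>])
qed

end

section \<open>From matrices to lattices\<close>

text \<open>Isomorphisms of lattices arrive as additive maps. Scaling by a natural number is
  repeated addition, and negative integers follow by cancellation, so such maps are linear over the
  integers.\<close>

lemma additive_fscale:
  fixes h :: "(nat \<Rightarrow> int) \<Rightarrow> nat \<Rightarrow> int"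
  assumes add: "\<And>v w. v \<in> vecs n \<Longrightarrow> w \<in> vecs n \<Longrightarrow> h (v + w) = h v + h w" and v: "v \<in> vecs n"
  shows "h (fscale c v) = fscale c (h v)"
proof -
  have "h (0 + 0) = h 0 + h 0" by (rule add) simp_all
  then have 0: "h 0 = 0" by simp
  have nat: "h (fscale (int k) v) = fscale (int k) (h v)" for k
  proof (induction k)
    case (Suc k)
    then show ?case using v by (simp add: fscale_add add)
  qed (simp add: 0)
  show ?thesis
  proof (cases "c \<ge> 0")
    case True
    then show ?thesis using nat[of "nat c"] by simp
  next
    case False
    then have c: "c + int (nat (- c)) = 0" by simp
    have "h (fscale c v) + h (fscale (int (nat (- c))) v) = h (fscale (c + int (nat (- c))) v)"
      using v by (simp only: fscale_add add vecs_fscale)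
    then have "h (fscale c v) + fscale (int (nat (- c))) (h v) = 0"
      unfolding c nat by (simp add: 0)
    moreover have "fscale c (h v) + fscale (int (nat (- c))) (h v) = 0"
      unfolding fscale_add(1)[symmetric] c by simp
    ultimately show ?thesis by (metis add_right_cancel)
  qed
qed

lemma mat_app_act:
  assumes V: "\<And>a. a \<in> vecs n \<Longrightarrow> mat_app V (mat_app A a) = mat_app B (mat_app V a)"
    and A: "A \<in> carrier_mat n n" and a: "a \<in> vecs n"
  shows "mat_app V (act A g a) = act B g (mat_app V a)"
proof (induction g)
  case (pCons c g)
  have "act A g a \<in> vecs n" using A a by (intro act_vecs) auto
  then show ?case using pCons.IH by (simp add: act_pCons mat_app_add mat_app_fscale V)
qed simp

text \<open>An additive bijection of integer column vectors and its inverse are both given by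
  integer matrices, so the conjugating matrix is invertible over the integers and not only over the
  rationals.\<close>

lemma similar_mat_if_intertwined:
  fixes A B :: "int mat"
  assumes A: "A \<in> carrier_mat n n" and B: "B \<in> carrier_mat n n"
    and h: "bij_betw h (vecs n) (vecs n)"
    and add: "\<And>v w. v \<in> vecs n \<Longrightarrow> w \<in> vecs n \<Longrightarrow> h (v + w) = h v + h w"
    and comm: "\<And>a. a \<in> vecs n \<Longrightarrow> h (mat_app A a) = mat_app B (h a)"
  shows "similar_mat A B"
proof -
  define h' where "h' = inv_into (vecs n) h"
  have h_vecs: "h v \<in> vecs n" if "v \<in> vecs n" for v using bij_betw_apply[OF h that] .
  have h'_vecs: "h' v \<in> vecs n" if "v \<in> vecs n" for v
    using bij_betw_apply[OF bij_betw_inv_into[OF h] that] by (simp add: h'_def)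
  have h'_h: "h' (h v) = v" if "v \<in> vecs n" for v
    unfolding h'_def by (rule bij_betw_inv_into_left[OF h that])
  have h_h': "h (h' v) = v" if "v \<in> vecs n" for v
    unfolding h'_def by (rule bij_betw_inv_into_right[OF h that])
  have add': "h' (v + w) = h' v + h' w" if "v \<in> vecs n" "w \<in> vecs n" for v w
  proof -
    have "h (h' v + h' w) = v + w" using that by (simp add: add h'_vecs h_h')
    then show ?thesis using h'_h[of "h' v + h' w"] that h'_vecs by simp
  qed
  define V where "V = mat n n (\<lambda>(i, j). h (unit_fun j) i)"
  define U where "U = mat n n (\<lambda>(i, j). h' (unit_fun j) i)"
  have U: "U \<in> carrier_mat n n" and V: "V \<in> carrier_mat n n" by (simp_all add: U_def V_def)
  have app_V: "mat_app V v = h v" if "v \<in> vecs n" for v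
    unfolding V_def by (rule mat_of_linear[OF add additive_fscale[OF add] h_vecs that])
  have app_U: "mat_app U v = h' v" if "v \<in> vecs n" for v
    unfolding U_def by (rule mat_of_linear[OF add' additive_fscale[OF add'] h'_vecs that])
  have UV: "U * V = 1\<^sub>m n"
  proof (rule mat_eq_by_app)
    fix v :: "nat \<Rightarrow> int" assume v: "v \<in> vecs n"
    show "mat_app (U * V) v = mat_app (1\<^sub>m n) v"
      using U V v by (simp add: mat_app_mult app_V app_U h_vecs h'_h mat_app_one)
  qed (use U V in auto)
  have VU: "V * U = 1\<^sub>m n"
  proof (rule mat_eq_by_app)
    fix v :: "nat \<Rightarrow> int" assume v: "v \<in> vecs n"
    show "mat_app (V * U) v = mat_app (1\<^sub>m n) v"
      using U V v by (simp add: mat_app_mult app_V app_U h'_vecs h_h' mat_app_one)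
  qed (use U V in auto)
  have "A = U * B * V"
  proof (rule mat_eq_by_app[OF A])
    fix v :: "nat \<Rightarrow> int" assume v: "v \<in> vecs n"
    have "mat_app A v = h' (mat_app B (h v))"
      unfolding comm[OF v, symmetric] using A by (simp add: h'_h)
    also have "\<dots> = mat_app (U * B * V) v"
      using A B U V v by (simp add: mat_app_mult app_V app_U)
    finally show "mat_app A v = mat_app (U * B * V) v" .
  qed (use U V B in auto)
  then show ?thesis using A B U V UV VU by (intro similar_matI[of A B U V n]) auto
qed

text \<open>\<open>R\<close> is the pullback of \<open>E\<close> along \<open>rep\<close>, so
  classes of \<open>R\<close> embed into classes of \<open>E\<close>, and \<open>surj\<close> says
  that every class is hit. Taking the \<open>E\<close>-image of all representatives of a class
  avoids choosing a member of it.\<close>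

lemma bij_betw_quotient:
  assumes E: "equiv S E" and rep: "\<And>x. x \<in> L \<Longrightarrow> rep x \<in> S"
    and R: "\<And>x y. (x, y) \<in> R \<longleftrightarrow> x \<in> L \<and> y \<in> L \<and> (rep x, rep y) \<in> E"
    and surj: "\<And>s. s \<in> S \<Longrightarrow> \<exists>x\<in>L. (rep x, s) \<in> E"
  shows "x \<in> L \<Longrightarrow> E `` (rep ` (R `` {x})) = E `` {rep x}"
    and "bij_betw (\<lambda>C. E `` (rep ` C)) (L // R) (S // E)"
proof -
  have refl: "(rep x, rep x) \<in> E" if "x \<in> L" for x
    using E rep[OF that] by (simp add: equiv_def refl_on_def)
  have sym: "(b, a) \<in> E" if "(a, b) \<in> E" for a b using E that by (meson equivE symE)
  have trans: "(a, c) \<in> E" if "(a, b) \<in> E" "(b, c) \<in> E" for a b c using E that by (meson equivE transE)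
  have image: "E `` (rep ` (R `` {x})) = E `` {rep x}" if x: "x \<in> L" for x
  proof
    show "E `` (rep ` (R `` {x})) \<subseteq> E `` {rep x}" using trans by (auto simp: R)
    have "x \<in> R `` {x}" using x refl by (simp add: R)
    then show "E `` {rep x} \<subseteq> E `` (rep ` (R `` {x}))" by blast
  qed
  show "x \<in> L \<Longrightarrow> E `` (rep ` (R `` {x})) = E `` {rep x}" by (rule image)
  show "bij_betw (\<lambda>C. E `` (rep ` C)) (L // R) (S // E)"
    unfolding bij_betw_def
  proof
    show "inj_on (\<lambda>C. E `` (rep ` C)) (L // R)"
    proof (rule inj_onI)
      fix C D assume C: "C \<in> L // R" and D: "D \<in> L // R" and eq: "E `` (rep ` C) = E `` (rep ` D)"
      obtain x where x: "x \<in> L" "C = R `` {x}" using C by (rule quotientE)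
      obtain y where y: "y \<in> L" "D = R `` {y}" using D by (rule quotientE)
      have "E `` {rep x} = E `` {rep y}" using eq image x y by simp
      then have xy: "(rep x, rep y) \<in> E" using refl[OF y(1)] by blast
      have "(x, z) \<in> R \<longleftrightarrow> (y, z) \<in> R" for z
        using x(1) y(1) trans[OF xy] trans[OF sym[OF xy]] by (auto simp: R)
      then show "C = D" unfolding x(2) y(2) by auto
    qed
    show "(\<lambda>C. E `` (rep ` C)) ` (L // R) = S // E"
    proof
      show "(\<lambda>C. E `` (rep ` C)) ` (L // R) \<subseteq> S // E"
      proof
        fix Z assume "Z \<in> (\<lambda>C. E `` (rep ` C)) ` (L // R)"
        then obtain C where C: "C \<in> L // R" "Z = E `` (rep ` C)" by blast
        obtain x where x: "x \<in> L" "C = R `` {x}" using C(1) by (rule quotientE)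
        then have "Z = E `` {rep x}" using C(2) image by simp
        then show "Z \<in> S // E" using rep[OF x(1)] by (simp add: quotientI)
      qed
      show "S // E \<subseteq> (\<lambda>C. E `` (rep ` C)) ` (L // R)"
      proof
        fix Z assume "Z \<in> S // E"
        then obtain s where s: "s \<in> S" "Z = E `` {s}" by (rule quotientE)
        obtain x where x: "x \<in> L" "(rep x, s) \<in> E" using surj[OF s(1)] by blast
        have "Z = E `` {rep x}" unfolding s(2) using equiv_class_eq[OF E x(2)] by simp
        also have "\<dots> = E `` (rep ` (R `` {x}))" using image[OF x(1)] by simp
        finally show "Z \<in> (\<lambda>C. E `` (rep ` C)) ` (L // R)"
          by (intro image_eqI[of _ _ "R `` {x}"]) (simp_all add: x(1) quotientI)
      qed
    qed
  qed
qed

lemma equiv_int_conj_rel: "equiv (int_matrices m c) (int_conj_rel m c)"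
proof (rule equivI)
  show "int_conj_rel m c \<subseteq> int_matrices m c \<times> int_matrices m c" by (auto simp: int_conj_rel_def)
  show "refl_on (int_matrices m c) (int_conj_rel m c)"
    by (auto simp: refl_on_def int_conj_rel_def int_matrices_def intro: similar_mat_refl)
  show "sym (int_conj_rel m c)" by (auto simp: sym_def int_conj_rel_def intro: similar_mat_sym)
  show "trans (int_conj_rel m c)" by (auto simp: trans_def int_conj_rel_def intro: similar_mat_trans)
qed

section \<open>Integer matrices, models and lattices\<close>

context irreducible_factors begin

abbreviation m :: "int poly" where "m \<equiv> \<Prod>i<r. f i"

abbreviation c :: "int poly" where "c \<equiv> \<Prod>i<r. f i ^ e i"

lemma of_int_poly_m: "of_int_poly m = (\<Prod>i<r. F i)"
  by (simp add: F_def of_int_poly_hom.hom_prod)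

lemma of_int_poly_c: "of_int_poly c = (\<Prod>i<r. F i ^ e i)"
  by (simp add: F_def of_int_poly_hom.hom_prod of_int_poly_hom.hom_power)

text \<open>The characteristic polynomial is computed over the rationals and descends because
  integer polynomials embed; its degree then reveals the size \<open>n\<close>. This is where the
  rank of a lattice is determined.\<close>

lemma int_matrices_if_model:
  assumes A: "A \<in> carrier_mat n n" and model: "model n (map_mat of_int A) \<Theta>"
  shows "A \<in> int_matrices m c" "n = Polynomial.degree c"
proof -
  have "of_int_poly (char_poly A) = (of_int_poly c :: rat poly)"
    unfolding of_int_poly_c of_int_hom.char_poly_hom[OF A, symmetric] by (rule model_char_poly[OF model])
  then have char: "char_poly A = c" by (simp only: of_int_poly_hom.eq_iff)
  show n: "n = Polynomial.degree c" using degree_monic_char_poly[OF A] char by simp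
  have "is_min_poly (map_mat of_int A) (of_int_poly m :: rat poly)"
    unfolding of_int_poly_m
    by (rule is_min_poly_prodI[OF _ model_mat_poly_eq_0_iff[OF model]]) (use A in simp)
  then show "A \<in> int_matrices m c" using A char n by (simp add: int_matrices_def)
qed

lemma model_of_int_matrices:
  assumes "A \<in> int_matrices m c"
  shows "\<exists>\<Theta>. model (Polynomial.degree c) (map_mat of_int A) \<Theta>"
proof (rule model_exists)
  have A: "A \<in> carrier_mat (Polynomial.degree c) (Polynomial.degree c)"
    using assms by (simp add: int_matrices_def)
  then show "map_mat rat_of_int A \<in> carrier_mat (Polynomial.degree c) (Polynomial.degree c)" by simp
  show "is_min_poly (map_mat rat_of_int A) (\<Prod>i<r. F i)"
    using assms unfolding of_int_poly_m[symmetric] by (simp add: int_matrices_def)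
  have "char_poly A = c" using assms by (simp add: int_matrices_def)
  then show "char_poly (map_mat rat_of_int A) = (\<Prod>i<r. F i ^ e i)"
    unfolding of_int_poly_c[symmetric] using of_int_hom.char_poly_hom[OF A] by simp
qed

text \<open>The lattice consists of the elements with integral image under the model, with basis the
  preimages of the unit vectors. It is stable under \<open>R\<close> because \<open>A\<close> is
  integral, and full because denominators can be cleared.\<close>

lemma lattice_of_model:
  assumes A: "A \<in> carrier_mat n n" and model: "model n (map_mat of_int A) \<Theta>"
  shows "\<exists>I P. I \<in> lattices r f e \<and> bij_betw (zcomb n P) (vecs n) I \<and>
    (\<forall>a\<in>vecs n. alpha r f e \<otimes>\<^bsub>K\<^esub> zcomb n P a = zcomb n P (mat_app A a))"
proof -
  have range: "range \<Theta> = vecs n" and add: "\<And>Q R. \<Theta> (Q + R) = \<Theta> Q + \<Theta> R"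
    and act: "\<And>p Q. \<Theta> (\<lambda>j. p * Q j) = act (map_mat of_int A) p (\<Theta> Q)"
    and ker: "\<And>Q. \<Theta> Q = 0 \<longleftrightarrow> (\<forall>j\<in>Ix. F (fst j) dvd Q j)"
    using model by (auto simp: model_def)
  have scale: "\<Theta> (xscale q Q) = fscale q (\<Theta> Q)" for q Q
    using act[of "[:q:]" Q] by (simp add: xscale_def act_const)
  have \<Theta>_eq: "\<Theta> Q = \<Theta> R \<longleftrightarrow> \<pi> Q = \<pi> R" for Q R
  proof -
    have "\<Theta> Q = \<Theta> (Q - R) + \<Theta> R" using add[of "Q - R" R] by simp
    then have "\<Theta> Q = \<Theta> R \<longleftrightarrow> \<Theta> (Q - R) = 0" by simp
    then show ?thesis by (simp add: ker \<pi>_eq_iff fun_apply)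
  qed
  have "\<forall>k. \<exists>Q. k < n \<longrightarrow> \<Theta> Q = unit_fun k"
    using range unit_fun_vecs by (metis imageE)
  then obtain P where P: "\<And>k. k < n \<Longrightarrow> \<Theta> (P k) = unit_fun k" by metis
  have \<Theta>_P: "\<Theta> (\<Sum>k<n. xscale (q k) (P k)) = q" if "q \<in> vecs n" for q
  proof -
    have "\<Theta> (\<Sum>k<n. xscale (q k) (P k)) = (\<Sum>k<n. fscale (q k) (unit_fun k))"
      unfolding model_sum[OF model] by (intro sum.cong) (simp_all add: scale P)
    then show ?thesis using vecs_expand[OF that] by simp
  qed
  have app: "alpha r f e \<otimes>\<^bsub>K\<^esub> zcomb n P a = zcomb n P (mat_app A a)" if a: "a \<in> vecs n" for a
  proof -
    have "\<Theta> (\<lambda>j. [:0, 1:] * (\<Sum>k<n. xscale (of_int (a k)) (P k)) j) = (\<lambda>k. of_int (mat_app A a k))"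
      unfolding act act_x using \<Theta>_P[of "\<lambda>k. of_int (a k)"] a by (simp only: vecs_of_int mat_app_of_int)
    also have "\<dots> = \<Theta> (\<Sum>k<n. xscale (of_int (mat_app A a k)) (P k))"
      using A by (intro \<Theta>_P[symmetric]) (simp add: vecs_of_int)
    finally show ?thesis unfolding \<Theta>_eq qcomb_def alpha_mult .
  qed
  define I where "I = zcomb n P ` vecs n"
  \<comment> \<open>Membership as integrality of coordinates: closure under negation and under
    \<open>R\<close>, and fullness, are checked in this form.\<close>
  have mem_I: "\<pi> Q \<in> I \<longleftrightarrow> (\<exists>a. \<Theta> Q = (\<lambda>k. of_int (a k)))" for Q
  proof
    assume "\<pi> Q \<in> I"
    then obtain a where a: "a \<in> vecs n" "\<pi> Q = zcomb n P a" by (auto simp: I_def)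
    then have "\<Theta> Q = (\<lambda>k. of_int (a k))"
      using \<Theta>_P[of "\<lambda>k. of_int (a k)"] unfolding qcomb_def \<Theta>_eq[symmetric] by (simp add: vecs_of_int)
    then show "\<exists>a. \<Theta> Q = (\<lambda>k. of_int (a k))" by (rule exI[of _ a])
  next
    assume "\<exists>a. \<Theta> Q = (\<lambda>k. of_int (a k))"
    then obtain a :: "nat \<Rightarrow> int" where a: "\<Theta> Q = (\<lambda>k. of_int (a k))" by (elim exE)
    have "\<Theta> Q \<in> vecs n" using range by blast
    then have "a \<in> vecs n" unfolding a by (simp add: vecs_of_int)
    moreover have "\<pi> Q = zcomb n P a"
      using \<Theta>_P[of "\<lambda>k. of_int (a k)"] \<open>a \<in> vecs n\<close> unfolding qcomb_def \<Theta>_eq[symmetric]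
      by (simp add: vecs_of_int a)
    ultimately show "\<pi> Q \<in> I" by (simp add: I_def)
  qed
  have I_carrier: "I \<subseteq> carrier K" by (auto simp: I_def)
  have bij: "bij_betw (zcomb n P) (vecs n) I"
    unfolding bij_betw_def
  proof
    show "inj_on (zcomb n P) (vecs n)"
    proof (rule inj_onI)
      fix a b :: "nat \<Rightarrow> int" assume ab: "a \<in> vecs n" "b \<in> vecs n" "zcomb n P a = zcomb n P b"
      then have "(\<lambda>k. rat_of_int (a k)) = (\<lambda>k. of_int (b k))"
        using \<Theta>_P[of "\<lambda>k. of_int (a k)"] \<Theta>_P[of "\<lambda>k. of_int (b k)"]
        unfolding qcomb_def \<Theta>_eq[symmetric] by (simp add: vecs_of_int)
      then show "a = b" by (simp add: fun_eq_iff)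
    qed
  qed (simp add: I_def)
  have sub: "subgroup I (add_monoid K)"
  proof (rule K.add.subgroupI)
    have "zcomb n P 0 \<in> I" unfolding I_def by (intro image_eqI[of _ _ 0]) simp_all
    then show "I \<noteq> {}" by blast
    fix x assume x: "x \<in> I"
    obtain Q where Q: "x = \<pi> Q" using carrier_K_obtain[OF subsetD[OF I_carrier x]] .
    obtain a where "\<Theta> Q = (\<lambda>k. of_int (a k))" using x mem_I unfolding Q by blast
    then have "\<Theta> (xscale (- 1) Q) = (\<lambda>k. of_int (- a k))" by (simp add: scale fscale_def)
    then have "\<pi> (xscale (- 1) Q) \<in> I" unfolding mem_I by (rule exI[of _ "\<lambda>k. - a k"])
    moreover have "\<pi> (xscale (- 1) Q) = \<ominus>\<^bsub>K\<^esub> x"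
      unfolding Q \<pi>_minus by (rule \<pi>_cong) (simp add: xscale_def)
    ultimately show "\<ominus>\<^bsub>K\<^esub> x \<in> I" by simp
    fix y assume y: "y \<in> I"
    from x obtain a where "a \<in> vecs n" "x = zcomb n P a" unfolding I_def by (elim imageE)
    moreover from y obtain b where "b \<in> vecs n" "y = zcomb n P b" unfolding I_def by (elim imageE)
    ultimately have "a + b \<in> vecs n" "x \<oplus>\<^bsub>K\<^esub> y = zcomb n P (a + b)" by (simp_all add: zcomb_add)
    then show "x \<oplus>\<^bsub>K\<^esub> y \<in> I" unfolding I_def by (intro image_eqI[of _ _ "a + b"])
  qed (use I_carrier in auto)
  have gens: "I = generate (add_monoid K) ((\<lambda>k. \<pi> (P k)) ` {..<n})"
  proof
    have P_I: "(\<lambda>k. \<pi> (P k)) ` {..<n} \<subseteq> I"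
      using bij_betw_apply[OF bij unit_fun_vecs] by (auto simp: zcomb_unit)
    show "generate (add_monoid K) ((\<lambda>k. \<pi> (P k)) ` {..<n}) \<subseteq> I"
      by (rule K.add.generate_subgroup_incl[OF P_I sub])
    have gen: "subgroup (generate (add_monoid K) ((\<lambda>k. \<pi> (P k)) ` {..<n})) (add_monoid K)"
      by (rule K.add.generate_is_subgroup) auto
    show "I \<subseteq> generate (add_monoid K) ((\<lambda>k. \<pi> (P k)) ` {..<n})"
    proof
      fix x assume "x \<in> I"
      then obtain a where "x = zcomb n P a" unfolding I_def by (elim imageE)
      then show "x \<in> generate (add_monoid K) ((\<lambda>k. \<pi> (P k)) ` {..<n})"
        using subgroup_zcomb[OF gen, of n P a] by (simp add: generate.incl)
    qed
  qed
  have full: "generate (add_monoid K) {Q_embed r f e q \<otimes>\<^bsub>K\<^esub> w | q w. w \<in> I} = carrier K"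
  proof
    have "Q_embed r f e q \<otimes>\<^bsub>K\<^esub> w \<in> carrier K" if "w \<in> I" for q w
    proof -
      have "w \<in> carrier K" using that I_carrier by blast
      then obtain Q where "w = \<pi> Q" by (rule carrier_K_obtain)
      then show ?thesis by (simp add: Q_embed_mult)
    qed
    then have "{Q_embed r f e q \<otimes>\<^bsub>K\<^esub> w | q w. w \<in> I} \<subseteq> carrier K" by auto
    then show "generate (add_monoid K) {Q_embed r f e q \<otimes>\<^bsub>K\<^esub> w | q w. w \<in> I} \<subseteq> carrier K"
      by (rule K.add.generate_incl)
    show "carrier K \<subseteq> generate (add_monoid K) {Q_embed r f e q \<otimes>\<^bsub>K\<^esub> w | q w. w \<in> I}"
    proof
      fix x assume "x \<in> carrier K"
      then obtain Q where Q: "x = \<pi> Q" by (rule carrier_K_obtain)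
      have "\<Theta> Q \<in> vecs n" using range by blast
      then obtain d :: int and a where d: "d > 0" "a \<in> vecs n" "fscale (of_int d) (\<Theta> Q) = (\<lambda>k. of_int (a k))"
        by (rule common_denominator_fun)
      then have "\<pi> (xscale (of_int d) Q) \<in> I" unfolding mem_I scale by blast
      moreover have "x = Q_embed r f e (inverse (of_int d)) \<otimes>\<^bsub>K\<^esub> \<pi> (xscale (of_int d) Q)"
        using d(1) by (simp add: Q_embed_mult Q)
      ultimately show "x \<in> generate (add_monoid K) {Q_embed r f e q \<otimes>\<^bsub>K\<^esub> w | q w. w \<in> I}"
        by (intro generate.incl) blast
    qed
  qed
  have closed: "\<rho> \<otimes>\<^bsub>K\<^esub> w \<in> I" if \<rho>: "\<rho> \<in> R_order r f e" and w: "w \<in> I" for \<rho> w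
  proof -
    obtain g where g: "\<rho> = \<pi> (\<lambda>_. of_int_poly g)" using \<rho> unfolding R_order_eq by blast
    obtain Q where Q: "w = \<pi> Q" using carrier_K_obtain[OF subsetD[OF I_carrier w]] .
    obtain a :: "nat \<Rightarrow> int" where a: "\<Theta> Q = (\<lambda>k. of_int (a k))" using w mem_I unfolding Q by blast
    have "\<Theta> (\<lambda>j. of_int_poly g * Q j) = (\<lambda>k. of_int (act A g a k))"
      unfolding act a by (rule act_of_int)
    then show ?thesis unfolding g Q \<pi>_mult mem_I by blast
  qed
  have "finite ((\<lambda>k. \<pi> (P k)) ` {..<n})" "(\<lambda>k. \<pi> (P k)) ` {..<n} \<subseteq> I"
    using bij_betw_apply[OF bij unit_fun_vecs] by (auto simp: zcomb_unit)
  then have "full_lattice r f e I" unfolding full_lattice_def using sub gens full by blast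
  then have "I \<in> lattices r f e" using closed by (simp add: lattices_def)
  then show ?thesis using bij app by blast
qed

text \<open>Every element of \<open>R\<close> is an integer polynomial in \<alpha>, so Horner's rule
  extends the known action of \<alpha> to all of \<open>R\<close>.\<close>

lemma R_order_zcomb:
  assumes A: "A \<in> carrier_mat n n"
    and app: "\<And>a. a \<in> vecs n \<Longrightarrow> alpha r f e \<otimes>\<^bsub>K\<^esub> zcomb n P a = zcomb n P (mat_app A a)"
    and a: "a \<in> vecs n"
  shows "\<pi> (\<lambda>_. of_int_poly g) \<otimes>\<^bsub>K\<^esub> zcomb n P a = zcomb n P (act A g a)"
proof (induction g)
  case 0
  show ?case unfolding qcomb_def \<pi>_mult by (rule \<pi>_cong) (simp add: fun_apply)
next
  case (pCons k g)
  let ?s = "\<Sum>k<n. xscale (of_int (a k)) (P k)"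
  have "act A g a \<in> vecs n" using A a by (intro act_vecs) auto
  then have "zcomb n P (act A (pCons k g) a) =
      zcomb n P (fscale k a) \<oplus>\<^bsub>K\<^esub> alpha r f e \<otimes>\<^bsub>K\<^esub> zcomb n P (act A g a)"
    unfolding act_pCons zcomb_add by (simp only: app)
  also have "\<dots> = \<pi> (xscale (of_int k) ?s) \<oplus>\<^bsub>K\<^esub> alpha r f e \<otimes>\<^bsub>K\<^esub> (\<pi> (\<lambda>_. of_int_poly g) \<otimes>\<^bsub>K\<^esub> \<pi> ?s)"
    unfolding pCons.IH[symmetric] zcomb_fscale by (simp only: qcomb_def)
  also have "\<dots> = \<pi> (\<lambda>_. of_int_poly (pCons k g)) \<otimes>\<^bsub>K\<^esub> \<pi> ?s"
    unfolding \<pi>_mult alpha_mult \<pi>_add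
    by (rule \<pi>_cong) (simp add: fun_apply xscale_def of_int_hom.map_poly_pCons_hom)
  finally show ?case by (simp only: qcomb_def)
qed

section \<open>Isomorphism and conjugacy\<close>

lemma R_isomorphic_iff:
  assumes I: "bij_betw (zcomb n P) (vecs n) I" and J: "bij_betw (zcomb n Q) (vecs n) J"
    and A: "A \<in> carrier_mat n n" and B: "B \<in> carrier_mat n n"
    and app_A: "\<And>a. a \<in> vecs n \<Longrightarrow> alpha r f e \<otimes>\<^bsub>K\<^esub> zcomb n P a = zcomb n P (mat_app A a)"
    and app_B: "\<And>a. a \<in> vecs n \<Longrightarrow> alpha r f e \<otimes>\<^bsub>K\<^esub> zcomb n Q a = zcomb n Q (mat_app B a)"
  shows "R_isomorphic r f e I J \<longleftrightarrow> similar_mat A B"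
proof
  assume "R_isomorphic r f e I J"
  then obtain \<phi> where iso: "\<phi> \<in> iso (add_monoid K \<lparr>carrier := I\<rparr>) (add_monoid K \<lparr>carrier := J\<rparr>)"
    and lin: "\<And>\<rho> w. \<rho> \<in> R_order r f e \<Longrightarrow> w \<in> I \<Longrightarrow> \<phi> (\<rho> \<otimes>\<^bsub>K\<^esub> w) = \<rho> \<otimes>\<^bsub>K\<^esub> \<phi> w"
    unfolding R_isomorphic_def by blast
  have hom: "\<phi> (x \<oplus>\<^bsub>K\<^esub> y) = \<phi> x \<oplus>\<^bsub>K\<^esub> \<phi> y" if "x \<in> I" "y \<in> I" for x y
    using iso that by (simp add: iso_def hom_def)
  have bij: "bij_betw \<phi> I J" using iso by (simp add: iso_def)
  \<comment> \<open>The isomorphism in coordinates. It commutes with multiplication by \<alpha>,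
    since \<alpha> lies in \<open>R\<close>, and this is the intertwining of \<open>A\<close> and
    \<open>B\<close>.\<close>
  define h where "h = inv_into (vecs n) (zcomb n Q) \<circ> (\<phi> \<circ> zcomb n P)"
  have h: "bij_betw h (vecs n) (vecs n)"
    unfolding h_def by (intro bij_betw_trans[OF bij_betw_trans[OF I bij]] bij_betw_inv_into[OF J])
  have P_I: "zcomb n P a \<in> I" if "a \<in> vecs n" for a using bij_betw_apply[OF I that] .
  have Q_h: "zcomb n Q (h a) = \<phi> (zcomb n P a)" if "a \<in> vecs n" for a
    using bij_betw_inv_into_right[OF J bij_betw_apply[OF bij P_I[OF that]]] by (simp add: h_def)
  have h_vecs: "h a \<in> vecs n" if "a \<in> vecs n" for a using bij_betw_apply[OF h that] .
  have Q_inj: "a = b" if "zcomb n Q a = zcomb n Q b" "a \<in> vecs n" "b \<in> vecs n" for a b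
    using inj_onD[OF bij_betw_imp_inj_on[OF J]] that by blast
  show "similar_mat A B"
  proof (rule similar_mat_if_intertwined[OF A B h])
    fix v w :: "nat \<Rightarrow> int" assume v: "v \<in> vecs n" and w: "w \<in> vecs n"
    have "zcomb n Q (h (v + w)) = zcomb n Q (h v + h w)"
      using v w by (simp add: Q_h zcomb_add hom P_I)
    then show "h (v + w) = h v + h w" by (rule Q_inj) (simp_all add: v w h_vecs)
  next
    fix a :: "nat \<Rightarrow> int" assume a: "a \<in> vecs n"
    have Aa: "mat_app A a \<in> vecs n" using A by simp
    have "zcomb n Q (h (mat_app A a)) = \<phi> (alpha r f e \<otimes>\<^bsub>K\<^esub> zcomb n P a)"
      unfolding Q_h[OF Aa] app_A[OF a] ..
    also have "\<dots> = alpha r f e \<otimes>\<^bsub>K\<^esub> zcomb n Q (h a)"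
      unfolding Q_h[OF a] by (rule lin[OF alpha_R_order P_I[OF a]])
    also have "\<dots> = zcomb n Q (mat_app B (h a))" by (rule app_B[OF h_vecs[OF a]])
    finally show "h (mat_app A a) = mat_app B (h a)"
      by (rule Q_inj) (use B h_vecs[OF Aa] in simp_all)
  qed
next
  assume "similar_mat A B"
  then obtain n' U V where "{A, B, U, V} \<subseteq> carrier_mat n' n'"
    and UV: "U * V = 1\<^sub>m n'" and VU: "V * U = 1\<^sub>m n'" and eq: "A = U * B * V"
    using similar_matD by blast
  moreover have n': "n' = n" using calculation(1) A by auto
  ultimately have U: "U \<in> carrier_mat n n" and V: "V \<in> carrier_mat n n" by auto
  have VU_app: "mat_app V (mat_app U a) = a" if "a \<in> vecs n" for a
    using mat_app_mult[of V U a] U V that VU n' by (simp add: mat_app_one)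
  have UV_app: "mat_app U (mat_app V a) = a" if "a \<in> vecs n" for a
    using mat_app_mult[of U V a] U V that UV n' by (simp add: mat_app_one)
  \<comment> \<open>From \<open>A = U * B * V\<close> and \<open>V * U = 1\<close>, the matrix
    \<open>V\<close> carries the action of \<open>A\<close> to that of \<open>B\<close>; the
    isomorphism below is \<open>V\<close> read through the two bases.\<close>
  have V_A: "mat_app V (mat_app A a) = mat_app B (mat_app V a)" if a: "a \<in> vecs n" for a
  proof -
    have "mat_app A a = mat_app U (mat_app B (mat_app V a))"
      unfolding eq using U V B by (simp add: mat_app_mult)
    then show ?thesis using B by (simp add: VU_app)
  qed
  have V_bij: "bij_betw (mat_app V) (vecs n) (vecs n)"
    by (rule bij_betw_byWitness[where f' = "mat_app U"]) (use U V in \<open>auto simp: UV_app VU_app\<close>)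
  define \<phi> where "\<phi> = zcomb n Q \<circ> (mat_app V \<circ> inv_into (vecs n) (zcomb n P))"
  have bij: "bij_betw \<phi> I J"
    unfolding \<phi>_def by (intro bij_betw_trans[OF bij_betw_trans[OF bij_betw_inv_into[OF I] V_bij]] J)
  have \<phi>: "\<phi> (zcomb n P a) = zcomb n Q (mat_app V a)" if "a \<in> vecs n" for a
    using bij_betw_inv_into_left[OF I that] by (simp add: \<phi>_def)
  have I_cases: "\<exists>a\<in>vecs n. x = zcomb n P a" if "x \<in> I" for x
  proof -
    have "x \<in> zcomb n P ` vecs n" using bij_betw_imp_surj_on[OF I] that by simp
    then show ?thesis by blast
  qed
  have hom: "\<phi> (x \<oplus>\<^bsub>K\<^esub> y) = \<phi> x \<oplus>\<^bsub>K\<^esub> \<phi> y" if xy: "x \<in> I" "y \<in> I" for x y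
  proof -
    obtain a b where ab: "a \<in> vecs n" "b \<in> vecs n" "x = zcomb n P a" "y = zcomb n P b"
      using I_cases[OF xy(1)] I_cases[OF xy(2)] by blast
    have "\<phi> (zcomb n P (a + b)) = zcomb n Q (mat_app V (a + b))" by (rule \<phi>) (simp add: ab)
    then show ?thesis unfolding ab(3,4) \<phi>[OF ab(1)] \<phi>[OF ab(2)] mat_app_add zcomb_add .
  qed
  have lin: "\<phi> (\<rho> \<otimes>\<^bsub>K\<^esub> w) = \<rho> \<otimes>\<^bsub>K\<^esub> \<phi> w" if \<rho>: "\<rho> \<in> R_order r f e" and w: "w \<in> I" for \<rho> w
  proof -
    obtain g where g: "\<rho> = \<pi> (\<lambda>_. of_int_poly g)" using \<rho> unfolding R_order_eq by blast
    obtain a where a: "a \<in> vecs n" "w = zcomb n P a" using I_cases[OF w] by blast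
    have act: "act A g a \<in> vecs n" using A a(1) by (intro act_vecs) auto
    have "\<rho> \<otimes>\<^bsub>K\<^esub> w = zcomb n P (act A g a)"
      unfolding g a(2) by (rule R_order_zcomb[OF A app_A a(1)])
    then have "\<phi> (\<rho> \<otimes>\<^bsub>K\<^esub> w) = zcomb n Q (mat_app V (act A g a))"
      by (simp only: \<phi>[OF act])
    also have "mat_app V (act A g a) = act B g (mat_app V a)" by (rule mat_app_act[OF V_A A a(1)])
    also have "zcomb n Q (act B g (mat_app V a)) = \<rho> \<otimes>\<^bsub>K\<^esub> zcomb n Q (mat_app V a)"
      unfolding g by (rule R_order_zcomb[OF B app_B, symmetric]) (use V in auto)
    finally show ?thesis unfolding a(2) \<phi>[OF a(1)] .
  qed
  have "\<phi> \<in> iso (add_monoid K \<lparr>carrier := I\<rparr>) (add_monoid K \<lparr>carrier := J\<rparr>)"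
    using bij hom bij_betw_apply[OF bij] by (auto simp: iso_def hom_def)
  then show "R_isomorphic r f e I J" unfolding R_isomorphic_def using lin by blast
qed

section \<open>From bases to classes\<close>

lemma lattice_matrix:
  assumes I: "I \<in> lattices r f e" and ws: "is_Z_basis K I ws"
  defines "n \<equiv> Polynomial.degree c"
  shows "mult_matrix r f e ws \<in> int_matrices m c"
    and "\<exists>P. bij_betw (zcomb n P) (vecs n) I \<and> (\<forall>a\<in>vecs n.
      alpha r f e \<otimes>\<^bsub>K\<^esub> zcomb n P a = zcomb n P (mat_app (mult_matrix r f e ws) a))"
proof -
  have "set ws \<subseteq> carrier K" using ws lattice_subset[OF I] unfolding is_Z_basis_def by blast
  then obtain P where P: "\<And>k. k < length ws \<Longrightarrow> ws ! k = \<pi> (P k)" using representatives by blast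
  have bij: "bij_betw (zcomb (length ws) P) (vecs (length ws)) I"
    using Z_basis_iff[OF latticesD(1)[OF I] refl P] ws by blast
  obtain A where A: "A \<in> carrier_mat (length ws) (length ws)"
    and app: "\<And>a. a \<in> vecs (length ws) \<Longrightarrow>
      alpha r f e \<otimes>\<^bsub>K\<^esub> zcomb (length ws) P a = zcomb (length ws) P (mat_app A a)"
    using multiplication_matrix[OF I bij] by blast
  have mult: "mult_matrix r f e ws = A"
    by (rule mult_matrix_eqI[OF refl P bij_betw_imp_inj_on[OF bij] A app])
  obtain \<Theta> where \<Theta>: "model (length ws) (map_mat of_int A) \<Theta>"
    using lattice_model[OF I bij A app] by blast
  \<comment> \<open>Only here is the length of the basis seen to be the degree of \<open>c\<close>:
    it is the size of a matrix admitting a model.\<close>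
  have len: "length ws = n" unfolding n_def by (rule int_matrices_if_model(2)[OF A \<Theta>])
  show "mult_matrix r f e ws \<in> int_matrices m c" unfolding mult by (rule int_matrices_if_model(1)[OF A \<Theta>])
  show "\<exists>P. bij_betw (zcomb n P) (vecs n) I \<and> (\<forall>a\<in>vecs n.
      alpha r f e \<otimes>\<^bsub>K\<^esub> zcomb n P a = zcomb n P (mat_app (mult_matrix r f e ws) a))"
    using bij app unfolding mult len by blast
qed

lemma Z_basis_of_bij:
  assumes I: "I \<in> lattices r f e" and bij: "bij_betw (zcomb n P) (vecs n) I"
  shows "is_Z_basis K I (map (\<lambda>k. \<pi> (P k)) [0..<n])"
proof -
  have "is_Z_basis K I (map (\<lambda>k. \<pi> (P k)) [0..<n]) \<longleftrightarrow> bij_betw (zcomb n P) (vecs n) I"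
    by (rule Z_basis_iff[OF latticesD(1)[OF I]]) simp_all
  then show ?thesis using bij by (rule iffD2)
qed

lemma Z_basis_exists:
  assumes I: "I \<in> lattices r f e"
  shows "\<exists>ws. is_Z_basis K I ws"
proof -
  obtain n P where "bij_betw (zcomb n P) (vecs n) I" using lattice_basis_exists[OF I] by (elim exE)
  from Z_basis_of_bij[OF I this] show ?thesis by (rule exI)
qed

lemma R_iso_rel_iff:
  assumes I: "I \<in> lattices r f e" "is_Z_basis K I ws" and J: "J \<in> lattices r f e" "is_Z_basis K J ws'"
  shows "(I, J) \<in> R_iso_rel r f e \<longleftrightarrow>
    (mult_matrix r f e ws, mult_matrix r f e ws') \<in> int_conj_rel m c"
proof -
  obtain P where P: "bij_betw (zcomb (Polynomial.degree c) P) (vecs (Polynomial.degree c)) I"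
    "\<And>a. a \<in> vecs (Polynomial.degree c) \<Longrightarrow> alpha r f e \<otimes>\<^bsub>K\<^esub> zcomb (Polynomial.degree c) P a =
      zcomb (Polynomial.degree c) P (mat_app (mult_matrix r f e ws) a)"
    using lattice_matrix(2)[OF I] by blast
  obtain Q where Q: "bij_betw (zcomb (Polynomial.degree c) Q) (vecs (Polynomial.degree c)) J"
    "\<And>a. a \<in> vecs (Polynomial.degree c) \<Longrightarrow> alpha r f e \<otimes>\<^bsub>K\<^esub> zcomb (Polynomial.degree c) Q a =
      zcomb (Polynomial.degree c) Q (mat_app (mult_matrix r f e ws') a)"
    using lattice_matrix(2)[OF J] by blast
  have mem: "mult_matrix r f e ws \<in> int_matrices m c" "mult_matrix r f e ws' \<in> int_matrices m c"
    using lattice_matrix(1) I J by blast+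
  then have "R_isomorphic r f e I J \<longleftrightarrow> similar_mat (mult_matrix r f e ws) (mult_matrix r f e ws')"
    by (intro R_isomorphic_iff[OF P(1) Q(1) _ _ P(2) Q(2)]) (auto simp: int_matrices_def)
  then show ?thesis using I J mem by (simp add: R_iso_rel_def int_conj_rel_def)
qed

lemma lattice_of_matrix:
  assumes "A \<in> int_matrices m c"
  shows "\<exists>I ws. I \<in> lattices r f e \<and> is_Z_basis K I ws \<and> mult_matrix r f e ws = A"
proof -
  define n where "n = Polynomial.degree c"
  have A: "A \<in> carrier_mat n n" using assms by (simp add: int_matrices_def n_def)
  obtain \<Theta> where \<Theta>: "model n (map_mat of_int A) \<Theta>"
    using model_of_int_matrices[OF assms] unfolding n_def by blast
  obtain I P where I: "I \<in> lattices r f e" and bij: "bij_betw (zcomb n P) (vecs n) I"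
    and app: "\<And>a. a \<in> vecs n \<Longrightarrow> alpha r f e \<otimes>\<^bsub>K\<^esub> zcomb n P a = zcomb n P (mat_app A a)"
    using lattice_of_model[OF A \<Theta>] by blast
  have "mult_matrix r f e (map (\<lambda>k. \<pi> (P k)) [0..<n]) = A"
    by (rule mult_matrix_eqI[OF _ _ bij_betw_imp_inj_on[OF bij] A app]) simp_all
  then show ?thesis using I Z_basis_of_bij[OF I bij] by blast
qed

theorem lattice_classes_bij:
  "\<exists>\<Phi>. (\<forall>I \<in> lattices r f e. \<forall>ws. is_Z_basis K I ws \<longrightarrow>
        \<Phi> (R_iso_rel r f e `` {I}) = int_conj_rel m c `` {mult_matrix r f e ws}) \<and>
      bij_betw \<Phi> (lattices r f e // R_iso_rel r f e) (int_matrices m c // int_conj_rel m c)"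
proof -
  define basis where "basis I = (SOME ws. is_Z_basis K I ws)" for I
  have basis: "is_Z_basis K I (basis I)" if "I \<in> lattices r f e" for I
    unfolding basis_def by (rule someI_ex[OF Z_basis_exists[OF that]])
  define rep where "rep I = mult_matrix r f e (basis I)" for I
  have rep: "rep I \<in> int_matrices m c" if "I \<in> lattices r f e" for I
    unfolding rep_def by (rule lattice_matrix(1)[OF that basis[OF that]])
  have R: "(I, J) \<in> R_iso_rel r f e \<longleftrightarrow>
      I \<in> lattices r f e \<and> J \<in> lattices r f e \<and> (rep I, rep J) \<in> int_conj_rel m c" for I J
  proof (cases "I \<in> lattices r f e \<and> J \<in> lattices r f e")
    case True
    then show ?thesis using R_iso_rel_iff[of I "basis I" J "basis J"] basis by (simp add: rep_def)
  qed (auto simp: R_iso_rel_def)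
  \<comment> \<open>Independence of the basis: the relation of \<open>I\<close> to itself, obtained
    from the chosen basis, is read a second time with the chosen basis on one side and
    \<open>ws\<close> on the other.\<close>
  have conj: "(rep I, mult_matrix r f e ws) \<in> int_conj_rel m c"
    if I: "I \<in> lattices r f e" and ws: "is_Z_basis K I ws" for I ws
  proof -
    have "(rep I, rep I) \<in> int_conj_rel m c"
      using rep[OF I] equiv_int_conj_rel[of m c] by (simp add: equiv_def refl_on_def)
    then have "(I, I) \<in> R_iso_rel r f e" using I R by blast
    then show ?thesis unfolding rep_def R_iso_rel_iff[OF I basis[OF I] I ws] .
  qed
  have surj: "\<exists>I\<in>lattices r f e. (rep I, A) \<in> int_conj_rel m c" if "A \<in> int_matrices m c" for A
    using lattice_of_matrix[OF that] conj by blast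
  note quot = bij_betw_quotient[where L = "lattices r f e" and rep = rep and R = "R_iso_rel r f e",
      OF equiv_int_conj_rel rep R surj]
  have image: "int_conj_rel m c `` (rep ` (R_iso_rel r f e `` {I})) = int_conj_rel m c `` {rep I}"
    if "I \<in> lattices r f e" for I
    by (rule quot(1)) (assumption | rule that)+
  show ?thesis
  proof (intro exI conjI ballI allI impI)
    show "bij_betw (\<lambda>C. int_conj_rel m c `` (rep ` C)) (lattices r f e // R_iso_rel r f e)
        (int_matrices m c // int_conj_rel m c)"
      by (rule quot(2)) assumption+
    fix I ws assume I: "I \<in> lattices r f e" and ws: "is_Z_basis K I ws"
    show "int_conj_rel m c `` (rep ` (R_iso_rel r f e `` {I})) = int_conj_rel m c `` {mult_matrix r f e ws}"
      unfolding image[OF I] by (rule equiv_class_eq[OF equiv_int_conj_rel conj[OF I ws]])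
  qed
qed

end

theorem theorem8p1:
  fixes r :: nat and f :: "nat \<Rightarrow> int poly" and e :: "nat \<Rightarrow> nat" and m c :: "int poly"
  assumes "inj_on f {..<r}"
    and "\<And>i. i < r \<Longrightarrow> Factorial_Ring.irreducible (f i)"
    and "\<And>i. i < r \<Longrightarrow> monic (f i)"
    and "\<And>i. i < r \<Longrightarrow> e i > 0"
    and "m = (\<Prod>i<r. f i)"
    and "c = (\<Prod>i<r. f i ^ e i)"
  shows "(\<forall>I \<in> lattices r f e. \<exists>ws. is_Z_basis (K_alg r f e) I ws) \<and>
    (\<forall>I \<in> lattices r f e. \<forall>ws. is_Z_basis (K_alg r f e) I ws \<longrightarrow>
       mult_matrix r f e ws \<in> int_matrices m c) \<and>
    (\<exists>\<Phi>. (\<forall>I \<in> lattices r f e. \<forall>ws. is_Z_basis (K_alg r f e) I ws \<longrightarrow>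
              \<Phi> (R_iso_rel r f e `` {I}) = int_conj_rel m c `` {mult_matrix r f e ws}) \<and>
          bij_betw \<Phi> (lattices r f e // R_iso_rel r f e)
                     (int_matrices m c // int_conj_rel m c))"
proof -
  interpret irreducible_factors r f e by unfold_locales (fact assms)+
  show ?thesis unfolding assms(5,6)
    using Z_basis_exists lattice_matrix(1) lattice_classes_bij by blast
qed

end
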